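(* Let $\sigma=(\sigma_{ij})_{1\le i\le d,\,1\le j\le r}$ and $b=(b_1,\dots,b_d)$ have $C^\infty$ entries on $\mathbb{R}^d$ with bounded derivatives. Fix $p\ge5$. Then the pair $(L^*,A^* )$ satisfies the $(p,0)$ Monotonicity inequality: for every compact subset $K$ of $\mathbb{R}^d$ there is a constant $C_K>0$ such that $$2\langle\phi,L^*\phi\rangle_0+\sum_{i=1}^r\|A_i^*\phi\|_0^2\le C_K\|\phi\|_0^2\qquad\text{for all }\phi\in\mathcal{S}_p\cap\mathcal{E}'(K).$$
   Context: For $p\in\mathbb{R}$, $\mathcal{S}_p$ is the Hermite-Sobolev space: the completion of the Schwartz space $\mathcal{S}$ on $\mathbb{R}^d$ in the norm $\|\cdot\|_p$ given by $\langle f,g\rangle_p=\sum_{k}(2|k|+d)^{2p}\langle f,h_k\rangle\langle g,h_k\rangle$, where $k$ ranges over multi-indices, $\{h_k\}$ is the orthonormal basis of $L^2(\mathbb{R}^d)$ of Hermite functions and $\langle\cdot,\cdot\rangle$ is the $L^2$ inner product; thus $\mathcal{S}_0=L^2(\mathbb{R}^d)$, and $\langle\cdot,\cdot\rangle_0$, $\|\cdot\|_0$ are the $L^2$ inner product and norm. $\mathcal{E}'(K)$ is the set of distributions on $\mathbb{R}^d$ with support contained in $K$. "Bounded derivatives" means that partial derivatives (of order at least one) are bounded, so $\sigma,b$ have at most linear growth. The operators are $$A_i^*\psi=-\sum_{k=1}^d\partial_k(\sigma_{ki}\psi)\ (1\le i\le r),\quad A^*\psi=(A_1^*\psi,\dots,A_r^*\psi),\quad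 L^*\psi=\frac12\sum_{i,j=1}^d\partial^2_{ij}\big((\sigma\sigma^t)_{ij}\psi\big)-\sum_{i=1}^d\partial_i(b_i\psi).$$ For $p\ge5$ these are known to be bounded linear operators $L^*:\mathcal{S}_p\cap\mathcal{E}'(K)\to\mathcal{S}_0\cap\mathcal{E}'(K)$ and $A^*:\mathcal{S}_p\cap\mathcal{E}'(K)\to\mathcal{L}(\mathbb{R}^r,\mathcal{S}_0\cap\mathcal{E}'(K))$ for compact $K$. *)

theory Defs
  imports "HOL-Analysis.Analysis"
begin

section \<open>Smooth functions, test functions and Schwartz functions on R^d\<close>

definition partial :: "'d::finite \<Rightarrow> (real^'d \<Rightarrow> real) \<Rightarrow> real^'d \<Rightarrow> real" where
  "partial i f x = frechet_derivative f (at x) (axis i 1)"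

text \<open>The list \<open>[i1, ..., im]\<close> stands for the operator \<open>partial i1 ... partial im\<close> of order \<open>m\<close>.\<close>

fun partials :: "'d::finite list \<Rightarrow> (real^'d \<Rightarrow> real) \<Rightarrow> real^'d \<Rightarrow> real" where
  "partials [] f = f"
| "partials (i # is) f = partial i (partials is f)"

definition C_infinity :: "(real^'d::finite \<Rightarrow> real) \<Rightarrow> bool" where
  "C_infinity f \<longleftrightarrow> (\<forall>is. partials is f differentiable_on UNIV)"

text \<open>Only derivatives of order at least one are bounded; the function itself need not be.\<close>

definition bounded_derivatives :: "(real^'d::finite \<Rightarrow> real) \<Rightarrow> bool" where
  "bounded_derivatives f \<longleftrightarrow> (\<forall>is. is \<noteq> [] \<longrightarrow> bounded (range (partials is f)))"

definition fun_support :: "(real^'d::finite \<Rightarrow> real) \<Rightarrow> (real^'d) set" where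
  "fun_support f = closure {x. f x \<noteq> 0}"

definition test_functions :: "(real^'d::finite \<Rightarrow> real) set" where
  "test_functions = {f. C_infinity f \<and> compact (fun_support f)}"

definition schwartz :: "(real^'d::finite \<Rightarrow> real) set" where
  "schwartz = {f. C_infinity f \<and>
     (\<forall>n is. bounded (range (\<lambda>x. (1 + norm x) ^ n * partials is f x)))}"

section \<open>Distributions\<close>

text \<open>
  A generalized function is a functional on functions \<open>real^'d \<Rightarrow> real\<close>. Only its values on
  test functions (for distributions), respectively on Schwartz functions (for tempered
  distributions), are meaningful; its values elsewhere are arbitrary and never used.
  An element of both classes is a tempered distribution together with its restriction
  to test functions.
\<close>

type_synonym 'd functional = "(real^'d \<Rightarrow> real) \<Rightarrow> real"

definition linear_functional_on :: "(real^'d::finite \<Rightarrow> real) set \<Rightarrow> 'd functional \<Rightarrow> bool" where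
  "linear_functional_on X u \<longleftrightarrow>
     (\<forall>f\<in>X. \<forall>g\<in>X. \<forall>a c. u (\<lambda>x. a * f x + c * g x) = a * u f + c * u g)"

definition distribution :: "'d::finite functional \<Rightarrow> bool" where
  "distribution u \<longleftrightarrow> linear_functional_on test_functions u \<and>
     (\<forall>K. compact K \<longrightarrow> (\<exists>C N. \<forall>f\<in>test_functions. fun_support f \<subseteq> K \<longrightarrow>
        \<bar>u f\<bar> \<le> C * (\<Sum>is | length is \<le> N. SUP x. \<bar>partials is f x\<bar>)))"

definition tempered :: "'d::finite functional \<Rightarrow> bool" where
  "tempered u \<longleftrightarrow> linear_functional_on schwartz u \<and>
     (\<exists>C N. \<forall>f\<in>schwartz.
        \<bar>u f\<bar> \<le> C * (\<Sum>is | length is \<le> N. SUP x. (1 + norm x) ^ N * \<bar>partials is f x\<bar>))"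

definition dist_support :: "'d::finite functional \<Rightarrow> (real^'d) set" where
  "dist_support u =
     - \<Union>{U. open U \<and> (\<forall>f\<in>test_functions. fun_support f \<subseteq> U \<longrightarrow> u f = 0)}"

definition dist_supported_in :: "(real^'d::finite) set \<Rightarrow> 'd functional set" where
  "dist_supported_in K = {u. distribution u \<and> dist_support u \<subseteq> K}"

definition of_fun :: "(real^'d::finite \<Rightarrow> real) \<Rightarrow> 'd functional" where
  "of_fun f = (\<lambda>g. LINT x|lborel. f x * g x)"

definition dist_partial :: "'d::finite \<Rightarrow> 'd functional \<Rightarrow> 'd functional" where
  "dist_partial i u = (\<lambda>f. - u (partial i f))"

definition dist_mult :: "(real^'d::finite \<Rightarrow> real) \<Rightarrow> 'd functional \<Rightarrow> 'd functional" where
  "dist_mult g u = (\<lambda>f. u (\<lambda>x. g x * f x))"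

section \<open>Hermite functions and Hermite-Sobolev spaces\<close>

text \<open>
  \<open>hermite1 n x = (2^n n! sqrt pi)^(-1/2) H_n(x) exp(-x^2/2)\<close>, where
  \<open>H_n(x) = (-1)^n exp(x^2) (d/dx)^n exp(-x^2)\<close> is the physicists' Hermite polynomial.
  With this normalization \<open>hermite k\<close> is an eigenfunction of \<open>|x|^2 - Laplacian\<close> with
  eigenvalue \<open>2|k| + d\<close>, the weight in the norm below.
\<close>

definition hermite1 :: "nat \<Rightarrow> real \<Rightarrow> real" where
  "hermite1 n x = (-1) ^ n * exp (x\<^sup>2 / 2) * (deriv ^^ n) (\<lambda>t. exp (- t\<^sup>2)) x
     / sqrt (2 ^ n * fact n * sqrt pi)"

definition hermite :: "('d::finite \<Rightarrow> nat) \<Rightarrow> real^'d \<Rightarrow> real" where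
  "hermite k x = (\<Prod>i\<in>UNIV. hermite1 (k i) (x $ i))"

text \<open>
  For a Schwartz function \<open>f\<close>, \<open>of_fun f (hermite k)\<close> is the \<open>L2\<close> inner product of \<open>f\<close> with
  the \<open>k\<close>-th Hermite function. For \<open>u\<close> in the completion, the \<open>k\<close>-th coefficient is the
  value \<open>u (hermite k)\<close>, so that the same formula is the continuous extension of the inner
  product. For two elements of \<open>hermite_sobolev p\<close> the sum converges absolutely.
\<close>

definition hs_inner :: "real \<Rightarrow> 'd::finite functional \<Rightarrow> 'd functional \<Rightarrow> real" where
  "hs_inner p u v =
     (\<Sum>\<^sub>\<infinity>k\<in>UNIV. real (2 * (\<Sum>i\<in>UNIV. k i) + CARD('d)) powr (2 * p)
        * u (hermite k) * v (hermite k))"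

definition hs_norm :: "real \<Rightarrow> 'd::finite functional \<Rightarrow> real" where
  "hs_norm p u = sqrt (hs_inner p u u)"

text \<open>
  The completion of the Schwartz space in \<open>hs_norm p\<close>, realized inside the tempered
  distributions: a class of Cauchy sequences is identified with its common limit.
\<close>

definition hermite_sobolev :: "real \<Rightarrow> 'd::finite functional set" where
  "hermite_sobolev p = {u. tempered u \<and>
     (\<exists>F :: nat \<Rightarrow> real^'d \<Rightarrow> real.
        (\<forall>n. F n \<in> schwartz) \<and>
        (\<forall>e>0. \<exists>N. \<forall>m\<ge>N. \<forall>n\<ge>N. hs_norm p (of_fun (\<lambda>x. F m x - F n x)) < e) \<and>
        (\<forall>g\<in>schwartz. (\<lambda>n. of_fun (F n) g) \<longlonglongrightarrow> u g))}"

section \<open>The operators\<close>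

definition A_star ::
  "(real^'d::finite \<Rightarrow> real^'r^'d) \<Rightarrow> 'r::finite \<Rightarrow> 'd functional \<Rightarrow> 'd functional" where
  "A_star \<sigma> i u =
     (\<lambda>f. - (\<Sum>k\<in>UNIV. dist_partial k (dist_mult (\<lambda>x. \<sigma> x $ k $ i) u) f))"

definition L_star ::
  "(real^'d::finite \<Rightarrow> real^'r::finite^'d) \<Rightarrow> (real^'d \<Rightarrow> real^'d)
     \<Rightarrow> 'd functional \<Rightarrow> 'd functional" where
  "L_star \<sigma> b u =
     (\<lambda>f. 1/2 * (\<Sum>i\<in>UNIV. \<Sum>j\<in>UNIV.
             dist_partial i (dist_partial j
               (dist_mult (\<lambda>x. (\<sigma> x ** transpose (\<sigma> x)) $ i $ j) u)) f)
          - (\<Sum>i\<in>UNIV. dist_partial i (dist_mult (\<lambda>x. b x $ i) u) f))"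

end

(*
  Integrating by parts for Schwartz functions F, the left-hand side of the inequality becomes the
  integral of V F^2 with V = (1/2) sum_i ((div s_i)^2 + tr (D s_i)^2) - div b, where s_i is the i-th
  column of sigma. The terms with second derivatives of sigma, which the linear growth of sigma could
  make unbounded, cancel, so V is bounded and the inequality holds for all Schwartz functions.

  For phi in S_p, the approximating Schwartz functions F_n are Cauchy in the norm of order 2. The
  coefficients of L^* grow at most quadratically, so by the ladder relations of the Hermite functions
  L^* F_n and A_i^* F_n are Cauchy in L^2, and the inequality passes to the limit in the Hermite
  coefficients. This uses Parseval's identity, i.e. completeness of the Hermite functions: a
  Stone-Weierstrass argument approximates by polynomials times exp (- m |x|^2 / 4 - |x|^2 / 2), whose
  Gaussian factors are then expanded into power series.
*)
theory Submission
  imports Defs "HOL-Probability.Sinc_Integral"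
begin

text \<open>Variable coefficients have no explicit action on Hermite expansions; only coordinates
  and partial derivatives do. \<open>L_star\<close> is therefore dominated pointwise by
  \<open>1 + |x|^2\<close> times derivatives of order at most two, and only these comparison
  operators are measured through Hermite coefficients. Two coordinates and two derivatives make four
  ladder steps. Each costs one power of the weight \<open>2|k| + d\<close> in the squared norm,
  hence the norm of order 2.

  The term \<open><phi, L^* phi>\<close> is bilinear, while the limit argument controls sums of
  squares; polarization with \<open>phi + L^* phi\<close> and \<open>phi - L^* phi\<close> bridges
  the gap. A distribution enters only through its values: the operators act on the test function, so
  pointwise convergence on Schwartz functions already identifies the limits of all Hermite
  coefficients.

  The cancellation of second derivatives of sigma becomes visible once each column's share of the
  second-order term is written as the square of its first-order operator plus the divergence of
  \<open>(D s) s F\<close>.\<close>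

section \<open>Calculus of partial derivatives\<close>

lemma partial_eq:
  "(f has_derivative f') (at x) \<Longrightarrow> partial i f x = f' (axis i 1)"
  unfolding partial_def by (metis frechet_derivative_at)

lemma has_derivative_partial:
  fixes f :: "real^'d::finite \<Rightarrow> real"
  assumes "f differentiable (at x)"
  shows "(f has_derivative (\<lambda>h. \<Sum>i\<in>UNIV. h $ i * partial i f x)) (at x)"
proof -
  let ?D = "frechet_derivative f (at x)"
  have D: "(f has_derivative ?D) (at x)"
    using assms frechet_derivative_works by blast
  then have lin: "linear ?D" by (rule has_derivative_linear)
  have "?D h = (\<Sum>i\<in>UNIV. h $ i * partial i f x)" for h
  proof -
    have "?D h = ?D (\<Sum>i\<in>UNIV. (h $ i) *\<^sub>R axis i 1)"
      using basis_expansion[of h] by (simp add: scalar_mult_eq_scaleR)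
    also have "\<dots> = (\<Sum>i\<in>UNIV. h $ i * ?D (axis i 1))"
      by (simp add: linear_sum[OF lin] linear_cmul[OF lin])
    finally show ?thesis unfolding partial_def .
  qed
  then show ?thesis using D by (metis (no_types, lifting) ext)
qed

lemma partial_add:
  assumes "f differentiable (at x)" "g differentiable (at x)"
  shows "partial i (\<lambda>x. f x + g x) x = partial i f x + partial i g x"
  using assms[unfolded frechet_derivative_works]
  by (subst partial_eq[OF has_derivative_add]) (auto simp: partial_def algebra_simps)

lemma partial_mult:
  assumes "f differentiable (at x)" "g differentiable (at x)"
  shows "partial i (\<lambda>x. f x * g x) x = partial i f x * g x + f x * partial i g x"
  using assms[unfolded frechet_derivative_works]
  by (subst partial_eq[OF has_derivative_mult]) (auto simp: partial_def algebra_simps)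

lemma partial_const [simp]: "partial i (\<lambda>x. c) = (\<lambda>x. 0)"
  by (rule ext, rule partial_eq[THEN trans, OF has_derivative_const]) simp

lemma partial_cmult:
  "f differentiable (at x) \<Longrightarrow> partial i (\<lambda>x. c * f x) x = c * partial i f x"
  by (subst partial_mult) auto

lemma partial_uminus:
  "f differentiable (at x) \<Longrightarrow> partial i (\<lambda>x. - f x) x = - partial i f x"
  using partial_cmult[of f x i "-1"] by simp

lemma partial_diff:
  "f differentiable (at x) \<Longrightarrow> g differentiable (at x) \<Longrightarrow>
   partial i (\<lambda>x. f x - g x) x = partial i f x - partial i g x"
  using partial_add[of f x "\<lambda>x. - g x" i] by (simp add: partial_uminus)

lemma partial_sum:
  assumes "\<And>a. a \<in> A \<Longrightarrow> f a differentiable (at x)"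
  shows "partial i (\<lambda>x. \<Sum>a\<in>A. f a x) x = (\<Sum>a\<in>A. partial i (f a) x)"
  using assms[unfolded frechet_derivative_works]
  by (subst partial_eq[OF has_derivative_sum]) (auto simp: partial_def)

lemma partial_coord: "partial i (\<lambda>x. x $ j) = (\<lambda>x. if i = j then 1 else 0)"
  by (rule ext, rule partial_eq[THEN trans, OF bounded_linear_imp_has_derivative])
    (auto simp: bounded_linear_vec_nth axis_def)

lemma partials_append: "partials (is @ js) f = partials is (partials js f)"
  by (induction "is") auto

text \<open>In HOL \<open>0 powr 0 = 0\<close>, so reducing \<open>(1 + norm x) powr 0\<close> to 1
  requires a nonzero base.\<close>

lemma one_norm_nz: "1 + norm x \<noteq> 0"
  using norm_ge_zero[of x] by linarith

section \<open>Symbol classes\<close>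

text \<open>All derivatives share one exponent, with no gain per derivative. This is what the
  hypotheses on the coefficients provide: they lie in \<open>symb 1\<close> and their derivatives in
  \<open>symb 0\<close>.\<close>

definition symb :: "real \<Rightarrow> (real^'d::finite \<Rightarrow> real) set" where
  "symb m = {f. C_infinity f \<and> (\<forall>is. \<exists>C. \<forall>x. \<bar>partials is f x\<bar> \<le> C * (1 + norm x) powr m)}"

text \<open>Replaces induction over lists of derivatives, and with it the higher Leibniz rule: it
  suffices to exhibit a set that is stable under single partial derivatives and whose members obey
  the growth bound.\<close>

lemma symb_coinduct:
  assumes "f \<in> X"
    and d: "\<And>g x. g \<in> X \<Longrightarrow> g differentiable (at x)"
    and p: "\<And>g i. g \<in> X \<Longrightarrow> partial i g \<in> X"
    and b: "\<And>g. g \<in> X \<Longrightarrow> \<exists>C. \<forall>x. \<bar>g x\<bar> \<le> C * (1 + norm x) powr m"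
  shows "f \<in> symb m"
proof -
  have "partials is f \<in> X" for "is" by (induction "is") (auto simp: assms(1) p)
  then show ?thesis unfolding symb_def C_infinity_def
    using d b by (auto simp: differentiable_on_def)
qed

lemma symb_bound: "f \<in> symb m \<Longrightarrow> \<exists>C. \<forall>x. \<bar>f x\<bar> \<le> C * (1 + norm x) powr m"
  unfolding symb_def by (force dest: spec[of _ "[]"])

lemma symb_boundE:
  assumes "f \<in> symb m"
  obtains C where "C \<ge> 0" "\<And>x. \<bar>f x\<bar> \<le> C * (1 + norm x) powr m"
proof -
  obtain C where C: "\<And>x. \<bar>f x\<bar> \<le> C * (1 + norm x) powr m" using symb_bound[OF assms] by auto
  have "0 \<le> C" using C[of 0] by simp
  then show ?thesis using C that by blast
qed

lemma symb_differentiable: "f \<in> symb m \<Longrightarrow> f differentiable (at x)"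
  unfolding symb_def C_infinity_def differentiable_on_def by (force dest: spec[of _ "[]"])

lemma symb_continuous_on: "f \<in> symb m \<Longrightarrow> continuous_on S f"
  by (meson continuous_at_imp_continuous_on differentiable_imp_continuous_within symb_differentiable)

lemma symb_measurable: "f \<in> symb m \<Longrightarrow> f \<in> borel_measurable borel"
  by (rule borel_measurable_continuous_onI, rule symb_continuous_on)

lemma symb_partial: "f \<in> symb m \<Longrightarrow> partial i f \<in> symb m"
  unfolding symb_def C_infinity_def
  by (auto simp: partials_append[of _ "[i]", simplified, symmetric])

lemma symb_partials: "f \<in> symb m \<Longrightarrow> partials is f \<in> symb m"
  by (induction "is") (auto simp: symb_partial)

lemma symb_mono: assumes "f \<in> symb m" "m \<le> n" shows "f \<in> symb n"
proof (rule symb_coinduct[where X = "symb m"])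
  fix g :: "real^'a \<Rightarrow> real" assume "g \<in> symb m"
  then obtain C where C: "C \<ge> 0" "\<And>x. \<bar>g x\<bar> \<le> C * (1 + norm x) powr m" using symb_boundE by blast
  have "\<bar>g x\<bar> \<le> C * (1 + norm x) powr n" for x
  proof -
    have "C * (1 + norm x) powr m \<le> C * (1 + norm x) powr n"
      using C(1) assms(2) by (intro mult_left_mono powr_mono) auto
    then show ?thesis using C(2)[of x] by linarith
  qed
  then show "\<exists>C. \<forall>x. \<bar>g x\<bar> \<le> C * (1 + norm x) powr n" by blast
qed (use assms in \<open>auto simp: symb_partial symb_differentiable\<close>)

lemma symb_add: assumes "f \<in> symb m" "g \<in> symb m" shows "(\<lambda>x. f x + g x) \<in> symb m"
proof (rule symb_coinduct[where X = "{\<lambda>x. f x + g x | f g. f \<in> symb m \<and> g \<in> symb m}"])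
  fix h :: "real^'a \<Rightarrow> real" and i assume "h \<in> {\<lambda>x. f x + g x | f g. f \<in> symb m \<and> g \<in> symb m}"
  then obtain f g where h: "h = (\<lambda>x. f x + g x)" and f: "f \<in> symb m" and g: "g \<in> symb m" by blast
  have "partial i h = (\<lambda>x. partial i f x + partial i g x)"
    unfolding h using f g by (auto simp: partial_add symb_differentiable)
  then show "partial i h \<in> {\<lambda>x. f x + g x | f g. f \<in> symb m \<and> g \<in> symb m}"
    using symb_partial f g by blast
next
  fix h :: "real^'a \<Rightarrow> real" assume "h \<in> {\<lambda>x. f x + g x | f g. f \<in> symb m \<and> g \<in> symb m}"
  then obtain f g where h: "h = (\<lambda>x. f x + g x)" and f: "f \<in> symb m" and g: "g \<in> symb m" by blast
  obtain C where "\<And>x. \<bar>f x\<bar> \<le> C * (1 + norm x) powr m" using symb_bound[OF f] by blast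
  moreover obtain D where "\<And>x. \<bar>g x\<bar> \<le> D * (1 + norm x) powr m" using symb_bound[OF g] by blast
  ultimately have "\<bar>h x\<bar> \<le> (C + D) * (1 + norm x) powr m" for x
    unfolding h distrib_right by (meson abs_triangle_ineq add_mono order_trans)
  then show "\<exists>C. \<forall>x. \<bar>h x\<bar> \<le> C * (1 + norm x) powr m" by blast
qed (use assms in \<open>auto simp: symb_differentiable\<close>)

lemma symb_const: "m \<ge> 0 \<Longrightarrow> (\<lambda>x. c) \<in> symb m"
  by (rule symb_mono[OF symb_coinduct[where X = "range (\<lambda>c x. c)" and m = 0]])
    (auto simp: image_iff one_norm_nz)

lemma symb_coord: "(\<lambda>x. x $ i) \<in> symb 1"
proof (rule symb_coinduct[where X = "insert (\<lambda>x. x $ i) (symb 0)"])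
  fix g :: "real^'a \<Rightarrow> real" assume "g \<in> insert (\<lambda>x. x $ i) (symb 0)"
  moreover have "\<bar>x $ i\<bar> \<le> 1 * (1 + norm x) powr 1" for x :: "real^'a"
    using component_le_norm_cart[of x i] by simp
  ultimately show "\<exists>C. \<forall>x. \<bar>g x\<bar> \<le> C * (1 + norm x) powr 1"
    using symb_bound[OF symb_mono[of g 0 1]] by fastforce
next
  fix g :: "real^'a \<Rightarrow> real" and j assume "g \<in> insert (\<lambda>x. x $ i) (symb 0)"
  then show "partial j g \<in> insert (\<lambda>x. x $ i) (symb 0)"
    by (auto simp: partial_coord symb_const symb_partial)
qed (auto simp: symb_differentiable bounded_linear_vec_nth bounded_linear_imp_differentiable)

text \<open>The derivative of a product is a sum of two products, so products alone are not stable
  under \<open>partial\<close>; their finite sums are, and they serve as the coinduction set in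
  \<open>symb_mult\<close>.\<close>

inductive_set sum_products :: "('a \<Rightarrow> real) set \<Rightarrow> ('a \<Rightarrow> real) set \<Rightarrow> ('a \<Rightarrow> real) set"
  for A B where
  prod: "f \<in> A \<Longrightarrow> g \<in> B \<Longrightarrow> (\<lambda>x. f x * g x) \<in> sum_products A B"
| add: "u \<in> sum_products A B \<Longrightarrow> v \<in> sum_products A B \<Longrightarrow> (\<lambda>x. u x + v x) \<in> sum_products A B"

lemma symb_mult:
  fixes f g :: "real^'d::finite \<Rightarrow> real"
  assumes "f \<in> symb m" "g \<in> symb n" shows "(\<lambda>x. f x * g x) \<in> symb (m + n)"
proof (rule symb_coinduct[where X = "sum_products (symb m) (symb n)"])
  show "(\<lambda>x. f x * g x) \<in> sum_products (symb m) (symb n)"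
    by (rule sum_products.prod[OF assms])
next
  fix h :: "real^'d \<Rightarrow> real" and x assume "h \<in> sum_products (symb m) (symb n)"
  then show "h differentiable (at x)" by induction (auto simp: symb_differentiable)
next
  have dif: "h differentiable (at x)" if "h \<in> sum_products (symb m) (symb n)" for h :: "real^'d \<Rightarrow> real" and x
    using that by induction (auto simp: symb_differentiable)
  fix h :: "real^'d \<Rightarrow> real" and i assume "h \<in> sum_products (symb m) (symb n)"
  then show "partial i h \<in> sum_products (symb m) (symb n)"
  proof induction
    case (prod f g)
    have "partial i (\<lambda>x. f x * g x) = (\<lambda>x. partial i f x * g x + f x * partial i g x)"
      using prod by (auto simp: partial_mult symb_differentiable)
    also have "\<dots> \<in> sum_products (symb m) (symb n)"
      using prod by (intro sum_products.intros symb_partial)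
    finally show ?case .
  next
    case (add u v)
    have "partial i (\<lambda>x. u x + v x) = (\<lambda>x. partial i u x + partial i v x)"
      using add by (auto simp: partial_add dif)
    with add show ?case by (auto intro: sum_products.intros)
  qed
next
  fix h :: "real^'d \<Rightarrow> real" assume "h \<in> sum_products (symb m) (symb n)"
  then show "\<exists>C. \<forall>x. \<bar>h x\<bar> \<le> C * (1 + norm x) powr (m + n)"
  proof induction
    case (prod f g)
    obtain C where C: "C \<ge> 0" "\<And>x. \<bar>f x\<bar> \<le> C * (1 + norm x) powr m" using symb_boundE[OF prod(1)] by blast
    obtain D where D: "D \<ge> 0" "\<And>x. \<bar>g x\<bar> \<le> D * (1 + norm x) powr n" using symb_boundE[OF prod(2)] by blast
    have "\<bar>f x * g x\<bar> \<le> (C * D) * (1 + norm x) powr (m + n)" for x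
    proof -
      have "\<bar>f x\<bar> * \<bar>g x\<bar> \<le> (C * (1 + norm x) powr m) * (D * (1 + norm x) powr n)"
        using C D by (intro mult_mono) auto
      then show ?thesis by (simp add: abs_mult powr_add mult_ac)
    qed
    then show ?case by blast
  next
    case (add u v)
    then obtain C D where "\<And>x. \<bar>u x\<bar> \<le> C * (1 + norm x) powr (m + n)"
      "\<And>x. \<bar>v x\<bar> \<le> D * (1 + norm x) powr (m + n)" by blast
    then have "\<bar>u x + v x\<bar> \<le> (C + D) * (1 + norm x) powr (m + n)" for x
      unfolding distrib_right by (meson abs_triangle_ineq add_mono order_trans)
    then show ?case by blast
  qed
qed

lemma symb_cmult: "f \<in> symb m \<Longrightarrow> (\<lambda>x. c * f x) \<in> symb m"
  using symb_mult[OF symb_const[of 0 c], of f m] by simp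

lemma symb_uminus: "f \<in> symb m \<Longrightarrow> (\<lambda>x. - f x) \<in> symb m"
  using symb_cmult[of f m "-1"] by simp

lemma symb_diff: "f \<in> symb m \<Longrightarrow> g \<in> symb m \<Longrightarrow> (\<lambda>x. f x - g x) \<in> symb m"
  using symb_add[OF _ symb_uminus, of f m g] by simp

lemma symb_0: "(\<lambda>x. 0) \<in> symb m"
proof (rule symb_coinduct[where X = "{\<lambda>x. 0}"])
  fix g :: "real^'a \<Rightarrow> real" assume "g \<in> {\<lambda>x. 0}"
  then show "\<exists>C. \<forall>x. \<bar>g x\<bar> \<le> C * (1 + norm x) powr m" by (intro exI[of _ 0]) auto
qed auto

lemma symb_sum: "(\<And>a. a \<in> A \<Longrightarrow> f a \<in> symb m) \<Longrightarrow> (\<lambda>x. \<Sum>a\<in>A. f a x) \<in> symb m"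
proof (induction A rule: infinite_finite_induct)
  case (insert a A) then show ?case by (simp add: symb_add)
qed (auto simp: symb_0)

text \<open>With this characterization the closure properties of \<open>schwartz\<close> are read
  off from those of \<open>symb\<close>.\<close>

lemma schwartz_iff: "f \<in> schwartz \<longleftrightarrow> (\<forall>m. f \<in> symb m)"
proof
  assume f: "f \<in> schwartz"
  show "\<forall>m. f \<in> symb m"
  proof
    fix m :: real
    have "f \<in> symb (- real n)" for n
      unfolding symb_def
    proof (safe)
      show "C_infinity f" using f by (simp add: schwartz_def)
      fix "is"
      obtain C where C: "\<And>x. \<bar>(1 + norm x) ^ n * partials is f x\<bar> \<le> C"
        using f unfolding schwartz_def bounded_iff by (auto; blast)
      have "\<bar>partials is f x\<bar> \<le> C * (1 + norm x) powr (- real n)" for x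
        using C[of x] by (simp add: powr_minus powr_realpow add_pos_nonneg abs_mult field_simps)
      then show "\<exists>C. \<forall>x. \<bar>partials is f x\<bar> \<le> C * (1 + norm x) powr (- real n)" by blast
    qed
    moreover obtain n :: nat where "- real n \<le> m" using real_arch_simple[of "-m"] by (auto simp: minus_le_iff)
    ultimately show "f \<in> symb m" using symb_mono by blast
  qed
next
  assume f: "\<forall>m. f \<in> symb m"
  show "f \<in> schwartz" unfolding schwartz_def
  proof safe
    show "C_infinity f" using f by (auto simp: symb_def)
    fix n "is"
    have "partials is f \<in> symb (- real n)" using f symb_partials by blast
    then obtain C where C: "\<And>x. \<bar>partials is f x\<bar> \<le> C * (1 + norm x) powr (- real n)"
      using symb_bound by blast
    have "norm ((1 + norm x) ^ n * partials is f x) \<le> C" for x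
      using C[of x] by (simp add: powr_minus powr_realpow add_pos_nonneg abs_mult field_simps)
    then show "bounded (range (\<lambda>x. (1 + norm x) ^ n * partials is f x))"
      unfolding bounded_iff by blast
  qed
qed

lemma schwartz_symb: "f \<in> schwartz \<Longrightarrow> f \<in> symb m" by (simp add: schwartz_iff)

lemma schwartz_differentiable: "f \<in> schwartz \<Longrightarrow> f differentiable (at x)"
  using schwartz_symb symb_differentiable by blast

lemma schwartz_partial: "f \<in> schwartz \<Longrightarrow> partial i f \<in> schwartz"
  and schwartz_add: "f \<in> schwartz \<Longrightarrow> g \<in> schwartz \<Longrightarrow> (\<lambda>x. f x + g x) \<in> schwartz"
  and schwartz_diff: "f \<in> schwartz \<Longrightarrow> g \<in> schwartz \<Longrightarrow> (\<lambda>x. f x - g x) \<in> schwartz"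
  and schwartz_uminus: "f \<in> schwartz \<Longrightarrow> (\<lambda>x. - f x) \<in> schwartz"
  and schwartz_cmult: "f \<in> schwartz \<Longrightarrow> (\<lambda>x. c * f x) \<in> schwartz"
  and schwartz_sum: "(\<And>a. a \<in> A \<Longrightarrow> F a \<in> schwartz) \<Longrightarrow> (\<lambda>x. \<Sum>a\<in>A. F a x) \<in> schwartz"
  by (simp_all add: schwartz_iff symb_partial symb_add symb_diff symb_uminus symb_cmult symb_sum)

text \<open>To land in \<open>symb k\<close>, the Schwartz factor is taken in
  \<open>symb (k - m)\<close>.\<close>

lemma schwartz_mult: "f \<in> symb m \<Longrightarrow> g \<in> schwartz \<Longrightarrow> (\<lambda>x. f x * g x) \<in> schwartz"
  unfolding schwartz_iff by (metis symb_mult add.commute diff_add_cancel)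

lemma bounded_derivatives_partial:
  assumes "C_infinity f" "bounded_derivatives f"
  shows "partial i f \<in> symb 0"
  unfolding symb_def
proof safe
  show "C_infinity (partial i f)"
    using assms(1) unfolding C_infinity_def by (metis partials.simps partials_append)
  fix "is"
  have "bounded (range (partials (is @ [i]) f))" using assms(2) by (simp add: bounded_derivatives_def)
  then obtain C where "\<And>x. \<bar>partials is (partial i f) x\<bar> \<le> C"
    by (auto simp: bounded_iff partials_append)
  then show "\<exists>C. \<forall>x. \<bar>partials is (partial i f) x\<bar> \<le> C * (1 + norm x) powr 0"
    by (intro exI[of _ C]) (simp add: one_norm_nz)
qed

text \<open>A bounded gradient gives linear growth by the mean value inequality. The coinduction set
  is \<open>f\<close> together with \<open>symb 0\<close>, because every derivative of order at
  least one is bounded.\<close>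

lemma bounded_derivatives_symb:
  fixes f :: "real^'d::finite \<Rightarrow> real"
  assumes "C_infinity f" "bounded_derivatives f"
  shows "f \<in> symb 1"
proof (rule symb_coinduct[where X = "insert f (symb 0)"])
  have dif: "f differentiable (at x)" for x
    using assms(1) unfolding C_infinity_def differentiable_on_def by (force dest: spec[of _ "[]"])
  have "\<exists>C\<ge>0. \<forall>x. \<bar>partial i f x\<bar> \<le> C" for i
    by (rule symb_boundE[OF bounded_derivatives_partial[OF assms, of i]]) (auto simp: one_norm_nz)
  then obtain C where C: "\<And>i. C i \<ge> 0" "\<And>i x. \<bar>partial i f x\<bar> \<le> C i" by metis
  have on: "onorm (\<lambda>h. \<Sum>i\<in>UNIV. h $ i * partial i f x) \<le> (\<Sum>i\<in>UNIV. C i)" for x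
  proof (rule onorm_le)
    fix h :: "real^'d"
    have "norm (\<Sum>i\<in>UNIV. h $ i * partial i f x) \<le> (\<Sum>i\<in>UNIV. norm h * C i)"
      by (rule sum_norm_le) (auto simp: abs_mult intro!: mult_mono C component_le_norm_cart)
    then show "norm (\<Sum>i\<in>UNIV. h $ i * partial i f x) \<le> (\<Sum>i\<in>UNIV. C i) * norm h"
      by (simp add: sum_distrib_left mult.commute)
  qed
  have "norm (f x - f 0) \<le> (\<Sum>i\<in>UNIV. C i) * norm (x - 0)" for x
    by (rule differentiable_bound[of UNIV f]) (use dif on has_derivative_partial in \<open>auto\<close>)
  then have 1: "\<bar>f x\<bar> \<le> (\<bar>f 0\<bar> + (\<Sum>i\<in>UNIV. C i)) * (1 + norm x) powr 1" for x
  proof -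
    have "0 \<le> \<bar>f 0\<bar> * norm x" "0 \<le> (\<Sum>i\<in>UNIV. C i)" using C by (auto intro: sum_nonneg)
    moreover have "\<bar>f x - f 0\<bar> \<le> (\<Sum>i\<in>UNIV. C i) * norm x"
      using \<open>norm (f x - f 0) \<le> (\<Sum>i\<in>UNIV. C i) * norm (x - 0)\<close> by simp
    ultimately have "\<bar>f x\<bar> \<le> \<bar>f 0\<bar> + (\<Sum>i\<in>UNIV. C i) * norm x + \<bar>f 0\<bar> * norm x + (\<Sum>i\<in>UNIV. C i)"
      by linarith
    then show ?thesis by (simp add: algebra_simps)
  qed
  fix g assume g: "g \<in> insert f (symb 0)"
  then show "\<exists>C. \<forall>x. \<bar>g x\<bar> \<le> C * (1 + norm x) powr 1"
    using 1 symb_bound[OF symb_mono[of g 0 1]] by (metis insertE zero_le_one)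
  show "g differentiable (at x)" for x using g dif symb_differentiable by blast
  show "partial i g \<in> insert f (symb 0)" for i
    using g bounded_derivatives_partial[OF assms] symb_partial by blast
qed simp

section \<open>Symmetry of second derivatives\<close>

lemma symb_partial_line:
  assumes "f \<in> symb m"
  shows "((\<lambda>t. f (x + t *\<^sub>R axis i 1)) has_real_derivative partial i f (x + s *\<^sub>R axis i 1)) (at s)"
proof -
  have "((\<lambda>t. x + t *\<^sub>R axis i 1) has_derivative (\<lambda>t. t *\<^sub>R axis i 1)) (at s)"
    by (auto intro!: derivative_eq_intros)
  moreover have "(f has_derivative (\<lambda>h. \<Sum>j\<in>UNIV. h $ j * partial j f (x + s *\<^sub>R axis i 1))) (at (x + s *\<^sub>R axis i 1))"
    by (rule has_derivative_partial[OF symb_differentiable[OF assms]])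
  ultimately have "((\<lambda>t. f (x + t *\<^sub>R axis i 1)) has_derivative
      (\<lambda>t. \<Sum>j\<in>UNIV. (t *\<^sub>R axis i 1) $ j * partial j f (x + s *\<^sub>R axis i 1))) (at s)"
    by (rule has_derivative_compose)
  moreover have "(\<Sum>j\<in>UNIV. (t *\<^sub>R axis i 1) $ j * partial j f (x + s *\<^sub>R axis i 1)) =
     partial i f (x + s *\<^sub>R axis i 1) * t" for t
    by (simp add: axis_def if_distrib[of "\<lambda>u. _ * u"] if_distrib[of "\<lambda>u. u * _"] cong: if_cong)
  ultimately show ?thesis by (simp add: has_field_derivative_def)
qed

text \<open>The mean value theorem is used twice: in direction \<open>i\<close> for the increment of
  \<open>f\<close> along \<open>j\<close>, then in direction \<open>j\<close> for
  \<open>partial i f\<close>.\<close>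

lemma second_difference:
  assumes "f \<in> symb m" "h > 0"
  obtains s t where "0 \<le> s" "s \<le> h" "0 \<le> t" "t \<le> h"
    "f (x + h *\<^sub>R axis i 1 + h *\<^sub>R axis j 1) - f (x + h *\<^sub>R axis i 1) - f (x + h *\<^sub>R axis j 1) + f x =
       h\<^sup>2 * partial j (partial i f) (x + s *\<^sub>R axis i 1 + t *\<^sub>R axis j 1)"
proof -
  let ?e = "axis i 1 :: real^'a" and ?e' = "axis j 1 :: real^'a"
  let ?g = "\<lambda>s. f (x + h *\<^sub>R ?e' + s *\<^sub>R ?e) - f (x + s *\<^sub>R ?e)"
  have "(?g has_real_derivative (partial i f (x + h *\<^sub>R ?e' + s *\<^sub>R ?e) - partial i f (x + s *\<^sub>R ?e))) (at s)" for s
    by (intro DERIV_diff symb_partial_line[OF assms(1)])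
  then obtain s where s: "0 < s" "s < h" "?g h - ?g 0 = (h - 0) * (partial i f (x + h *\<^sub>R ?e' + s *\<^sub>R ?e) - partial i f (x + s *\<^sub>R ?e))"
    using MVT2[of 0 h ?g "\<lambda>s. partial i f (x + h *\<^sub>R ?e' + s *\<^sub>R ?e) - partial i f (x + s *\<^sub>R ?e)"] assms(2) by blast
  let ?k = "\<lambda>t. partial i f (x + s *\<^sub>R ?e + t *\<^sub>R ?e')"
  have "(?k has_real_derivative (partial j (partial i f) (x + s *\<^sub>R ?e + t *\<^sub>R ?e'))) (at t)" for t
    by (intro symb_partial_line[OF symb_partial[OF assms(1)]])
  then obtain t where t: "0 < t" "t < h" "?k h - ?k 0 = (h - 0) * partial j (partial i f) (x + s *\<^sub>R ?e + t *\<^sub>R ?e')"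
    using MVT2[of 0 h ?k "\<lambda>t. partial j (partial i f) (x + s *\<^sub>R ?e + t *\<^sub>R ?e')"] assms(2) by blast
  have "?g h - ?g 0 = h * (?k h - ?k 0)" using s(3) by (simp add: algebra_simps)
  then have "?g h - ?g 0 = h\<^sup>2 * partial j (partial i f) (x + s *\<^sub>R ?e + t *\<^sub>R ?e')"
    unfolding t(3) by (simp add: power2_eq_square)
  then show ?thesis using that[of s t] s t by (simp add: algebra_simps)
qed

text \<open>The second difference is symmetric in \<open>i\<close> and \<open>j\<close>. Hence the
  two mixed derivatives agree at points within reach of \<open>h = 1 / (n + 1)\<close> from
  \<open>x\<close>, and continuity gives equality at \<open>x\<close>.\<close>

lemma partial_commute:
  fixes f :: "real^'a::finite \<Rightarrow> real"
  assumes f: "f \<in> symb m"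
  shows "partial i (partial j f) = partial j (partial i f)"
proof
  fix x :: "real^'a"
  let ?p = "\<lambda>s t::real. x + s *\<^sub>R axis i 1 + t *\<^sub>R axis j 1"
  have "\<forall>n::nat. \<exists>s t s' t'. 0 \<le> s \<and> s \<le> inverse (real (Suc n)) \<and> 0 \<le> t \<and> t \<le> inverse (real (Suc n)) \<and>
      0 \<le> s' \<and> s' \<le> inverse (real (Suc n)) \<and> 0 \<le> t' \<and> t' \<le> inverse (real (Suc n)) \<and>
      partial j (partial i f) (?p s t) = partial i (partial j f) (?p s' t')"
  proof
    fix n :: nat
    let ?h = "inverse (real (Suc n))"
    have h: "?h > 0" by simp
    obtain s t where st: "0 \<le> s" "s \<le> ?h" "0 \<le> t" "t \<le> ?h"
      "f (x + ?h *\<^sub>R axis i 1 + ?h *\<^sub>R axis j 1) - f (x + ?h *\<^sub>R axis i 1) - f (x + ?h *\<^sub>R axis j 1) + f x =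
       ?h\<^sup>2 * partial j (partial i f) (x + s *\<^sub>R axis i 1 + t *\<^sub>R axis j 1)"
      using second_difference[OF f h] by metis
    obtain t' s' where st': "0 \<le> t'" "t' \<le> ?h" "0 \<le> s'" "s' \<le> ?h"
      "f (x + ?h *\<^sub>R axis j 1 + ?h *\<^sub>R axis i 1) - f (x + ?h *\<^sub>R axis j 1) - f (x + ?h *\<^sub>R axis i 1) + f x =
       ?h\<^sup>2 * partial i (partial j f) (x + t' *\<^sub>R axis j 1 + s' *\<^sub>R axis i 1)"
      using second_difference[OF f h] by metis
    have "?h\<^sup>2 * partial j (partial i f) (?p s t) = ?h\<^sup>2 * partial i (partial j f) (?p s' t')"
      using st(5) st'(5) by (simp add: algebra_simps)
    then have "partial j (partial i f) (?p s t) = partial i (partial j f) (?p s' t')" using h by simp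
    then show "\<exists>s t s' t'. 0 \<le> s \<and> s \<le> inverse (real (Suc n)) \<and> 0 \<le> t \<and> t \<le> inverse (real (Suc n)) \<and>
      0 \<le> s' \<and> s' \<le> inverse (real (Suc n)) \<and> 0 \<le> t' \<and> t' \<le> inverse (real (Suc n)) \<and>
      partial j (partial i f) (?p s t) = partial i (partial j f) (?p s' t')"
      using st st' by blast
  qed
  then obtain s t s' t' where st: "\<And>n. 0 \<le> s n \<and> s n \<le> inverse (real (Suc n)) \<and> 0 \<le> t n \<and> t n \<le> inverse (real (Suc n)) \<and>
      0 \<le> s' n \<and> s' n \<le> inverse (real (Suc n)) \<and> 0 \<le> t' n \<and> t' n \<le> inverse (real (Suc n)) \<and>
      partial j (partial i f) (?p (s n) (t n)) = partial i (partial j f) (?p (s' n) (t' n))" by metis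
  have z: "a \<longlonglongrightarrow> 0" if "\<And>n. 0 \<le> a n \<and> a n \<le> inverse (real (Suc n))" for a :: "nat \<Rightarrow> real"
    by (rule tendsto_sandwich[OF _ _ tendsto_const LIMSEQ_inverse_real_of_nat]) (use that in auto)
  have p: "(\<lambda>n. ?p (a n) (c n)) \<longlonglongrightarrow> x" if "a \<longlonglongrightarrow> 0" "c \<longlonglongrightarrow> 0" for a c
    using that by (auto intro!: tendsto_eq_intros)
  have c: "(\<lambda>n. g (?p (a n) (c n))) \<longlonglongrightarrow> g x" if "a \<longlonglongrightarrow> 0" "c \<longlonglongrightarrow> 0" "g \<in> symb m" for a c g
    by (rule isCont_tendsto_compose[OF _ p[OF that(1,2)]])
      (meson differentiable_imp_continuous_within symb_differentiable that(3))
  have "(\<lambda>n. partial j (partial i f) (?p (s n) (t n))) \<longlonglongrightarrow> partial j (partial i f) x"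
    using st f by (intro c z symb_partial) auto
  moreover have "(\<lambda>n. partial i (partial j f) (?p (s' n) (t' n))) \<longlonglongrightarrow> partial i (partial j f) x"
    using st f by (intro c z symb_partial) auto
  ultimately show "partial i (partial j f) x = partial j (partial i f) x"
    using st LIMSEQ_unique by auto
qed

section \<open>Integration on R^d\<close>

text \<open>Fubini's theorem, obtained from the description of \<open>lborel\<close> as the image of
  a product measure indexed by \<open>Basis\<close>; the map \<open>axis\<close> translates between
  \<open>Basis\<close> and the index type.\<close>

lemma
  fixes f :: "'d::finite \<Rightarrow> real \<Rightarrow> real"
  assumes int: "\<And>i. integrable lborel (f i)"
  shows integrable_prod_vec: "integrable lborel (\<lambda>x::real^'d. \<Prod>i\<in>UNIV. f i (x $ i))"
    and integral_prod_vec: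
      "(LINT x|lborel. (\<Prod>i\<in>UNIV. f i ((x::real^'d) $ i))) = (\<Prod>i\<in>UNIV. LINT t|lborel. f i t)"
proof -
  let ?e = "\<lambda>i. axis i 1 :: real^'d"
  have inj: "inj ?e" by (auto simp: inj_on_def axis_eq_axis)
  have B: "(Basis::(real^'d) set) = range ?e" by (auto simp: Basis_vec_def)
  define g where "g b = f (inv ?e b)" for b
  have g: "g (?e i) = f i" for i unfolding g_def by (simp add: inv_f_f[OF inj])
  let ?T = "\<lambda>y. \<Sum>b\<in>Basis. y b *\<^sub>R b :: real^'d"
  let ?M = "\<Pi>\<^sub>M b\<in>Basis::(real^'d) set. (lborel :: real measure)"
  have nth: "?T y $ i = y (?e i)" for y i
    unfolding B by (subst sum.reindex[OF inj])
      (simp add: axis_def if_distrib[of "\<lambda>u. _ * u"] cong: if_cong)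
  have T: "(\<Prod>i\<in>UNIV. f i (?T y $ i)) = (\<Prod>b\<in>Basis. g b (y b))" for y
    unfolding nth unfolding B by (subst prod.reindex[OF inj]) (simp add: g)
  have P: "(\<Prod>b\<in>Basis. LINT t|lborel. g b t) = (\<Prod>i\<in>UNIV. LINT t|lborel. f i t)"
    unfolding B by (subst prod.reindex[OF inj]) (simp add: g)
  interpret product_sigma_finite "\<lambda>_::real^'d. lborel :: real measure" ..
  have intg: "integrable lborel (g b)" for b unfolding g_def by (rule int)
  have [measurable]: "(\<lambda>x::real^'d. x $ i) \<in> borel_measurable borel" for i
    by (intro borel_measurable_continuous_onI continuous_intros)
  have [measurable]: "f i \<in> borel_measurable borel" for i
    using borel_measurable_integrable[OF int] by simp
  have fm: "(\<lambda>x::real^'d. \<Prod>i\<in>UNIV. f i (x $ i)) \<in> borel_measurable borel"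
    by measurable
  have Tm: "?T \<in> ?M \<rightarrow>\<^sub>M borel" by measurable
  show "integrable lborel (\<lambda>x::real^'d. \<Prod>i\<in>UNIV. f i (x $ i))"
    by (subst lborel_eq, unfold integrable_distr_eq[OF Tm fm] T)
      (rule product_integrable_prod, auto intro: intg)
  show "(LINT x|lborel. (\<Prod>i\<in>UNIV. f i ((x::real^'d) $ i))) = (\<Prod>i\<in>UNIV. LINT t|lborel. f i t)"
    by (subst lborel_eq, unfold integral_distr[OF Tm fm] T P[symmetric])
      (rule product_integral_prod, auto intro: intg)
qed

lemma integrable_inverse_1_plus_square_real: "integrable lborel (\<lambda>x::real. inverse (1 + x\<^sup>2))"
  using integrable_inverse_1_plus_square by (simp add: set_integrable_def einterval_def)

text \<open>With this exponent the power of \<open>1 + norm x\<close> is at most the product over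
  the \<open>d\<close> coordinates of \<open>1 / (1 + x_i^2)\<close>, which is integrable.\<close>

abbreviation decay_exp :: "'d::finite itself \<Rightarrow> real" where
  "decay_exp _ \<equiv> - real (2 * CARD('d))"

lemma integrable_decay:
  "integrable lborel (\<lambda>x::real^'d::finite. (1 + norm x) powr (decay_exp TYPE('d)))"
proof (rule Bochner_Integration.integrable_bound)
  show "integrable lborel (\<lambda>x::real^'d. \<Prod>i\<in>UNIV. inverse (1 + (x $ i)\<^sup>2))"
    by (rule integrable_prod_vec[OF integrable_inverse_1_plus_square_real])
  show "(\<lambda>x::real^'d. (1 + norm x) powr (decay_exp TYPE('d))) \<in> borel_measurable lborel"
    by measurable
  have le: "(1 + norm x) powr (decay_exp TYPE('d)) \<le> (\<Prod>i\<in>UNIV. inverse (1 + (x $ i)\<^sup>2))" for x :: "real^'d"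
  proof -
    have "1 + (x $ i)\<^sup>2 \<le> (1 + norm x)\<^sup>2" for i
    proof -
      have "\<bar>x $ i\<bar>\<^sup>2 \<le> (norm x)\<^sup>2" by (intro power_mono component_le_norm_cart) auto
      moreover have "(1 + norm x)\<^sup>2 = 1 + 2 * norm x + (norm x)\<^sup>2" by (simp add: power2_sum)
      ultimately show ?thesis using norm_ge_zero[of x] unfolding power2_abs by linarith
    qed
    then have "(\<Prod>i\<in>(UNIV::'d set). 1 + (x $ i)\<^sup>2) \<le> (\<Prod>i\<in>(UNIV::'d set). (1 + norm x)\<^sup>2)"
      by (intro prod_mono) auto
    then have "inverse ((1 + norm x) ^ (2 * CARD('d))) \<le> inverse (\<Prod>i\<in>(UNIV::'d set). 1 + (x $ i)\<^sup>2)"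
      by (intro le_imp_inverse_le) (auto simp: power_mult intro!: prod_pos add_pos_nonneg)
    then show ?thesis
      by (simp only: powr_minus powr_realpow add_pos_nonneg norm_ge_zero zero_less_one prod_inversef[unfolded comp_def])
  qed
  show "AE x::real^'d in lborel. norm ((1 + norm x) powr (decay_exp TYPE('d))) \<le> norm (\<Prod>i\<in>UNIV. inverse (1 + (x $ i)\<^sup>2))"
    using le by (intro AE_I2) (auto intro: order_trans[OF _ abs_ge_self])
qed

lemma symb_integrable:
  fixes f :: "real^'d::finite \<Rightarrow> real"
  assumes "f \<in> symb (decay_exp TYPE('d))"
  shows "integrable lborel f"
proof -
  obtain C where C: "C \<ge> 0" "\<And>x. \<bar>f x\<bar> \<le> C * (1 + norm x) powr (decay_exp TYPE('d))"
    using symb_boundE[OF assms] by blast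
  show ?thesis
    by (rule Bochner_Integration.integrable_bound[OF integrable_mult_right[OF integrable_decay, of C]])
      (use C symb_measurable[OF assms] in auto)
qed

lemma schwartz_integrable: "f \<in> schwartz \<Longrightarrow> integrable lborel f"
  by (rule symb_integrable[OF schwartz_symb])

lemma schwartz_measurable [measurable_dest]: "f \<in> schwartz \<Longrightarrow> f \<in> borel_measurable borel"
  by (rule symb_measurable[OF schwartz_symb])

lemma schwartz_mult_schwartz: "f \<in> schwartz \<Longrightarrow> g \<in> schwartz \<Longrightarrow> (\<lambda>x. f x * g x) \<in> schwartz"
  by (rule schwartz_mult[OF schwartz_symb[of f 0]])

lemma integral_translation:
  fixes f :: "real^'d::finite \<Rightarrow> real"
  assumes [measurable]: "f \<in> borel_measurable borel"
  shows "(LINT x|lborel. f (c + x)) = (LINT x|lborel. f x)"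
proof -
  have "(LINT x|lborel. f (c + x)) = integral\<^sup>L (distr lborel borel ((+) c)) f"
    by (rule integral_distr[symmetric]) auto
  then show ?thesis by (simp add: lborel_distr_plus)
qed

text \<open>Difference quotients have integral zero by translation invariance, and dominated
  convergence passes to the derivative. No Fubini argument along lines is involved.\<close>

lemma integral_partial:
  fixes f :: "real^'d::finite \<Rightarrow> real"
  assumes f: "f \<in> schwartz"
  shows "(LINT x|lborel. partial i f x) = 0"
proof -
  let ?e = "axis i 1 :: real^'d" and ?M = "real (2 * CARD('d))"
  define q where "q n x = (f (x + inverse (real (Suc n)) *\<^sub>R ?e) - f x) / inverse (real (Suc n))" for n x
  have fm[measurable]: "f \<in> borel_measurable borel" "partial i f \<in> borel_measurable borel"
    using f schwartz_partial schwartz_measurable by blast+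
  obtain C where C: "C \<ge> 0" "\<And>x. \<bar>partial i f x\<bar> \<le> C * (1 + norm x) powr (- ?M)"
    using symb_boundE[OF schwartz_symb[OF schwartz_partial[OF f, of i]]] by metis
  have shift: "integrable lborel (\<lambda>x. f (c + x))" for c
    using schwartz_integrable[OF f]
    by (subst (asm) lborel_distr_plus[of c, symmetric]) (simp add: integrable_distr_eq)
  have q0: "(LINT x|lborel. q n x) = 0" for n
    unfolding q_def
    using shift[of "inverse (real (Suc n)) *\<^sub>R ?e"] schwartz_integrable[OF f]
      integral_translation[OF fm(1), of "inverse (real (Suc n)) *\<^sub>R ?e"]
    by (simp add: add.commute[of _ "_ *\<^sub>R _"])
  have "(\<lambda>n. LINT x|lborel. q n x) \<longlonglongrightarrow> (LINT x|lborel. partial i f x)"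
  proof (rule integral_dominated_convergence)
    \<comment> \<open>The mean value theorem evaluates the derivative at a point shifted by at most
      1, and \<open>1 + norm x\<close> is at most twice its value at the shifted point; this gives
      the factor \<open>2 powr ?M\<close>.\<close>
    show "integrable lborel (\<lambda>x::real^'d. (C * 2 powr ?M) * (1 + norm x) powr (- ?M))"
      using integrable_decay[where 'd='d] by (rule integrable_mult_right)
    show "AE x in lborel. (\<lambda>n. q n x) \<longlonglongrightarrow> partial i f x"
    proof (rule AE_I2)
      fix x :: "real^'d"
      have "((\<lambda>t. f (x + t *\<^sub>R ?e)) has_real_derivative partial i f (x + 0 *\<^sub>R ?e)) (at 0)"
        by (rule symb_partial_line[OF schwartz_symb[OF f]])
      then have "((\<lambda>h. (f (x + h *\<^sub>R ?e) - f x) / h) \<longlongrightarrow> partial i f x) (at 0)"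
        by (simp add: DERIV_def)
      moreover have "filterlim (\<lambda>n. inverse (real (Suc n))) (at 0) sequentially"
        using LIMSEQ_inverse_real_of_nat by (auto simp: filterlim_at)
      ultimately show "(\<lambda>n. q n x) \<longlonglongrightarrow> partial i f x"
        unfolding q_def by (rule filterlim_compose)
    qed
    fix n
    show "AE x in lborel. norm (q n x) \<le> (C * 2 powr ?M) * (1 + norm x) powr (- ?M)"
    proof (rule AE_I2)
      fix x :: "real^'d"
      let ?h = "inverse (real (Suc n))"
      have h: "0 < ?h" "?h \<le> 1" by (auto simp: field_simps)
      obtain s where s: "0 < s" "s < ?h"
        "f (x + ?h *\<^sub>R ?e) - f (x + 0 *\<^sub>R ?e) = (?h - 0) * partial i f (x + s *\<^sub>R ?e)"
        using MVT2[of 0 ?h "\<lambda>t. f (x + t *\<^sub>R ?e)" "\<lambda>t. partial i f (x + t *\<^sub>R ?e)"]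
          symb_partial_line[OF schwartz_symb[OF f]] h(1) by blast
      have q: "q n x = partial i f (x + s *\<^sub>R ?e)"
        unfolding q_def using s(3) h(1) by (simp add: field_simps)
      have "norm x \<le> norm (x + s *\<^sub>R ?e) + norm (s *\<^sub>R ?e)"
        using norm_triangle_ineq4[of "x + s *\<^sub>R ?e" "s *\<^sub>R ?e"] by simp
      moreover have "norm (s *\<^sub>R ?e) \<le> 1" using s h by simp
      moreover have "a \<le> b + c \<Longrightarrow> c \<le> 1 \<Longrightarrow> 0 \<le> b \<Longrightarrow> (1 + a) / 2 \<le> 1 + b" for a b c :: real
        by (simp add: field_simps)
      ultimately have le: "(1 + norm x) / 2 \<le> 1 + norm (x + s *\<^sub>R ?e)"
        using norm_ge_zero by blast
      have "(1 + norm (x + s *\<^sub>R ?e)) powr (- ?M) \<le> ((1 + norm x) / 2) powr (- ?M)"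
        using le by (intro powr_mono2') (auto intro: add_pos_nonneg)
      also have "\<dots> = 2 powr ?M * (1 + norm x) powr (- ?M)"
        by (simp add: powr_divide powr_minus field_simps)
      finally have "C * (1 + norm (x + s *\<^sub>R ?e)) powr (- ?M) \<le> C * (2 powr ?M * (1 + norm x) powr (- ?M))"
        using C(1) by (rule mult_left_mono)
      then show "norm (q n x) \<le> (C * 2 powr ?M) * (1 + norm x) powr (- ?M)"
        using C(2)[of "x + s *\<^sub>R ?e"] unfolding q by (simp add: mult.assoc)
    qed
    show "q n \<in> borel_measurable lborel" unfolding q_def by measurable
  qed (use fm in simp)
  then show ?thesis using q0 by (simp add: LIMSEQ_const_iff)
qed

lemma integration_by_parts:
  assumes f: "f \<in> symb m" and g: "g \<in> schwartz"
  shows "(LINT x|lborel. partial i f x * g x) = - (LINT x|lborel. f x * partial i g x)"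
proof -
  have eq: "partial i (\<lambda>x. f x * g x) = (\<lambda>x. partial i f x * g x + f x * partial i g x)"
    using f g by (auto simp: partial_mult symb_differentiable schwartz_differentiable)
  have "(LINT x|lborel. partial i f x * g x + f x * partial i g x) = 0"
    using integral_partial[OF schwartz_mult[OF f g], of i] by (simp add: eq)
  then show ?thesis
    by (subst (asm) Bochner_Integration.integral_add)
      (auto intro!: schwartz_integrable schwartz_mult[OF symb_partial[OF f] g] schwartz_mult[OF f schwartz_partial[OF g]])
qed

section \<open>Hermite functions\<close>

text \<open>This is \<open>(-1)^n H_n(t) exp (- t^2)\<close>, so the last equation is the three-term
  recurrence of the Hermite polynomials. Taking it as the definition leaves only the derivative rule
  to be proved.\<close>

fun gauss_deriv :: "nat \<Rightarrow> real \<Rightarrow> real" where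
  "gauss_deriv 0 t = exp (- t\<^sup>2)"
| "gauss_deriv (Suc 0) t = - 2 * t * exp (- t\<^sup>2)"
| "gauss_deriv (Suc (Suc n)) t = - 2 * t * gauss_deriv (Suc n) t - 2 * real (Suc n) * gauss_deriv n t"

lemma DERIV_gauss_deriv: "(gauss_deriv n has_real_derivative gauss_deriv (Suc n) t) (at t)"
proof (induction n t rule: gauss_deriv.induct)
  case (1 t) show ?case unfolding gauss_deriv.simps
    by (auto intro!: derivative_eq_intros)
next
  case (2 t) show ?case unfolding gauss_deriv.simps
    by (auto intro!: derivative_eq_intros simp: algebra_simps)
next
  case (3 n t)
  have "(gauss_deriv (Suc (Suc n)) has_real_derivative
     (- 2 * gauss_deriv (Suc n) t - 2 * t * gauss_deriv (Suc (Suc n)) t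
       - 2 * real (Suc n) * gauss_deriv (Suc n) t)) (at t)"
    unfolding gauss_deriv.simps(3)[of n, abs_def]
    by (rule derivative_eq_intros 3 refl)+ (simp only: gauss_deriv.simps, simp add: algebra_simps)
  then show ?case by (rule DERIV_cong) (simp add: algebra_simps)
qed

lemma deriv_pow_gauss: "(deriv ^^ n) (\<lambda>t. exp (- t\<^sup>2)) = gauss_deriv n"
proof (induction n)
  case 0 show ?case by (simp add: fun_eq_iff)
next
  case (Suc n) show ?case
    by (rule ext) (simp only: funpow.simps comp_apply Suc DERIV_imp_deriv[OF DERIV_gauss_deriv])
qed

definition hermite_scale :: "nat \<Rightarrow> real" where
  "hermite_scale n = sqrt (2 ^ n * fact n * sqrt pi)"

lemma hermite_scale_pos: "hermite_scale n > 0" by (simp add: hermite_scale_def)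

lemma hermite_scale_Suc: "hermite_scale (Suc n) = sqrt (2 * real (Suc n)) * hermite_scale n"
  by (simp add: hermite_scale_def real_sqrt_mult[symmetric] algebra_simps)

lemma hermite1_gauss_deriv:
  "hermite1 n x = (-1) ^ n * exp (x\<^sup>2 / 2) * gauss_deriv n x / hermite_scale n"
  by (simp add: hermite1_def deriv_pow_gauss hermite_scale_def)

text \<open>Differentiating the factor \<open>exp (x^2 / 2)\<close> contributes
  \<open>x * hermite1 n x\<close>; differentiating \<open>gauss_deriv n\<close> contributes the next
  Hermite function, up to the ratio of the scales.\<close>

lemma hermite1_raise: "(hermite1 n has_real_derivative
    (x * hermite1 n x - sqrt (2 * real (Suc n)) * hermite1 (Suc n) x)) (at x)"
proof -
  have s: "sqrt (2 * real (Suc n)) > 0" by simp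
  show ?thesis
    unfolding hermite1_gauss_deriv[abs_def]
    using hermite_scale_pos[of n] s
    by (auto intro!: derivative_eq_intros DERIV_gauss_deriv simp del: gauss_deriv.simps simp: hermite_scale_Suc field_simps)
qed

lemma sqrt_double: "sqrt (2 * a) = 2 * sqrt (a / 2)"
  using real_sqrt_mult[of 4 "a / 2"] by simp

text \<open>The three-term recurrence of \<open>gauss_deriv\<close> after normalization. For
  \<open>n = 0\<close> the coefficient \<open>sqrt (real n / 2)\<close> vanishes, so the truncated
  \<open>n - 1\<close> is harmless, here and in all ladder formulas below.\<close>

lemma hermite1_coord: "x * hermite1 n x =
   sqrt (real n / 2) * hermite1 (n - 1) x + sqrt (real (Suc n) / 2) * hermite1 (Suc n) x"
proof -
  have "2 * x * hermite1 n x = sqrt (2 * real n) * hermite1 (n - 1) x + sqrt (2 * real (Suc n)) * hermite1 (Suc n) x"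
  proof (cases n)
    case 0
    then show ?thesis using hermite_scale_pos[of 0]
      by (simp add: hermite1_gauss_deriv hermite_scale_Suc field_simps)
  next
    case (Suc m)
    have s: "sqrt (2 * real (Suc k)) > 0" "sqrt (2 * real (Suc k)) * sqrt (2 * real (Suc k)) = 2 * real (Suc k)" for k
      by simp_all
    let ?s = "sqrt (2 * real (Suc m))" and ?r = "sqrt (2 * real (Suc (Suc m)))"
    let ?E = "(-1) ^ m * exp (x\<^sup>2 / 2) / hermite_scale m"
    have 0: "hermite1 m x = ?E * gauss_deriv m x" by (simp add: hermite1_gauss_deriv)
    have 1: "?s * hermite1 (Suc m) x = - ?E * gauss_deriv (Suc m) x"
      using s(1)[of m] hermite_scale_pos[of m]
      by (simp add: hermite1_gauss_deriv hermite_scale_Suc del: gauss_deriv.simps)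
    have 2: "?r * ?s * hermite1 (Suc (Suc m)) x = ?E * gauss_deriv (Suc (Suc m)) x"
      using s(1)[of m] s(1)[of "Suc m"] hermite_scale_pos[of m]
      by (simp add: hermite1_gauss_deriv hermite_scale_Suc del: gauss_deriv.simps)
    have "?s * (2 * x * hermite1 (Suc m) x) = ?s * (?s * hermite1 m x + ?r * hermite1 (Suc (Suc m)) x)"
    proof -
      have "?s * (?s * hermite1 m x + ?r * hermite1 (Suc (Suc m)) x)
          = (?s * ?s) * hermite1 m x + ?r * ?s * hermite1 (Suc (Suc m)) x"
        by (simp only: algebra_simps)
      also have "\<dots> = 2 * real (Suc m) * (?E * gauss_deriv m x) + ?E * gauss_deriv (Suc (Suc m)) x"
        unfolding s(2) 2 0 ..
      also have "\<dots> = 2 * x * (- ?E * gauss_deriv (Suc m) x)"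
        unfolding gauss_deriv.simps(3) by (simp only: algebra_simps)
      also have "\<dots> = ?s * (2 * x * hermite1 (Suc m) x)"
        unfolding 1[symmetric] by (simp only: algebra_simps)
      finally show ?thesis ..
    qed
    then show ?thesis using s(1)[of m] Suc by (simp only: mult_cancel_left) simp
  qed
  then show ?thesis unfolding sqrt_double by simp
qed

lemma DERIV_hermite1: "(hermite1 n has_real_derivative
   sqrt (real n / 2) * hermite1 (n - 1) x - sqrt (real (Suc n) / 2) * hermite1 (Suc n) x) (at x)"
proof (rule DERIV_cong[OF hermite1_raise])
  show "x * hermite1 n x - sqrt (2 * real (Suc n)) * hermite1 (Suc n) x =
    sqrt (real n / 2) * hermite1 (n - 1) x - sqrt (real (Suc n) / 2) * hermite1 (Suc n) x"
    unfolding hermite1_coord sqrt_double by simp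
qed

text \<open>The recurrence \<open>hermite1_coord\<close>, solved for its top term, trades one step
  up in \<open>n\<close> for one more power of \<open>x\<close>; therefore the induction carries all
  powers \<open>m\<close> at once.\<close>

lemma hermite1_bound: "\<exists>C. \<forall>x. \<bar>x\<bar> ^ m * \<bar>hermite1 n x\<bar> \<le> C"
proof (induction n arbitrary: m rule: less_induct)
  case (less n)
  \<comment> \<open>For \<open>|x| > 1\<close> this combines \<open>|x|^m <= x^(2m)\<close> with
    \<open>(x^2 / (2m))^m <= exp (x^2 / 2)\<close>. The summand 1 covers \<open>|x| <= 1\<close> and
    \<open>m = 0\<close>.\<close>
  have 1: "\<bar>x\<bar> ^ m * exp (- x\<^sup>2 / 2) \<le> 1 + (2 * real m) ^ m" for x :: real
  proof (cases "\<bar>x\<bar> \<le> 1")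
    case True
    have "\<bar>x\<bar> ^ m * exp (- x\<^sup>2 / 2) \<le> 1 * 1" using True by (intro mult_mono power_le_one) auto
    then show ?thesis by (simp add: add_increasing2)
  next
    case False
    show ?thesis
    proof (cases "m = 0")
      case False
      have "(x\<^sup>2 / (2 * real m)) ^ m \<le> (1 + (x\<^sup>2 / 2) / real m) ^ m"
        by (intro power_mono) auto
      also have "\<dots> \<le> exp (x\<^sup>2 / 2)"
        using False by (intro exp_ge_one_plus_x_over_n_power_n) (auto intro: order_trans[of _ 0])
      finally have "(x\<^sup>2) ^ m \<le> (2 * real m) ^ m * exp (x\<^sup>2 / 2)"
        using False by (simp add: power_divide field_simps)
      moreover have "\<bar>x\<bar> ^ m \<le> (x\<^sup>2) ^ m"
      proof -
        have "\<bar>x\<bar> ^ m \<le> \<bar>x\<bar> ^ (2 * m)" using \<open>\<not> \<bar>x\<bar> \<le> 1\<close> by (intro power_increasing) auto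
        then show ?thesis by (simp add: power_mult)
      qed
      ultimately show ?thesis by (simp add: exp_minus field_simps add_increasing)
    qed (auto intro: order_trans[of _ "1 :: real"])
  qed
  have 2: "\<bar>hermite1 0 x\<bar> = exp (- x\<^sup>2 / 2) / hermite_scale 0" for x
    using hermite_scale_pos[of 0] by (simp add: hermite1_gauss_deriv exp_add[symmetric])
  show ?case
  proof (cases n)
    case 0
    then show ?thesis
      by (intro exI[of _ "(1 + (2 * real m) ^ m) / hermite_scale 0"])
        (use 1 hermite_scale_pos[of 0] in \<open>auto simp: 2 divide_right_mono\<close>)
  next
    case (Suc k)
    obtain C where C: "\<And>x. \<bar>x\<bar> ^ Suc m * \<bar>hermite1 k x\<bar> \<le> C" using less[of k "Suc m"] Suc by blast
    obtain D where D: "\<And>x. \<bar>x\<bar> ^ m * \<bar>hermite1 (k - 1) x\<bar> \<le> D" using less[of "k - 1" m] Suc by (metis diff_le_self le_imp_less_Suc)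
    let ?s = "sqrt (real (Suc k) / 2)" and ?r = "sqrt (real k / 2)"
    have s: "?s > 0" by simp
    have "\<bar>x\<bar> ^ m * \<bar>hermite1 n x\<bar> \<le> (C + ?r * D) / ?s" for x
    proof -
      have "?s * hermite1 n x = x * hermite1 k x - ?r * hermite1 (k - 1) x"
        using hermite1_coord[of x k] Suc by simp
      then have "?s * \<bar>hermite1 n x\<bar> = \<bar>x * hermite1 k x - ?r * hermite1 (k - 1) x\<bar>"
        using s by (metis abs_mult abs_of_pos)
      also have "\<dots> \<le> \<bar>x\<bar> * \<bar>hermite1 k x\<bar> + ?r * \<bar>hermite1 (k - 1) x\<bar>"
        using abs_triangle_ineq4[of "x * hermite1 k x" "?r * hermite1 (k - 1) x"] by (simp add: abs_mult)
      finally have "\<bar>x\<bar> ^ m * (?s * \<bar>hermite1 n x\<bar>) \<le> \<bar>x\<bar> ^ m * (\<bar>x\<bar> * \<bar>hermite1 k x\<bar> + ?r * \<bar>hermite1 (k - 1) x\<bar>)"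
        by (rule mult_left_mono) simp
      also have "\<dots> = \<bar>x\<bar> ^ Suc m * \<bar>hermite1 k x\<bar> + ?r * (\<bar>x\<bar> ^ m * \<bar>hermite1 (k - 1) x\<bar>)"
        by (simp add: algebra_simps)
      also have "\<dots> \<le> C + ?r * D" by (intro add_mono C mult_left_mono D) simp
      finally show ?thesis using s by (simp only: pos_le_divide_eq mult_ac)
    qed
    then show ?thesis by blast
  qed
qed

definition raise :: "'d \<Rightarrow> ('d \<Rightarrow> nat) \<Rightarrow> 'd \<Rightarrow> nat" where "raise i k = k(i := Suc (k i))"
definition lower :: "'d \<Rightarrow> ('d \<Rightarrow> nat) \<Rightarrow> 'd \<Rightarrow> nat" where "lower i k = k(i := k i - 1)"

lemma hermite_split:
  "hermite k x = hermite1 (k i) (x $ i) * (\<Prod>j\<in>UNIV - {i}. hermite1 (k j) (x $ j))"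
  unfolding hermite_def by (subst prod.remove[of UNIV i]) auto

lemma hermite_raise_split:
  "hermite (raise i k) x = hermite1 (Suc (k i)) (x $ i) * (\<Prod>j\<in>UNIV - {i}. hermite1 (k j) (x $ j))"
  unfolding hermite_split[of _ _ i] by (auto simp: raise_def intro!: prod.cong)

lemma hermite_lower_split:
  "hermite (lower i k) x = hermite1 (k i - 1) (x $ i) * (\<Prod>j\<in>UNIV - {i}. hermite1 (k j) (x $ j))"
  unfolding hermite_split[of _ _ i] by (auto simp: lower_def intro!: prod.cong)

lemma hermite_coord: "x $ i * hermite k x =
   sqrt (real (k i) / 2) * hermite (lower i k) x + sqrt (real (Suc (k i)) / 2) * hermite (raise i k) x"
proof -
  have "x $ i * hermite k x = (x $ i * hermite1 (k i) (x $ i)) * (\<Prod>j\<in>UNIV - {i}. hermite1 (k j) (x $ j))"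
    unfolding hermite_split[of _ _ i] by simp
  then show ?thesis
    unfolding hermite1_coord hermite_raise_split hermite_lower_split by (simp only: algebra_simps)
qed

lemma hermite_has_derivative:
  fixes x :: "real^'d::finite"
  shows "(hermite k has_derivative (\<lambda>h. \<Sum>i\<in>UNIV. (h $ i * (sqrt (real (k i) / 2) * hermite1 (k i - 1) (x $ i) - sqrt (real (Suc (k i)) / 2) * hermite1 (Suc (k i)) (x $ i)))
     * (\<Prod>j\<in>UNIV - {i}. hermite1 (k j) (x $ j)))) (at x)"
  unfolding hermite_def[abs_def]
proof (rule has_derivative_prod)
  fix i :: 'd
  have "((\<lambda>y::real^'d. y $ i) has_derivative (\<lambda>h. h $ i)) (at x)"
    by (rule bounded_linear_imp_has_derivative[OF bounded_linear_vec_nth])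
  from has_derivative_compose[OF this DERIV_hermite1[unfolded has_field_derivative_def]]
  show "((\<lambda>y. hermite1 (k i) (y $ i)) has_derivative (\<lambda>h. h $ i * (sqrt (real (k i) / 2) * hermite1 (k i - 1) (x $ i) - sqrt (real (Suc (k i)) / 2) * hermite1 (Suc (k i)) (x $ i)))) (at x)"
    by (simp add: mult.commute)
qed

lemma hermite_differentiable: "hermite k differentiable (at x)"
  using hermite_has_derivative differentiable_def by blast

lemma partial_hermite: "partial i (hermite k) x =
   sqrt (real (k i) / 2) * hermite (lower i k) x - sqrt (real (Suc (k i)) / 2) * hermite (raise i k) x"
  unfolding partial_eq[OF hermite_has_derivative] hermite_raise_split hermite_lower_split
  by (subst sum.remove[of UNIV i]) (auto simp: axis_def algebra_simps)

lemma hermite_bound: "\<exists>C. \<forall>x. \<bar>hermite k x\<bar> \<le> C"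
proof -
  have "\<forall>i. \<exists>C. \<forall>x. \<bar>hermite1 (k i) x\<bar> \<le> C" using hermite1_bound[of 0] by simp
  then obtain C where "\<And>i x. \<bar>hermite1 (k i) x\<bar> \<le> C i" by metis
  then have "\<bar>hermite k x\<bar> \<le> (\<Prod>i\<in>UNIV. C i)" for x
    unfolding hermite_def abs_prod by (intro prod_mono) auto
  then show ?thesis by blast
qed

text \<open>By the ladder relations this span is stable under \<open>partial\<close> and under
  multiplication by coordinates, which makes it a coinduction set for every
  \<open>symb m\<close>.\<close>

inductive_set hspan :: "(real^'d::finite \<Rightarrow> real) set" where
  hermite: "hermite k \<in> hspan"
| add: "f \<in> hspan \<Longrightarrow> g \<in> hspan \<Longrightarrow> (\<lambda>x. f x + g x) \<in> hspan"
| cmult: "f \<in> hspan \<Longrightarrow> (\<lambda>x. c * f x) \<in> hspan"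

lemma hspan_0: "(\<lambda>x. 0) \<in> hspan"
  using hspan.cmult[OF hspan.hermite, of 0] by simp

lemma hspan_diff: "f \<in> hspan \<Longrightarrow> g \<in> hspan \<Longrightarrow> (\<lambda>x. f x - g x) \<in> hspan"
  using hspan.add[OF _ hspan.cmult[of g "-1"], of f] by simp

lemma hspan_sum: "(\<And>a. a \<in> A \<Longrightarrow> f a \<in> hspan) \<Longrightarrow> (\<lambda>x. \<Sum>a\<in>A. f a x) \<in> hspan"
  by (induction A rule: infinite_finite_induct) (auto simp: hspan_0 hspan.add)

lemma hspan_differentiable: "f \<in> hspan \<Longrightarrow> f differentiable (at x)"
  by (induction rule: hspan.induct) (auto simp: hermite_differentiable)

lemma hspan_partial: "f \<in> hspan \<Longrightarrow> partial i f \<in> hspan"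
proof (induction rule: hspan.induct)
  case (hermite k)
  show ?case unfolding partial_hermite[abs_def] by (intro hspan_diff hspan.intros)
next
  case (add f g)
  then have "partial i (\<lambda>x. f x + g x) = (\<lambda>x. partial i f x + partial i g x)"
    by (auto simp: partial_add hspan_differentiable)
  with add show ?case by (simp add: hspan.add)
next
  case (cmult f c)
  then have "partial i (\<lambda>x. c * f x) = (\<lambda>x. c * partial i f x)"
    by (auto simp: partial_cmult hspan_differentiable)
  with cmult show ?case by (simp add: hspan.cmult)
qed

lemma hspan_coord: "f \<in> hspan \<Longrightarrow> (\<lambda>x. x $ i * f x) \<in> hspan"
proof (induction rule: hspan.induct)
  case (hermite k)
  show ?case unfolding hermite_coord by (intro hspan.intros)
next
  case (add f g)
  then show ?case by (simp add: distrib_left hspan.add)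
next
  case (cmult f c)
  then show ?case by (simp add: mult.left_commute hspan.cmult)
qed

lemma hspan_bound: "f \<in> hspan \<Longrightarrow> \<exists>C. \<forall>x. \<bar>f x\<bar> \<le> C"
proof (induction rule: hspan.induct)
  case (add f g)
  then obtain C D where "\<And>x. \<bar>f x\<bar> \<le> C" "\<And>x. \<bar>g x\<bar> \<le> D" by blast
  then have "\<bar>f x + g x\<bar> \<le> C + D" for x by (meson abs_triangle_ineq add_mono order_trans)
  then show ?case by blast
next
  case (cmult f c)
  then obtain C where "\<And>x. \<bar>f x\<bar> \<le> C" by blast
  then have "\<bar>c * f x\<bar> \<le> \<bar>c\<bar> * C" for x by (simp add: abs_mult mult_left_mono)
  then show ?case by blast
qed (rule hermite_bound)

lemma norm_sq_sum: "(norm x)\<^sup>2 = (\<Sum>i\<in>UNIV. x $ i * x $ i)" for x :: "real^'d::finite"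
  by (simp add: power2_norm_eq_inner inner_vec_def)

lemma hspan_weight:
  assumes "f \<in> hspan" shows "(\<lambda>x. (1 + (norm x)\<^sup>2) ^ n * f x) \<in> hspan"
proof (induction n)
  case (Suc n)
  have "(\<lambda>x. (1 + (norm x)\<^sup>2) ^ n * f x + (\<Sum>i\<in>UNIV. x $ i * (x $ i * ((1 + (norm x)\<^sup>2) ^ n * f x)))) \<in> hspan"
    by (intro hspan.add Suc hspan_sum hspan_coord)
  moreover have "(1 + (norm x)\<^sup>2) ^ Suc n * f x = (1 + (norm x)\<^sup>2) ^ n * f x + (\<Sum>i\<in>UNIV. x $ i * (x $ i * ((1 + (norm x)\<^sup>2) ^ n * f x)))" for x
  proof -
    have "(\<Sum>i\<in>UNIV. x $ i * (x $ i * ((1 + (norm x)\<^sup>2) ^ n * f x))) = (norm x)\<^sup>2 * ((1 + (norm x)\<^sup>2) ^ n * f x)"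
      unfolding norm_sq_sum by (simp only: sum_distrib_right mult.assoc)
    then show ?thesis by (simp add: algebra_simps)
  qed
  ultimately show ?case by simp
qed (simp add: assms)

text \<open>Boundedness upgrades itself to rapid decay: a member times \<open>(1 + |x|^2)^n\<close>
  is again in the span, hence bounded.\<close>

lemma hspan_schwartz: assumes "f \<in> hspan" shows "f \<in> schwartz"
  unfolding schwartz_iff
proof
  fix m :: real
  show "f \<in> symb m"
  proof (rule symb_coinduct[OF assms])
    fix g :: "real^'a \<Rightarrow> real" assume g: "g \<in> hspan"
    obtain n :: nat where n: "- m \<le> real n" using real_arch_simple by blast
    obtain C where C: "\<And>x. \<bar>(1 + (norm x)\<^sup>2) ^ n * g x\<bar> \<le> C" using hspan_bound[OF hspan_weight[OF g]] by blast
    have "\<bar>g x\<bar> \<le> (2 ^ n * C) * (1 + norm x) powr m" for x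
    proof -
      have p: "1 + norm x \<ge> 1" by simp
      have "(1 + norm x)\<^sup>2 \<le> 2 * (1 + (norm x)\<^sup>2)"
        using sum_squares_bound[of 1 "norm x"] by (simp add: power2_sum)
      moreover have "1 + norm x \<le> (1 + norm x)\<^sup>2" using power_increasing[of 1 2 "1 + norm x"] by simp
      ultimately have "(1 + norm x) ^ n \<le> (2 * (1 + (norm x)\<^sup>2)) ^ n" by (intro power_mono) auto
      moreover have "(1 + norm x) powr (- m) \<le> (1 + norm x) powr real n" using n p by (intro powr_mono) auto
      ultimately have "(1 + norm x) powr (- m) \<le> 2 ^ n * (1 + (norm x)\<^sup>2) ^ n"
        unfolding power_mult_distrib using p by (simp add: powr_realpow)
      then have "(1 + norm x) powr (- m) * \<bar>g x\<bar> \<le> 2 ^ n * (1 + (norm x)\<^sup>2) ^ n * \<bar>g x\<bar>"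
        by (rule mult_right_mono) simp
      also have "\<dots> \<le> 2 ^ n * C" using C[of x] by (simp add: abs_mult)
      finally have *: "(1 + norm x) powr m * ((1 + norm x) powr (- m) * \<bar>g x\<bar>) \<le> (1 + norm x) powr m * (2 ^ n * C)"
        by (rule mult_left_mono) simp
      have "(1 + norm x) powr m * (1 + norm x) powr (- m) = 1"
        unfolding powr_add[symmetric] by (simp add: one_norm_nz)
      then have "\<bar>g x\<bar> = (1 + norm x) powr m * ((1 + norm x) powr (- m) * \<bar>g x\<bar>)"
        by (simp only: mult.assoc[symmetric] mult_1_left)
      also note *
      finally show ?thesis by (simp only: mult.commute)
    qed
    then show "\<exists>C. \<forall>x. \<bar>g x\<bar> \<le> C * (1 + norm x) powr m" by blast
  qed (auto simp: hspan_partial hspan_differentiable)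
qed

lemma hermite_schwartz: "hermite k \<in> schwartz"
  by (rule hspan_schwartz[OF hspan.hermite])

section \<open>Orthonormality of the Hermite functions\<close>

abbreviation ip :: "(real^'d::finite \<Rightarrow> real) \<Rightarrow> (real^'d \<Rightarrow> real) \<Rightarrow> real" where
  "ip f g \<equiv> LINT x|lborel. f x * g x"

lemma ip_commute: "ip f g = ip g f" by (simp add: mult.commute)

text \<open>The creation operator \<open>x_i - partial_i\<close> produces
  \<open>hermite (raise i k)\<close>; by integration by parts its adjoint is the annihilation
  operator \<open>x_i + partial_i\<close>.\<close>

lemma ip_raise: assumes f: "f \<in> schwartz"
  shows "sqrt (2 * real (Suc (k i))) * ip f (hermite (raise i k)) = ip (\<lambda>x. x $ i * f x + partial i f x) (hermite k)"
proof -
  have h: "sqrt (2 * real (Suc (k i))) * hermite (raise i k) x = x $ i * hermite k x - partial i (hermite k) x" for x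
    unfolding partial_hermite hermite_coord sqrt_double by simp
  have int: "integrable lborel (\<lambda>x. (x $ i * f x) * hermite k x)" "integrable lborel (\<lambda>x. f x * partial i (hermite k) x)"
    "integrable lborel (\<lambda>x. partial i f x * hermite k x)"
    by (intro schwartz_integrable schwartz_mult_schwartz schwartz_mult[OF symb_coord] schwartz_partial f hermite_schwartz)+
  have "sqrt (2 * real (Suc (k i))) * ip f (hermite (raise i k)) = (LINT x|lborel. f x * (sqrt (2 * real (Suc (k i))) * hermite (raise i k) x))"
    by (subst integral_mult_right_zero[symmetric]) (simp add: mult.left_commute)
  also have "\<dots> = (LINT x|lborel. (x $ i * f x) * hermite k x - f x * partial i (hermite k) x)"
    unfolding h by (simp add: algebra_simps)
  also have "\<dots> = (LINT x|lborel. (x $ i * f x) * hermite k x) + (LINT x|lborel. partial i f x * hermite k x)"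
    using int integration_by_parts[OF schwartz_symb[OF f] hermite_schwartz, of i k] by simp
  also have "\<dots> = ip (\<lambda>x. x $ i * f x + partial i f x) (hermite k)"
    using int by (simp add: distrib_right)
  finally show ?thesis .
qed

lemma ip_hermite_raise:
  "sqrt (2 * real (Suc (l i))) * ip (hermite k) (hermite (raise i l)) = sqrt (2 * real (k i)) * ip (hermite (lower i k)) (hermite l)"
proof -
  have "x $ i * hermite k x + partial i (hermite k) x = sqrt (2 * real (k i)) * hermite (lower i k) x" for x
    unfolding partial_hermite hermite_coord sqrt_double by simp
  then show ?thesis unfolding ip_raise[OF hermite_schwartz] by (simp add: mult.assoc)
qed

lemma ip_hermite_0: "ip (hermite (\<lambda>i::'d::finite. 0)) (hermite (\<lambda>i. 0)) = 1"
proof -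
  have "hermite1 0 t * hermite1 0 t = exp (- t\<^sup>2) / sqrt pi" for t
  proof -
    have "hermite1 0 t * hermite1 0 t = exp (t\<^sup>2 / 2) * exp (t\<^sup>2 / 2) * exp (- t\<^sup>2) * exp (- t\<^sup>2) / (hermite_scale 0 * hermite_scale 0)"
      by (simp add: hermite1_gauss_deriv)
    also have "exp (t\<^sup>2 / 2) * exp (t\<^sup>2 / 2) * exp (- t\<^sup>2) * exp (- t\<^sup>2) = exp (- t\<^sup>2)"
      by (simp add: exp_add[symmetric])
    also have "hermite_scale 0 * hermite_scale 0 = sqrt pi" by (simp add: hermite_scale_def)
    finally show ?thesis .
  qed
  then have eq: "hermite (\<lambda>i::'d. 0) x * hermite (\<lambda>i. 0) x = (\<Prod>i\<in>UNIV. exp (- (x $ i)\<^sup>2) / sqrt pi)" for x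
    unfolding hermite_def prod.distrib[symmetric] by simp
  have "has_bochner_integral lborel (\<lambda>x::real. exp (- x\<^sup>2)) (sqrt pi)"
    using has_bochner_integral_even_function[OF gaussian_moment_0] by simp
  from has_bochner_integral_divide_zero[OF this, of "sqrt pi"]
  have "integrable lborel (\<lambda>x::real. exp (- x\<^sup>2) / sqrt pi)" "(LINT x|lborel. exp (- x\<^sup>2) / sqrt pi) = 1"
    by (auto simp: has_bochner_integral_iff)
  then show ?thesis unfolding eq by (subst integral_prod_vec) auto
qed

text \<open>Induction on \<open>|l|\<close>: \<open>ip_hermite_raise\<close> removes one unit from
  both indices. In the base case \<open>l = 0\<close> a nonzero \<open>k\<close> is itself a raised
  index, and the annihilation coefficient of \<open>l\<close> is zero.\<close>

lemma ip_hermite: "ip (hermite k) (hermite l) = (if k = l then 1 else 0)" for k l :: "'d::finite \<Rightarrow> nat"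
proof (induction "\<Sum>i\<in>UNIV. l i" arbitrary: k l)
  case 0
  then have l: "l = (\<lambda>i. 0)" by auto
  show ?case
  proof (cases "k = (\<lambda>i. 0)")
    case True then show ?thesis using l ip_hermite_0 by simp
  next
    case False
    then obtain i where "k i \<noteq> 0" by auto
    then have k: "k = raise i (lower i k)" by (auto simp: raise_def lower_def)
    have "sqrt (2 * real (Suc (lower i k i))) * ip (hermite l) (hermite k) = 0"
      using ip_hermite_raise[of "lower i k" i l] k l by simp
    then show ?thesis using False l by (simp add: ip_commute)
  qed
next
  case (Suc n)
  then obtain i where i: "l i \<noteq> 0" by (metis nat.simps(3) sum.neutral)
  define m where "m = lower i l"
  have l: "l = raise i m" "l i = Suc (m i)" using i by (auto simp: raise_def lower_def m_def)
  have "(\<Sum>j\<in>UNIV. l j) = Suc (\<Sum>j\<in>UNIV. m j)"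
    unfolding l(1) raise_def by (subst (1 2) sum.remove[of UNIV i]) auto
  then have IH: "ip (hermite k') (hermite m) = (if k' = m then 1 else 0)" for k'
    using Suc by simp
  have eq: "sqrt (2 * real (l i)) * ip (hermite k) (hermite l) = sqrt (2 * real (k i)) * (if lower i k = m then 1 else 0)"
    using ip_hermite_raise[of m i k] unfolding l(1)[symmetric] l(2)[symmetric] IH .
  show ?case
  proof (cases "k i = 0")
    case True
    then show ?thesis using eq i by auto
  next
    case False
    then have "raise i (lower i k) = k" by (auto simp: raise_def lower_def)
    then have "lower i k = m \<longleftrightarrow> k = l" using l(1) m_def by metis
    then show ?thesis using eq i by auto
  qed
qed

section \<open>Completeness of the Hermite functions\<close>

definition L2 :: "(real^'d::finite \<Rightarrow> real) set" where
  "L2 = {f. f \<in> borel_measurable borel \<and> integrable lborel (\<lambda>x. (f x)\<^sup>2)}"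

lemma L2_measurable [measurable_dest]: "f \<in> L2 \<Longrightarrow> f \<in> borel_measurable borel"
  and L2_integrable: "f \<in> L2 \<Longrightarrow> integrable lborel (\<lambda>x. (f x)\<^sup>2)"
  by (simp_all add: L2_def)

lemma L2_mult_integrable:
  assumes "f \<in> L2" "g \<in> L2" shows "integrable lborel (\<lambda>x. f x * g x)"
proof (rule Bochner_Integration.integrable_bound)
  show "integrable lborel (\<lambda>x. (f x)\<^sup>2 + (g x)\<^sup>2)" using assms by (intro Bochner_Integration.integrable_add L2_integrable)
  show "(\<lambda>x. f x * g x) \<in> borel_measurable lborel" using assms[THEN L2_measurable] by simp
  have "\<bar>a * c\<bar> \<le> a\<^sup>2 + c\<^sup>2" for a c :: real
  proof -
    have "2 * (\<bar>a\<bar> * \<bar>c\<bar>) \<le> a\<^sup>2 + c\<^sup>2" using sum_squares_bound[of "\<bar>a\<bar>" "\<bar>c\<bar>"] by simp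
    moreover have "0 \<le> \<bar>a\<bar> * \<bar>c\<bar>" by simp
    ultimately show ?thesis unfolding abs_mult by linarith
  qed
  then show "AE x in lborel. norm (f x * g x) \<le> norm ((f x)\<^sup>2 + (g x)\<^sup>2)" by simp
qed

lemma L2_add: assumes "f \<in> L2" "g \<in> L2" shows "(\<lambda>x. f x + g x) \<in> L2"
  unfolding L2_def
proof safe
  show "(\<lambda>x. f x + g x) \<in> borel_measurable borel" using assms[THEN L2_measurable] by simp
  have "integrable lborel (\<lambda>x. (f x)\<^sup>2 + (g x)\<^sup>2 + 2 * (f x * g x))"
    using assms by (intro Bochner_Integration.integrable_add integrable_mult_right L2_integrable L2_mult_integrable)
  then show "integrable lborel (\<lambda>x. (f x + g x)\<^sup>2)" by (simp add: power2_sum mult.assoc)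
qed

lemma L2_cmult: "f \<in> L2 \<Longrightarrow> (\<lambda>x. c * f x) \<in> L2"
  unfolding L2_def by (auto simp: power_mult_distrib)

lemma L2_diff: "f \<in> L2 \<Longrightarrow> g \<in> L2 \<Longrightarrow> (\<lambda>x. f x - g x) \<in> L2"
  using L2_add[OF _ L2_cmult[of g "-1"], of f] by simp

lemma L2_bounded:
  assumes "f \<in> L2" "g \<in> borel_measurable borel" "\<And>x. \<bar>g x\<bar> \<le> \<bar>f x\<bar>"
  shows "g \<in> L2"
  unfolding L2_def
proof safe
  show "integrable lborel (\<lambda>x. (g x)\<^sup>2)"
    by (rule Bochner_Integration.integrable_bound[OF L2_integrable[OF assms(1)]])
      (use assms(2,3) abs_le_square_iff in auto)
qed fact

lemma schwartz_L2: assumes "f \<in> schwartz" shows "f \<in> L2"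
  using schwartz_integrable[OF schwartz_mult_schwartz[OF assms assms]] schwartz_measurable[OF assms]
  by (simp add: L2_def power2_eq_square)

text \<open>Distances are kept squared, so \<open>integral_sum_sq_le\<close> takes the place of the
  triangle inequality; its factor 2 is why errors below \<open>e / 4\<close> are requested in the
  lemmas that follow.\<close>

definition hclosure :: "(real^'d::finite \<Rightarrow> real) set" where
  "hclosure = {f \<in> L2. \<forall>e>0. \<exists>h\<in>hspan. (LINT x|lborel. (f x - h x)\<^sup>2) < e}"

lemma hclosure_approx:
  "f \<in> hclosure \<Longrightarrow> e > 0 \<Longrightarrow> \<exists>h\<in>hspan. (LINT x|lborel. (f x - h x)\<^sup>2) < e"
  by (simp add: hclosure_def)

lemma hclosure_L2: "f \<in> hclosure \<Longrightarrow> f \<in> L2" by (simp add: hclosure_def)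

lemma hspan_L2: "f \<in> hspan \<Longrightarrow> f \<in> L2" by (rule schwartz_L2[OF hspan_schwartz])

lemma hspan_hclosure: assumes "f \<in> hspan" shows "f \<in> hclosure"
  unfolding hclosure_def using assms hspan_L2 by (force intro: bexI[of _ f])

lemma integral_sum_sq_le:
  assumes "f \<in> L2" "g \<in> L2"
  shows "(LINT x|lborel. (f x + g x)\<^sup>2) \<le> 2 * (LINT x|lborel. (f x)\<^sup>2) + 2 * (LINT x|lborel. (g x)\<^sup>2)"
proof -
  have "(LINT x|lborel. (f x + g x)\<^sup>2) \<le> (LINT x|lborel. 2 * (f x)\<^sup>2 + 2 * (g x)\<^sup>2)"
  proof (rule integral_mono)
    show "(f x + g x)\<^sup>2 \<le> 2 * (f x)\<^sup>2 + 2 * (g x)\<^sup>2" for x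
      using sum_squares_bound[of "f x" "g x"] by (simp add: power2_sum)
  qed (use assms in \<open>auto intro!: L2_integrable L2_add\<close>)
  then show ?thesis using assms[THEN L2_integrable] by simp
qed

lemma hclosure_limit:
  assumes f: "f \<in> L2" and l: "\<And>e. e > 0 \<Longrightarrow> \<exists>u\<in>hclosure. (LINT x|lborel. (f x - u x)\<^sup>2) < e"
  shows "f \<in> hclosure"
  unfolding hclosure_def
proof (safe intro!: f)
  fix e :: real assume e: "e > 0"
  then obtain u where u: "u \<in> hclosure" "(LINT x|lborel. (f x - u x)\<^sup>2) < e / 4" using l[of "e / 4"] by auto
  then obtain h where h: "h \<in> hspan" "(LINT x|lborel. (u x - h x)\<^sup>2) < e / 4"
    using hclosure_approx[of u "e / 4"] e by auto
  have "(LINT x|lborel. ((f x - u x) + (u x - h x))\<^sup>2) \<le> 2 * (LINT x|lborel. (f x - u x)\<^sup>2) + 2 * (LINT x|lborel. (u x - h x)\<^sup>2)"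
    by (rule integral_sum_sq_le) (use f u h hclosure_L2 hspan_L2 in \<open>auto intro!: L2_diff\<close>)
  then have "(LINT x|lborel. (f x - h x)\<^sup>2) < e" using u h by simp
  then show "\<exists>h\<in>hspan. (LINT x|lborel. (f x - h x)\<^sup>2) < e" using h by blast
qed

lemma hclosure_add: assumes f: "f \<in> hclosure" and g: "g \<in> hclosure" shows "(\<lambda>x. f x + g x) \<in> hclosure"
  unfolding hclosure_def
proof safe
  show "(\<lambda>x. f x + g x) \<in> L2" using f g hclosure_L2 L2_add by blast
  fix e :: real assume e: "e > 0"
  then obtain h where h: "h \<in> hspan" "(LINT x|lborel. (f x - h x)\<^sup>2) < e / 4"
    using hclosure_approx[OF f, of "e / 4"] by auto
  from e obtain k where k: "k \<in> hspan" "(LINT x|lborel. (g x - k x)\<^sup>2) < e / 4"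
    using hclosure_approx[OF g, of "e / 4"] by auto
  have "(LINT x|lborel. ((f x - h x) + (g x - k x))\<^sup>2) \<le> 2 * (LINT x|lborel. (f x - h x)\<^sup>2) + 2 * (LINT x|lborel. (g x - k x)\<^sup>2)"
    by (rule integral_sum_sq_le) (use f g h k hclosure_L2 hspan_L2 in \<open>auto intro!: L2_diff\<close>)
  then have "(LINT x|lborel. ((f x + g x) - (h x + k x))\<^sup>2) < e" using h k by (simp add: algebra_simps)
  then show "\<exists>h\<in>hspan. (LINT x|lborel. (f x + g x - h x)\<^sup>2) < e"
    using hspan.add[OF h(1) k(1)] by (intro bexI[of _ "\<lambda>x. h x + k x"])
qed

text \<open>Dominated convergence applied to \<open>(f - S n)^2\<close>, with majorant
  \<open>4 W^2\<close>. It serves two limits: partial sums of the exponential series, and the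
  removal of the cutoff.\<close>

lemma hclosure_dominated:
  assumes S: "\<And>n. S n \<in> hclosure" and f: "f \<in> borel_measurable borel"
    and lim: "\<And>x. (\<lambda>n. S n x) \<longlonglongrightarrow> f x"
    and W: "W \<in> L2" and bound: "\<And>n x. \<bar>S n x\<bar> \<le> W x"
  shows "f \<in> hclosure"
proof (rule hclosure_limit)
  have fb: "\<bar>f x\<bar> \<le> W x" for x
    by (rule tendsto_upperbound[OF tendsto_rabs[OF lim[of x]]]) (auto simp: bound)
  show fL: "f \<in> L2" by (rule L2_bounded[OF W f]) (rule order_trans[OF fb abs_ge_self])
  have "(\<lambda>n. LINT x|lborel. (f x - S n x)\<^sup>2) \<longlonglongrightarrow> (LINT (x::real^'a)|lborel. 0)"
  proof (rule integral_dominated_convergence)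
    show "integrable lborel (\<lambda>x. 4 * (W x)\<^sup>2)" using L2_integrable[OF W] by simp
    show "(\<lambda>x. (f x - S n x)\<^sup>2) \<in> borel_measurable lborel" for n
      using f L2_measurable[OF hclosure_L2[OF S[of n]]] by simp
    show "AE x in lborel. (\<lambda>n. (f x - S n x)\<^sup>2) \<longlonglongrightarrow> 0"
      by (rule AE_I2) (auto intro!: tendsto_eq_intros lim)
    show "AE x in lborel. norm ((f x - S n x)\<^sup>2) \<le> 4 * (W x)\<^sup>2" for n
    proof (rule AE_I2)
      fix x
      have "\<bar>f x - S n x\<bar> \<le> 2 * W x" using fb[of x] bound[of n x] by linarith
      then have "\<bar>f x - S n x\<bar>\<^sup>2 \<le> (2 * W x)\<^sup>2" by (intro power_mono) auto
      then show "norm ((f x - S n x)\<^sup>2) \<le> 4 * (W x)\<^sup>2" by (simp add: power_mult_distrib)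
    qed
  qed simp
  then have lim0: "(\<lambda>n. LINT x|lborel. (f x - S n x)\<^sup>2) \<longlonglongrightarrow> 0" by simp
  fix e :: real assume "e > 0"
  then have "\<forall>\<^sub>F n in sequentially. (LINT x|lborel. (f x - S n x)\<^sup>2) < e"
    using order_tendstoD(2)[OF lim0] by blast
  then show "\<exists>u\<in>hclosure. (LINT x|lborel. (f x - u x)\<^sup>2) < e"
    using S by (auto simp: eventually_sequentially)
qed

lemma bounded_linear_coords:
  fixes p :: "real^'d::finite \<Rightarrow> real"
  assumes "bounded_linear p" shows "p x = (\<Sum>i\<in>UNIV. p (axis i 1) * x $ i)"
proof -
  have lin: "linear p" using assms by (rule bounded_linear.linear)
  have "p x = p (\<Sum>i\<in>UNIV. (x $ i) *\<^sub>R axis i 1)"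
    using basis_expansion[of x] by (simp add: scalar_mult_eq_scaleR)
  then show ?thesis by (simp add: linear_sum[OF lin] linear_cmul[OF lin] mult.commute)
qed

text \<open>Polynomials are built from linear forms, constants, sums and products; \<open>h\<close>
  is arbitrary in the induction so that the product case can apply both hypotheses in
  succession.\<close>

lemma hspan_poly:
  fixes p :: "real^'d::finite \<Rightarrow> real"
  assumes "real_polynomial_function p" "h \<in> hspan" shows "(\<lambda>x. p x * h x) \<in> hspan"
  using assms
proof (induction p arbitrary: h)
  case (linear p)
  have "(\<lambda>x. \<Sum>i\<in>UNIV. p (axis i 1) * (x $ i * h x)) \<in> hspan"
    by (intro hspan_sum hspan.cmult hspan_coord linear)
  then show ?case
    by (subst bounded_linear_coords[OF linear(1)]) (simp add: sum_distrib_right mult.assoc)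
next
  case (add f g)
  then show ?case by (simp add: distrib_right hspan.add)
next
  case (mult f g)
  then show ?case by (simp add: mult.assoc)
qed (rule hspan.cmult)

section \<open>Approximation in \<open>L2\<close> by polynomials times Gaussians\<close>

definition gaussian :: "real^'d::finite \<Rightarrow> real" where "gaussian x = exp (- (norm x)\<^sup>2 / 2)"

lemma gaussian_hspan: "(gaussian :: real^'d::finite \<Rightarrow> real) \<in> hspan"
proof -
  have "hermite1 0 t = exp (- t\<^sup>2 / 2) / hermite_scale 0" for t
    by (simp add: hermite1_gauss_deriv exp_add[symmetric])
  then have "hermite (\<lambda>i::'d. 0) x = (\<Prod>i\<in>UNIV. exp (- (x $ i)\<^sup>2 / 2)) / hermite_scale 0 ^ CARD('d)" for x
    by (simp add: hermite_def prod_dividef)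
  moreover have "(\<Prod>i\<in>UNIV. exp (- (x $ i)\<^sup>2 / 2)) = gaussian x" for x :: "real^'d"
    unfolding gaussian_def norm_sq_sum
    by (simp add: exp_sum[symmetric] sum_negf sum_divide_distrib power2_eq_square)
  ultimately have "gaussian = (\<lambda>x::real^'d. hermite_scale 0 ^ CARD('d) * hermite (\<lambda>i::'d. 0) x)"
    using hermite_scale_pos[of 0] by auto
  moreover have "(\<lambda>x. hermite_scale 0 ^ CARD('d) * hermite (\<lambda>i::'d. 0) x) \<in> hspan"
    by (intro hspan.intros)
  ultimately show ?thesis by (simp only:)
qed

text \<open>A square root of \<open>gaussian\<close>: one factor pays for the bound
  \<open>exp (|x|^2 / 4)\<close> on the partial sums of the exponential series, and the other keeps
  the majorant square integrable.\<close>

definition gquarter :: "real^'d::finite \<Rightarrow> real" where "gquarter x = exp (- (norm x)\<^sup>2 / 4)"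

lemma gquarter: "0 < gquarter x" "gquarter x \<le> 1" "gquarter x * gquarter x = gaussian x"
  by (auto simp: gquarter_def gaussian_def exp_add[symmetric])

lemma continuous_gquarter: "continuous_on S gquarter" "continuous_on S gaussian"
  unfolding gquarter_def[abs_def] gaussian_def[abs_def] by (intro continuous_intros; simp)+

lemma measurable_gquarter [measurable]: "gquarter \<in> borel_measurable borel" "gaussian \<in> borel_measurable borel"
  by (intro borel_measurable_continuous_onI continuous_gquarter)+

lemma measurable_poly [measurable_dest]:
  "real_polynomial_function (p :: real^'d::finite \<Rightarrow> real) \<Longrightarrow> p \<in> borel_measurable borel"
  by (intro borel_measurable_continuous_onI)
    (simp add: continuous_on_polymonial_function real_polynomial_function_eq)

lemma exp_partial_sums:
  fixes y :: real
  shows "\<bar>\<Sum>j<n. y ^ j / fact j\<bar> \<le> exp \<bar>y\<bar>" "(\<lambda>n. \<Sum>j<n. y ^ j / fact j) \<longlonglongrightarrow> exp y"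
proof -
  have s: "(\<lambda>j. y ^ j / fact j) sums exp y" for y :: real
    using exp_converges[of y] by (simp add: field_simps)
  show "(\<lambda>n. \<Sum>j<n. y ^ j / fact j) \<longlonglongrightarrow> exp y" using s by (simp add: sums_def)
  have "\<bar>\<Sum>j<n. y ^ j / fact j\<bar> \<le> (\<Sum>j<n. \<bar>y\<bar> ^ j / fact j)"
    by (rule order_trans[OF sum_abs]) (simp add: power_abs)
  also have "\<dots> \<le> exp \<bar>y\<bar>"
    unfolding sums_unique[OF s] by (rule sum_le_suminf) (use s sums_summable in auto)
  finally show "\<bar>\<Sum>j<n. y ^ j / fact j\<bar> \<le> exp \<bar>y\<bar>" .
qed

lemma real_polynomial_function_norm_sq:
  "real_polynomial_function (\<lambda>x::real^'d::finite. (norm x)\<^sup>2)"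
  unfolding norm_sq_sum
  by (intro real_polynomial_function_sum real_polynomial_function.intros bounded_linear_vec_nth) auto

text \<open>Expanding one factor \<open>exp (- |x|^2 / 4)\<close> into its power series costs at most
  \<open>exp (|x|^2 / 4)\<close>, which the Gaussian weight absorbs; iterating reaches all powers.\<close>

lemma poly_gquarter_hclosure:
  fixes p :: "real^'d::finite \<Rightarrow> real"
  assumes "real_polynomial_function p"
  shows "(\<lambda>x. p x * gquarter x ^ m * gaussian x) \<in> hclosure"
  using assms
proof (induction m arbitrary: p)
  case 0
  then show ?case by (simp add: hspan_hclosure hspan_poly gaussian_hspan)
next
  case (Suc m)
  let ?y = "\<lambda>x::real^'d. - (norm x)\<^sup>2 / 4"
  let ?S = "\<lambda>n x. (p x * (\<Sum>j<n. ?y x ^ j / fact j)) * gquarter x ^ m * gaussian x"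
  have pm[measurable]: "p \<in> borel_measurable borel" using Suc(2) by (rule measurable_poly)
  have yp: "real_polynomial_function ?y"
    using real_polynomial_function.intros(4)[OF real_polynomial_function.intros(2)[of "- 1 / 4"] real_polynomial_function_norm_sq]
    by simp
  show ?case
  proof (rule hclosure_dominated[where S = ?S and W = "\<lambda>x. \<bar>p x\<bar> * gquarter x"])
    show "?S n \<in> hclosure" for n
    proof (rule Suc(1))
      have "real_polynomial_function (\<lambda>x. \<Sum>j<n. inverse (fact j) * ?y x ^ j)"
        by (intro real_polynomial_function_sum real_polynomial_function.intros(4) real_polynomial_function.intros(2)
            real_polynomial_function_power yp) auto
      then show "real_polynomial_function (\<lambda>x. p x * (\<Sum>j<n. ?y x ^ j / fact j))"
        using Suc(2) by (simp add: field_simps real_polynomial_function.intros(4))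
    qed
    show "(\<lambda>x. p x * gquarter x ^ Suc m * gaussian x) \<in> borel_measurable borel" by measurable
    show "(\<lambda>n. ?S n x) \<longlonglongrightarrow> p x * gquarter x ^ Suc m * gaussian x" for x
    proof -
      have "(\<lambda>n. ?S n x) \<longlonglongrightarrow> (p x * exp (?y x)) * gquarter x ^ m * gaussian x"
        by (intro tendsto_intros exp_partial_sums)
      then show ?thesis by (simp add: gquarter_def[of x] mult.assoc)
    qed
    show "(\<lambda>x. \<bar>p x\<bar> * gquarter x) \<in> L2"
      unfolding L2_def
    proof safe
      have "(\<lambda>x. (p x * p x) * gaussian x) \<in> hspan"
        using hspan_poly[OF real_polynomial_function.intros(4)[OF Suc(2) Suc(2)] gaussian_hspan] .
      then have "integrable lborel (\<lambda>x. (p x * p x) * gaussian x)"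
        by (intro schwartz_integrable hspan_schwartz)
      then show "integrable lborel (\<lambda>x. (\<bar>p x\<bar> * gquarter x)\<^sup>2)"
        by (simp add: power_mult_distrib power2_eq_square gquarter(3) mult_ac flip: gquarter(3))
    qed measurable
    show "\<bar>?S n x\<bar> \<le> \<bar>p x\<bar> * gquarter x" for n x
    proof -
      have "\<bar>\<Sum>j<n. ?y x ^ j / fact j\<bar> \<le> exp ((norm x)\<^sup>2 / 4)"
        using exp_partial_sums(1)[where y = "?y x"] by (simp add: abs_divide)
      then have "\<bar>\<Sum>j<n. ?y x ^ j / fact j\<bar> * gquarter x \<le> exp ((norm x)\<^sup>2 / 4) * gquarter x"
        using gquarter(1)[of x] by (intro mult_right_mono) auto
      also have "\<dots> = 1" by (simp add: gquarter_def exp_add[symmetric])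
      finally have 1: "\<bar>\<Sum>j<n. ?y x ^ j / fact j\<bar> * gquarter x \<le> 1" .
      have 2: "gquarter x ^ m \<le> 1" using gquarter[of x] by (intro power_le_one) auto
      have "\<bar>?S n x\<bar> = (\<bar>p x\<bar> * gquarter x) * ((\<bar>\<Sum>j<n. ?y x ^ j / fact j\<bar> * gquarter x) * gquarter x ^ m)"
        using gquarter(1)[of x] by (simp add: abs_mult gquarter(3)[symmetric] mult_ac)
      also have "\<dots> \<le> (\<bar>p x\<bar> * gquarter x) * (1 * 1)"
        using gquarter(1)[of x] by (intro mult_left_mono mult_mono 1 2) auto
      finally show ?thesis by simp
    qed
  qed
qed

text \<open>Contains every polynomial in the pair \<open>(E x, E)\<close> with
  \<open>E = gquarter x\<close>, that is, the approximants delivered by Stone-Weierstrass.\<close>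

inductive_set gpoly :: "(real^'d::finite \<Rightarrow> real) set" where
  base: "real_polynomial_function p \<Longrightarrow> (\<lambda>x. p x * gquarter x ^ m) \<in> gpoly"
| add: "u \<in> gpoly \<Longrightarrow> v \<in> gpoly \<Longrightarrow> (\<lambda>x. u x + v x) \<in> gpoly"

lemma gpoly_hclosure: "u \<in> gpoly \<Longrightarrow> (\<lambda>x. u x * gaussian x) \<in> hclosure"
  by (induction rule: gpoly.induct) (auto simp: poly_gquarter_hclosure distrib_right hclosure_add)

lemma gpoly_mult_poly:
  assumes p: "real_polynomial_function p"
  shows "u \<in> gpoly \<Longrightarrow> (\<lambda>x. u x * p x) \<in> gpoly"
proof (induction rule: gpoly.induct)
  case (base q m)
  then show ?case using gpoly.base[OF real_polynomial_function.intros(4)[OF p base], of m] by (simp add: mult_ac)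
qed (simp add: distrib_right gpoly.add)

lemma gpoly_mult_gquarter: "u \<in> gpoly \<Longrightarrow> (\<lambda>x. u x * gquarter x) \<in> gpoly"
proof (induction rule: gpoly.induct)
  case (base q m)
  then show ?case using gpoly.base[OF base, of "Suc m"] by (simp add: mult_ac)
qed (simp add: distrib_right gpoly.add)

text \<open>The extra factor \<open>u\<close> lets the product case apply both induction hypotheses
  in succession. In the linear case \<open>q (E x, E)\<close> is \<open>E\<close> times an affine
  function of \<open>x\<close>.\<close>

lemma gpoly_mult:
  fixes q :: "(real^'d::finite) \<times> real \<Rightarrow> real"
  assumes "real_polynomial_function q"
  shows "u \<in> gpoly \<Longrightarrow> (\<lambda>x. u x * q (gquarter x *\<^sub>R x, gquarter x)) \<in> gpoly"
  using assms
proof (induction q arbitrary: u)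
  case (linear q)
  have lin: "linear q" using linear(1) by (rule bounded_linear.linear)
  have q: "q (t *\<^sub>R x, t) = t * q (x, 0) + t * q (0, 1)" for t x
    using linear_add[OF lin, of "t *\<^sub>R (x, 0)" "t *\<^sub>R (0, 1)"]
    unfolding linear_cmul[OF lin] by simp
  have "real_polynomial_function (\<lambda>x. q (x, 0) + q (0, 1))"
    by (intro real_polynomial_function.intros bounded_linear_compose[OF linear(1)] bounded_linear_Pair
        bounded_linear_ident bounded_linear_zero)
  then have "(\<lambda>x. (u x * gquarter x) * (q (x, 0) + q (0, 1))) \<in> gpoly"
    by (intro gpoly_mult_poly gpoly_mult_gquarter linear)
  then show ?case by (simp add: q algebra_simps)
next
  case (const c)
  then show ?case by (intro gpoly_mult_poly real_polynomial_function.intros(2))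
next
  case (add f g)
  then show ?case by (simp add: distrib_left gpoly.add)
next
  case (mult f g)
  then show ?case by (simp add: mult.assoc[symmetric])
qed

text \<open>From \<open>t <= 1 + t^2 / 4 <= exp (t^2 / 4)\<close>. Both components of
  \<open>(E x, E)\<close> thus have norm at most 1, which places the pair in the ball of radius
  2.\<close>

lemma gquarter_norm_le: "gquarter x * norm x \<le> 1"
proof -
  have "norm x \<le> 1 + (norm x)\<^sup>2 / 4"
    using zero_le_power2[of "norm x / 2 - 1"] by (simp add: power2_diff power_divide)
  also have "\<dots> \<le> exp ((norm x)\<^sup>2 / 4)" by (rule exp_ge_add_one_self)
  finally show ?thesis by (simp add: gquarter_def exp_minus field_simps)
qed

text \<open>The map \<open>x \<mapsto> (E x, E)\<close> with \<open>E = exp (- |x|^2 / 4)\<close> embeds the space into a compact ball;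
  cutting off where \<open>E\<close> is small makes \<open>F\<close> divided by the Gaussian a continuous function on that ball,
  so that Stone-Weierstrass yields an approximation that is uniform on the whole space.\<close>

lemma cutoff_hclosure:
  fixes F :: "real^'d::finite \<Rightarrow> real"
  assumes F: "continuous_on UNIV F" "F \<in> L2" and N: "N > 0"
  shows "(\<lambda>x. F x * min 1 (max 0 (N * gquarter x - 1))) \<in> hclosure"
proof (rule hclosure_limit)
  let ?c = "\<lambda>t. min 1 (max 0 (N * t - 1))"
  let ?J = "\<lambda>x::real^'d. (gquarter x *\<^sub>R x, gquarter x)"
  have Fm: "F \<in> borel_measurable borel" using F(1) by (rule borel_measurable_continuous_onI)
  have c01: "\<bar>?c t\<bar> \<le> 1" for t by auto
  show L2: "(\<lambda>x. F x * ?c (gquarter x)) \<in> L2"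
    by (rule L2_bounded[OF F(2)]) (use Fm c01 in \<open>auto simp: abs_mult intro!: mult_left_le\<close>)
  \<comment> \<open>The point \<open>x\<close> is recovered from \<open>(E x, E)\<close> as a
    quotient. Replacing the denominator by its maximum with \<open>1 / N\<close> keeps the quotient
    continuous and changes it only where the cutoff vanishes.\<close>
  define \<Phi> where "\<Phi> z = F ((1 / max (snd z) (1 / N)) *\<^sub>R fst z)
     * exp ((norm ((1 / max (snd z) (1 / N)) *\<^sub>R fst z))\<^sup>2 / 2) * ?c (snd z)" for z :: "(real^'d) \<times> real"
  have mx: "max t (1 / N) \<noteq> 0" for t using N by (auto simp: max_def)
  have cont: "continuous_on UNIV \<Phi>"
    unfolding \<Phi>_def by (intro continuous_intros continuous_on_compose2[OF F(1)]) (auto simp: mx)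
  have \<Phi>J: "\<Phi> (?J x) * gaussian x = F x * ?c (gquarter x)" for x
  proof (cases "gquarter x \<ge> 1 / N")
    case True
    then have "(1 / max (gquarter x) (1 / N)) *\<^sub>R (gquarter x *\<^sub>R x) = x"
      using gquarter(1)[of x] by (simp add: max_def)
    then show ?thesis unfolding \<Phi>_def by (simp add: gaussian_def exp_minus)
  next
    case False
    then have "N * gquarter x \<le> 1" using N by (simp add: field_simps)
    then show ?thesis unfolding \<Phi>_def by (simp add: max_def min_def)
  qed
  have J: "?J x \<in> cball 0 2" for x
    using norm_Pair_le[of "gquarter x *\<^sub>R x" "gquarter x"] gquarter_norm_le[of x] gquarter[of x] by auto
  fix e :: real assume e: "e > 0"
  let ?G = "LINT x::real^'d|lborel. (gaussian x)\<^sup>2"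
  have G: "?G \<ge> 0" by (rule integral_nonneg_AE) simp
  \<comment> \<open>Chosen so that \<open>\<delta>^2 * ?G < e\<close>; the \<open>+ 1\<close> gives
    a positive denominator from \<open>?G \<ge> 0\<close> alone.\<close>
  define \<delta> where "\<delta> = sqrt (e / (?G + 1))"
  have "0 < e / (?G + 1)" using e G by (intro divide_pos_pos add_nonneg_pos) auto
  then have \<delta>: "\<delta> > 0" "\<delta>\<^sup>2 = e / (?G + 1)" by (simp_all add: \<delta>_def)
  obtain q where q: "real_polynomial_function q" "\<And>z. z \<in> cball 0 2 \<Longrightarrow> \<bar>\<Phi> z - q z\<bar> < \<delta>"
    using Stone_Weierstrass_real_polynomial_function[OF compact_cball continuous_on_subset[OF cont subset_UNIV] \<delta>(1)]
    by blast
  let ?u = "\<lambda>x. q (?J x) * gaussian x"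
  have "(\<lambda>x. 1 * gquarter x ^ 0) \<in> gpoly" by (intro gpoly.base real_polynomial_function.intros(2))
  then have u: "?u \<in> hclosure" using gpoly_mult[OF q(1), of "\<lambda>x. 1 * gquarter x ^ 0"] by (auto dest: gpoly_hclosure)
  have gL2: "(gaussian :: real^'d \<Rightarrow> real) \<in> L2" by (rule hspan_L2[OF gaussian_hspan])
  have "(LINT x|lborel. (F x * ?c (gquarter x) - ?u x)\<^sup>2) \<le> (LINT x::real^'d|lborel. \<delta>\<^sup>2 * (gaussian x)\<^sup>2)"
  proof (rule integral_mono)
    show "integrable lborel (\<lambda>x. (F x * ?c (gquarter x) - ?u x)\<^sup>2)"
      by (intro L2_integrable L2_diff L2 hclosure_L2[OF u])
    show "integrable lborel (\<lambda>x::real^'d. \<delta>\<^sup>2 * (gaussian x)\<^sup>2)" using L2_integrable[OF gL2] by simp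
    fix x
    have "(F x * ?c (gquarter x) - ?u x)\<^sup>2 = \<bar>\<Phi> (?J x) - q (?J x)\<bar>\<^sup>2 * (gaussian x)\<^sup>2"
      unfolding \<Phi>J[symmetric] by (simp add: left_diff_distrib[symmetric] power_mult_distrib)
    also have "\<dots> \<le> \<delta>\<^sup>2 * (gaussian x)\<^sup>2"
      using q(2)[OF J[of x]] by (intro mult_right_mono power_mono) auto
    finally show "(F x * ?c (gquarter x) - ?u x)\<^sup>2 \<le> \<delta>\<^sup>2 * (gaussian x)\<^sup>2" .
  qed
  also have "\<dots> = e * (?G / (?G + 1))" using \<delta>(2) by simp
  also have "e * (?G / (?G + 1)) < e * 1"
    using e G by (intro mult_strict_left_mono divide_less_eq_1_pos[THEN iffD2] add_nonneg_pos) linarith+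
  also have "e * 1 = e" by simp
  finally show "\<exists>u\<in>hclosure. (LINT x|lborel. (F x * ?c (gquarter x) - u x)\<^sup>2) < e"
    using u by (intro bexI[of _ ?u])
qed

text \<open>Since \<open>gquarter x > 0\<close>, at each point the cutoff is 1 for all large
  \<open>n\<close>; the cut-off functions are dominated by \<open>|F|\<close>.\<close>

lemma continuous_hclosure:
  assumes F: "continuous_on UNIV F" "F \<in> L2"
  shows "F \<in> hclosure"
proof (rule hclosure_dominated)
  let ?c = "\<lambda>n t. min 1 (max 0 (real (Suc n) * t - 1))"
  show "(\<lambda>x. F x * ?c n (gquarter x)) \<in> hclosure" for n by (rule cutoff_hclosure[OF F]) simp
  show "F \<in> borel_measurable borel" using F(1) by (rule borel_measurable_continuous_onI)
  then show "(\<lambda>x. \<bar>F x\<bar>) \<in> L2" using L2_bounded[OF F(2), of "\<lambda>x. \<bar>F x\<bar>"] by simp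
  show "\<bar>F x * ?c n (gquarter x)\<bar> \<le> \<bar>F x\<bar>" for n x by (auto simp: abs_mult intro!: mult_left_le)
  show "(\<lambda>n. F x * ?c n (gquarter x)) \<longlonglongrightarrow> F x" for x
  proof (rule tendsto_eventually)
    obtain n :: nat where n: "2 / gquarter x \<le> real n" using real_arch_simple by blast
    have "F x * ?c m (gquarter x) = F x" if "m \<ge> n" for m
    proof -
      have "2 / gquarter x \<le> real (Suc m)" using n that by linarith
      then have "2 \<le> real (Suc m) * gquarter x" using gquarter(1)[of x] by (simp add: field_simps)
      then show ?thesis by simp
    qed
    then show "\<forall>\<^sub>F m in sequentially. F x * ?c m (gquarter x) = F x"
      unfolding eventually_sequentially by blast
  qed
qed

lemma schwartz_hclosure: "f \<in> schwartz \<Longrightarrow> f \<in> hclosure"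
  by (rule continuous_hclosure[OF symb_continuous_on[OF schwartz_symb] schwartz_L2])

section \<open>Bessel's inequality and Parseval's identity\<close>

text \<open>The coefficients vanish outside \<open>A\<close> so that two expansions can be rewritten
  over the union of their index sets before being added.\<close>

lemma hspan_expansion:
  "h \<in> hspan \<Longrightarrow> \<exists>A c. finite A \<and> (\<forall>k. k \<notin> A \<longrightarrow> c k = 0) \<and> h = (\<lambda>x. \<Sum>k\<in>A. c k * hermite k x)"
proof (induction rule: hspan.induct)
  case (hermite k)
  show ?case by (intro exI[of _ "{k}"] exI[of _ "\<lambda>l. if l = k then 1 else 0"]) auto
next
  case (add f g)
  then obtain A c B d where A: "finite A" "\<forall>k. k \<notin> A \<longrightarrow> c k = 0" "f = (\<lambda>x. \<Sum>k\<in>A. c k * hermite k x)"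
    and B: "finite B" "\<forall>k. k \<notin> B \<longrightarrow> d k = 0" "g = (\<lambda>x. \<Sum>k\<in>B. d k * hermite k x)" by blast
  have "f x = (\<Sum>k\<in>A \<union> B. c k * hermite k x)" "g x = (\<Sum>k\<in>A \<union> B. d k * hermite k x)" for x
    unfolding A(3) B(3) using A B by (auto intro!: sum.mono_neutral_left)
  then have "(\<lambda>x. f x + g x) = (\<lambda>x. \<Sum>k\<in>A \<union> B. (c k + d k) * hermite k x)"
    by (simp add: sum.distrib distrib_right)
  then show ?case using A B by (intro exI[of _ "A \<union> B"] exI[of _ "\<lambda>k. c k + d k"]) auto
next
  case (cmult f a)
  then obtain A c where A: "finite A" "\<forall>k. k \<notin> A \<longrightarrow> c k = 0" "f = (\<lambda>x. \<Sum>k\<in>A. c k * hermite k x)" by blast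
  then show ?case
    by (intro exI[of _ A] exI[of _ "\<lambda>k. a * c k"]) (auto simp: sum_distrib_left mult.assoc)
qed

text \<open>Completing the square one coefficient at a time, by orthonormality. With
  \<open>c k\<close> equal to the Fourier coefficients this yields Bessel's inequality; for general
  \<open>c\<close> it shows that no combination over \<open>A\<close> approximates better, which is
  what \<open>parseval\<close> uses.\<close>

lemma integral_diff_expansion:
  assumes f: "f \<in> L2" and A: "finite A"
  shows "(LINT x|lborel. (f x - (\<Sum>k\<in>A. c k * hermite k x))\<^sup>2) =
    (LINT x|lborel. (f x)\<^sup>2) - (\<Sum>k\<in>A. (ip f (hermite k))\<^sup>2) + (\<Sum>k\<in>A. (c k - ip f (hermite k))\<^sup>2)"
  using A
proof (induction A)
  case (insert a A)
  let ?u = "\<lambda>x. f x - (\<Sum>k\<in>A. c k * hermite k x)"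
  have hL: "hermite k \<in> L2" for k by (rule schwartz_L2[OF hermite_schwartz])
  have "(\<lambda>x. \<Sum>k\<in>A. c k * hermite k x) \<in> hspan" by (intro hspan_sum hspan.intros)
  then have uL: "?u \<in> L2" using f by (intro L2_diff[OF _ hspan_L2])
  have int: "integrable lborel (\<lambda>x. f x * hermite a x)" "integrable lborel (\<lambda>x. hermite k x * hermite a x)" for k
    using f hL by (auto intro: L2_mult_integrable)
  have "ip ?u (hermite a) = (LINT x|lborel. f x * hermite a x - (\<Sum>k\<in>A. c k * (hermite k x * hermite a x)))"
    by (simp add: left_diff_distrib sum_distrib_right mult.assoc)
  also have "\<dots> = ip f (hermite a) - (\<Sum>k\<in>A. c k * ip (hermite k) (hermite a))"
    using int by (simp add: Bochner_Integration.integral_sum)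
  also have "(\<Sum>k\<in>A. c k * ip (hermite k) (hermite a)) = 0"
    using insert by (auto simp: ip_hermite intro!: sum.neutral)
  finally have u: "ip ?u (hermite a) = ip f (hermite a)" by simp
  have lin: "(LINT x|lborel. U x - s * V x + t * W x) = (LINT x|lborel. U x) - s * (LINT x|lborel. V x) + t * (LINT x|lborel. W x)"
    if "integrable lborel U" "integrable lborel V" "integrable lborel W" for U V W :: "real^'a \<Rightarrow> real" and s t
    using that by simp
  have "(LINT x|lborel. (f x - (\<Sum>k\<in>insert a A. c k * hermite k x))\<^sup>2) =
      (LINT x|lborel. (?u x)\<^sup>2 - 2 * c a * (?u x * hermite a x) + (c a)\<^sup>2 * (hermite a x * hermite a x))"
    using insert by (simp add: power2_eq_square algebra_simps)
  also have "\<dots> = (LINT x|lborel. (?u x)\<^sup>2) - 2 * c a * ip ?u (hermite a) + (c a)\<^sup>2 * ip (hermite a) (hermite a)"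
    by (rule lin[OF L2_integrable[OF uL] L2_mult_integrable[OF uL hL] L2_mult_integrable[OF hL hL]])
  also have "\<dots> = (LINT x|lborel. (?u x)\<^sup>2) - (ip f (hermite a))\<^sup>2 + (c a - ip f (hermite a))\<^sup>2"
    unfolding u ip_hermite by (simp add: power2_diff)
  finally show ?case using insert by simp
qed simp

lemma bessel:
  assumes "f \<in> L2" "finite A" shows "(\<Sum>k\<in>A. (ip f (hermite k))\<^sup>2) \<le> (LINT x|lborel. (f x)\<^sup>2)"
proof -
  have "0 \<le> (LINT x|lborel. (f x - (\<Sum>k\<in>A. ip f (hermite k) * hermite k x))\<^sup>2)" by simp
  then show ?thesis unfolding integral_diff_expansion[OF assms] by simp
qed

text \<open>If some combination over a finite \<open>A\<close> is within \<open>e\<close> of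
  \<open>f\<close>, then the coefficients over \<open>A\<close>, and over every larger finite set,
  already account for the norm up to \<open>e\<close>; Bessel's inequality is the bound from
  above.\<close>

lemma parseval:
  assumes "f \<in> hclosure"
  shows "((\<lambda>k. (ip f (hermite k))\<^sup>2) has_sum (LINT x|lborel. (f x)\<^sup>2)) UNIV"
  unfolding has_sum_def tendsto_iff
proof (intro allI impI)
  fix e :: real assume "e > 0"
  then obtain h where h: "h \<in> hspan" "(LINT x|lborel. (f x - h x)\<^sup>2) < e"
    using assms unfolding hclosure_def by blast
  obtain A c where A: "finite A" "h = (\<lambda>x. \<Sum>k\<in>A. c k * hermite k x)" using hspan_expansion[OF h(1)] by blast
  have f: "f \<in> L2" using assms by (rule hclosure_L2)
  have "0 \<le> (\<Sum>k\<in>A. (c k - ip f (hermite k))\<^sup>2)" by (intro sum_nonneg) auto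
  then have lower: "(LINT x|lborel. (f x)\<^sup>2) - e < (\<Sum>k\<in>A. (ip f (hermite k))\<^sup>2)"
    using h(2) unfolding A(2) integral_diff_expansion[OF f A(1)] by linarith
  have "dist (\<Sum>k\<in>B. (ip f (hermite k))\<^sup>2) (LINT x|lborel. (f x)\<^sup>2) < e" if "finite B" "A \<subseteq> B" for B
  proof -
    have "(\<Sum>k\<in>A. (ip f (hermite k))\<^sup>2) \<le> (\<Sum>k\<in>B. (ip f (hermite k))\<^sup>2)"
      using that by (intro sum_mono2) auto
    then show ?thesis using lower bessel[OF f that(1)] by (simp add: dist_real_def)
  qed
  then show "\<forall>\<^sub>F B in finite_subsets_at_top UNIV. dist (\<Sum>k\<in>B. (ip f (hermite k))\<^sup>2) (LINT x|lborel. (f x)\<^sup>2) < e"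
    unfolding eventually_finite_subsets_at_top using A(1) by blast
qed

lemma ip_add: "f \<in> L2 \<Longrightarrow> g \<in> L2 \<Longrightarrow> h \<in> L2 \<Longrightarrow> ip (\<lambda>x. f x + g x) h = ip f h + ip g h"
  by (simp add: distrib_right L2_mult_integrable)

section \<open>Hermite-Sobolev norms of integer order\<close>

definition weight :: "('d::finite \<Rightarrow> nat) \<Rightarrow> real" where
  "weight k = real (2 * (\<Sum>i\<in>UNIV. k i) + CARD('d))"

lemma weight_ge_1: "1 \<le> weight k"
proof -
  have "1 \<le> CARD('a)" by (simp add: Suc_le_eq)
  then have "1 \<le> 2 * (\<Sum>i\<in>UNIV. k i) + CARD('a)" by linarith
  then show ?thesis unfolding weight_def by linarith
qed

lemma weight_raise: "weight (raise i k) = weight k + 2"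
proof -
  have "(\<Sum>j\<in>UNIV. raise i k j) = Suc (\<Sum>j\<in>UNIV. k j)"
    unfolding raise_def by (subst (1 2) sum.remove[of UNIV i]) auto
  then show ?thesis by (simp add: weight_def)
qed

text \<open>Follows from \<open>weight k \<ge> 1\<close>. This 3 is the source of the constants
  \<open>3 ^ m\<close> below.\<close>

lemma weight_raise_le: "weight (raise i k) \<le> 3 * weight k"
  using weight_ge_1[of k] by (simp add: weight_raise)

lemma weight_coord: "real (Suc (k i)) \<le> weight k"
proof -
  have "k i \<le> (\<Sum>i\<in>UNIV. k i)" by (rule member_le_sum) auto
  moreover have "1 \<le> CARD('a)" by (simp add: Suc_le_eq)
  ultimately have "Suc (k i) \<le> 2 * (\<Sum>i\<in>UNIV. k i) + CARD('a)" by linarith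
  then show ?thesis unfolding weight_def by (simp only: of_nat_le_iff)
qed

lemma inj_raise: "inj (raise i)"
proof (rule injI)
  fix k l assume "raise i k = raise i l"
  then have "lower i (raise i k) = lower i (raise i l)" by simp
  then show "k = l" by (simp add: raise_def lower_def)
qed

lemma not_range_raise: "k \<notin> range (raise i) \<Longrightarrow> k i = 0"
proof (rule ccontr)
  assume k: "k \<notin> range (raise i)" "k i \<noteq> 0"
  then have "k = raise i (lower i k)" by (auto simp: raise_def lower_def)
  with k(1) show False by blast
qed

lemma lower_raise: "lower i (raise i k) = k" by (simp add: raise_def lower_def)

lemma nonneg_summable_bound:
  fixes f g :: "'a \<Rightarrow> real"
  assumes "g summable_on A" "\<And>k. k \<in> A \<Longrightarrow> 0 \<le> f k" "\<And>k. k \<in> A \<Longrightarrow> f k \<le> g k"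
  shows "f summable_on A" "infsum f A \<le> infsum g A"
proof -
  show "f summable_on A" by (rule summable_on_comparison_test[OF assms(1)]) (use assms in auto)
  then show "infsum f A \<le> infsum g A" by (rule infsum_mono[OF _ assms(1)]) (use assms in auto)
qed

lemma raise_shift:
  fixes c :: "('d::finite \<Rightarrow> nat) \<Rightarrow> real"
  assumes "c summable_on UNIV" "\<And>k. 0 \<le> c k"
  shows "(\<lambda>k. c (raise i k)) summable_on UNIV" "infsum (\<lambda>k. c (raise i k)) UNIV \<le> infsum c UNIV"
proof -
  have s: "c summable_on range (raise i)" by (rule summable_on_subset_banach[OF assms(1)]) simp
  then show "(\<lambda>k. c (raise i k)) summable_on UNIV"
    using summable_on_reindex[OF inj_raise, of c i] by (simp add: comp_def)
  have "infsum (\<lambda>k. c (raise i k)) UNIV = infsum c (range (raise i))"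
    using infsum_reindex[OF inj_raise, of c i] by (simp add: comp_def)
  also have "\<dots> \<le> infsum c UNIV" by (rule infsum_mono2[OF s assms(1)]) (use assms in auto)
  finally show "infsum (\<lambda>k. c (raise i k)) UNIV \<le> infsum c UNIV" .
qed

text \<open>The range of \<open>raise i\<close> consists of the multi-indices with positive
  \<open>i\<close>-th entry, and the remaining terms vanish. This turns sums over lowered indices
  into sums over all indices.\<close>

lemma lower_shift:
  fixes c :: "('d::finite \<Rightarrow> nat) \<Rightarrow> real"
  assumes "(\<lambda>k. c (raise i k)) summable_on UNIV" "\<And>k. k i = 0 \<Longrightarrow> c k = 0"
  shows "c summable_on UNIV" "infsum c UNIV = infsum (\<lambda>k. c (raise i k)) UNIV"
proof -
  have s: "c summable_on range (raise i)"
    using assms(1) summable_on_reindex[OF inj_raise, of c i] by (simp add: comp_def)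
  have z: "c k = 0" if "k \<notin> range (raise i)" for k using assms(2)[of k] not_range_raise[OF that] by simp
  show "c summable_on UNIV"
    using s summable_on_cong_neutral[of UNIV "range (raise i)" c c] z by auto
  have "infsum c UNIV = infsum c (range (raise i))"
    by (rule infsum_cong_neutral) (use z in auto)
  also have "\<dots> = infsum (\<lambda>k. c (raise i k)) UNIV"
    using infsum_reindex[OF inj_raise, of c i] by (simp add: comp_def)
  finally show "infsum c UNIV = infsum (\<lambda>k. c (raise i k)) UNIV" .
qed

definition hterm :: "nat \<Rightarrow> (real^'d::finite \<Rightarrow> real) \<Rightarrow> ('d \<Rightarrow> nat) \<Rightarrow> real" where
  "hterm m f k = weight k ^ m * (ip f (hermite k))\<^sup>2"

text \<open>The squared norm of order \<open>m / 2\<close>: the exponent \<open>m\<close> is the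
  \<open>2 * p\<close> of \<open>hs_norm p\<close>, so that one ladder step changes \<open>m\<close>
  by one.\<close>

definition hn :: "nat \<Rightarrow> (real^'d::finite \<Rightarrow> real) \<Rightarrow> real" where
  "hn m f = infsum (hterm m f) UNIV"

lemma hterm_nonneg: "0 \<le> hterm m f k"
  using weight_ge_1[of k] by (simp add: hterm_def)

lemma summable_on_finite_sum:
  fixes f :: "'i \<Rightarrow> 'a \<Rightarrow> real"
  shows "finite I \<Longrightarrow> (\<And>i. i \<in> I \<Longrightarrow> f i summable_on A) \<Longrightarrow> (\<lambda>k. \<Sum>i\<in>I. f i k) summable_on A"
  by (induction I rule: finite_induct) (auto intro: summable_on_add)

text \<open>The additional factor \<open>2|k| + d\<close> is split into its summands. By
  \<open>ip_raise\<close>, \<open>2 k_i\<close> times the squared coefficient of \<open>f\<close> at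
  \<open>k\<close> is the squared coefficient of \<open>x_i f + partial_i f\<close> at the lowered
  index, so the induction hypothesis for that Schwartz function applies.\<close>

lemma hterm_summable: "f \<in> schwartz \<Longrightarrow> hterm m f summable_on UNIV"
proof (induction m arbitrary: f)
  case 0
  then show ?case
    using parseval[OF schwartz_hclosure] by (auto simp: hterm_def[abs_def] summable_on_def)
next
  case (Suc m)
  have "(\<lambda>k. 2 * real (k i) * hterm m f k) summable_on UNIV" for i
  proof (rule lower_shift(1))
    let ?T = "\<lambda>x. x $ i * f x + partial i f x"
    have T: "?T \<in> schwartz"
      by (intro schwartz_add schwartz_mult[OF symb_coord] schwartz_partial Suc(2))
    show "(\<lambda>k. 2 * real (raise i k i) * hterm m f (raise i k)) summable_on UNIV"
    proof (rule nonneg_summable_bound(1)[OF summable_on_cmult_right[OF Suc(1)[OF T], of "3 ^ m"]])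
      fix k
      show "0 \<le> 2 * real (raise i k i) * hterm m f (raise i k)" by (simp add: hterm_nonneg)
      have "2 * real (Suc (k i)) * (ip f (hermite (raise i k)))\<^sup>2 = (sqrt (2 * real (Suc (k i))) * ip f (hermite (raise i k)))\<^sup>2"
        by (simp add: power_mult_distrib)
      also have "\<dots> = (ip ?T (hermite k))\<^sup>2" unfolding ip_raise[OF Suc(2)] ..
      finally have "2 * real (raise i k i) * hterm m f (raise i k) = weight (raise i k) ^ m * (ip ?T (hermite k))\<^sup>2"
        by (simp add: raise_def hterm_def mult_ac)
      also have "\<dots> \<le> (3 * weight k) ^ m * (ip ?T (hermite k))\<^sup>2"
        using weight_ge_1[of "raise i k"] by (intro mult_right_mono power_mono weight_raise_le) auto
      finally show "2 * real (raise i k i) * hterm m f (raise i k) \<le> 3 ^ m * hterm m ?T k"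
        by (simp add: hterm_def power_mult_distrib mult.assoc)
    qed
  qed simp
  then have "(\<lambda>k. (\<Sum>i\<in>UNIV. 2 * real (k i) * hterm m f k) + real CARD('a) * hterm m f k) summable_on UNIV"
    by (intro summable_on_add summable_on_finite_sum summable_on_cmult_right Suc) auto
  moreover have "(\<Sum>i\<in>UNIV. 2 * real (k i) * hterm m f k) + real CARD('a) * hterm m f k = hterm (Suc m) f k" for k
    by (simp add: hterm_def weight_def sum_distrib_right[symmetric] sum_distrib_left[symmetric] distrib_right mult.assoc)
  ultimately show ?case by (simp only:)
qed

lemma hn_0: "f \<in> schwartz \<Longrightarrow> hn 0 f = (LINT x|lborel. (f x)\<^sup>2)"
  unfolding hn_def hterm_def[abs_def] using infsumI[OF parseval[OF schwartz_hclosure]] by simp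

lemma hn_mono:
  assumes "f \<in> schwartz" "m \<le> n" shows "hn m f \<le> hn n f"
  unfolding hn_def
  by (rule nonneg_summable_bound(2)[OF hterm_summable[OF assms(1)]])
    (auto simp: hterm_nonneg, auto simp: hterm_def weight_ge_1 intro!: mult_right_mono power_increasing assms)

lemma hn_add:
  assumes "f \<in> schwartz" "g \<in> schwartz"
  shows "hn m (\<lambda>x. f x + g x) \<le> 2 * hn m f + 2 * hn m g"
proof -
  have "hn m (\<lambda>x. f x + g x) \<le> infsum (\<lambda>k. 2 * hterm m f k + 2 * hterm m g k) UNIV"
    unfolding hn_def
  proof (rule nonneg_summable_bound(2))
    show "(\<lambda>k. 2 * hterm m f k + 2 * hterm m g k) summable_on UNIV"
      by (intro summable_on_add summable_on_cmult_right hterm_summable assms)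
    fix k
    have "(ip (\<lambda>x. f x + g x) (hermite k))\<^sup>2 \<le> 2 * (ip f (hermite k))\<^sup>2 + 2 * (ip g (hermite k))\<^sup>2"
      unfolding ip_add[OF assms[THEN schwartz_L2] schwartz_L2[OF hermite_schwartz]]
      using sum_squares_bound[of "ip f (hermite k)" "ip g (hermite k)"] by (simp add: power2_sum)
    then have "weight k ^ m * (ip (\<lambda>x. f x + g x) (hermite k))\<^sup>2 \<le> weight k ^ m * (2 * (ip f (hermite k))\<^sup>2 + 2 * (ip g (hermite k))\<^sup>2)"
      using weight_ge_1[of k] by (intro mult_left_mono) auto
    then show "hterm m (\<lambda>x. f x + g x) k \<le> 2 * hterm m f k + 2 * hterm m g k"
      by (simp add: hterm_def algebra_simps)
  qed (rule hterm_nonneg)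
  also have "\<dots> = 2 * hn m f + 2 * hn m g"
    unfolding hn_def using assms
    by (subst infsum_add) (auto intro!: summable_on_cmult_right hterm_summable simp: infsum_cmult_right hterm_summable)
  finally show ?thesis .
qed

text \<open>Shared by multiplication with a coordinate and differentiation, whose ladder formulas
  differ only in signs. The raised part is bounded by the terms of \<open>f\<close> at the shifted
  index, with factor 1. The lowered part compares the weights at \<open>raise i k\<close> and
  \<open>k\<close>, which costs \<open>3 ^ m\<close>.\<close>

lemma ladder_bound:
  assumes f: "f \<in> schwartz" and g: "g \<in> schwartz"
    and eq: "\<And>k. \<bar>ip g (hermite k)\<bar> \<le> sqrt (real (k i) / 2) * \<bar>ip f (hermite (lower i k))\<bar> + sqrt (real (Suc (k i)) / 2) * \<bar>ip f (hermite (raise i k))\<bar>"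
  shows "hn m g \<le> (3 ^ m + 1) * hn (Suc m) f"
proof -
  let ?low = "\<lambda>k. weight k ^ m * (real (k i) * (ip f (hermite (lower i k)))\<^sup>2)"
  let ?up = "\<lambda>k. weight k ^ m * (real (Suc (k i)) * (ip f (hermite (raise i k)))\<^sup>2)"
  note S = hterm_summable[OF f, of "Suc m"]
  have up: "?up summable_on UNIV" "infsum ?up UNIV \<le> hn (Suc m) f"
  proof -
    have le: "?up k \<le> hterm (Suc m) f (raise i k)" for k
    proof -
      have "weight k ^ m * real (Suc (k i)) \<le> weight (raise i k) ^ m * weight (raise i k)"
        using weight_ge_1[of k] weight_coord[of k i] by (intro mult_mono power_mono) (auto simp: weight_raise)
      then show ?thesis by (simp add: hterm_def mult.assoc[symmetric] mult_right_mono mult.commute)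
    qed
    have nn: "0 \<le> ?up k" for k using weight_ge_1[of k] by simp
    note R = raise_shift[OF S hterm_nonneg, of i]
    show "?up summable_on UNIV" by (rule nonneg_summable_bound(1)[OF R(1) nn le])
    have "infsum ?up UNIV \<le> infsum (\<lambda>k. hterm (Suc m) f (raise i k)) UNIV" by (rule nonneg_summable_bound(2)[OF R(1) nn le])
    then show "infsum ?up UNIV \<le> hn (Suc m) f" using R(2) by (simp add: hn_def)
  qed
  have low: "?low summable_on UNIV" "infsum ?low UNIV \<le> 3 ^ m * hn (Suc m) f"
  proof -
    have le: "?low (raise i k) \<le> 3 ^ m * hterm (Suc m) f k" for k
    proof -
      have "weight (raise i k) ^ m * real (Suc (k i)) \<le> (3 * weight k) ^ m * weight k"
        using weight_ge_1[of k] weight_ge_1[of "raise i k"]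
        by (intro mult_mono power_mono weight_coord weight_raise_le) auto
      then have "weight (raise i k) ^ m * real (Suc (k i)) * (ip f (hermite k))\<^sup>2 \<le> (3 * weight k) ^ m * weight k * (ip f (hermite k))\<^sup>2"
        by (rule mult_right_mono) simp
      then show ?thesis unfolding lower_raise by (simp add: hterm_def raise_def power_mult_distrib mult_ac)
    qed
    have nn: "0 \<le> ?low (raise i k)" for k using weight_ge_1[of "raise i k"] by simp
    note R = nonneg_summable_bound[OF summable_on_cmult_right[OF S] nn le]
    have z: "?low k = 0" if "k i = 0" for k using that by simp
    show "?low summable_on UNIV" by (rule lower_shift(1)[OF R(1) z])
    have "infsum ?low UNIV = infsum (\<lambda>k. ?low (raise i k)) UNIV" by (rule lower_shift(2)[OF R(1) z])
    also note R(2)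
    also have "infsum (\<lambda>k. 3 ^ m * hterm (Suc m) f k) UNIV = 3 ^ m * hn (Suc m) f"
      by (simp add: infsum_cmult_right S hn_def)
    finally show "infsum ?low UNIV \<le> 3 ^ m * hn (Suc m) f" .
  qed
  have "hterm m g k \<le> ?low k + ?up k" for k
  proof -
    let ?a = "sqrt (real (k i) / 2) * \<bar>ip f (hermite (lower i k))\<bar>" and ?b = "sqrt (real (Suc (k i)) / 2) * \<bar>ip f (hermite (raise i k))\<bar>"
    have "(ip g (hermite k))\<^sup>2 \<le> (?a + ?b)\<^sup>2" using power_mono[OF eq[of k], of 2] by simp
    also have "\<dots> \<le> 2 * ?a\<^sup>2 + 2 * ?b\<^sup>2" using sum_squares_bound[of ?a ?b] by (simp add: power2_sum)
    also have "\<dots> = real (k i) * (ip f (hermite (lower i k)))\<^sup>2 + real (Suc (k i)) * (ip f (hermite (raise i k)))\<^sup>2"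
      by (simp add: power_mult_distrib)
    finally have "weight k ^ m * (ip g (hermite k))\<^sup>2 \<le> weight k ^ m * (real (k i) * (ip f (hermite (lower i k)))\<^sup>2 + real (Suc (k i)) * (ip f (hermite (raise i k)))\<^sup>2)"
      using weight_ge_1[of k] by (intro mult_left_mono) auto
    then show ?thesis by (simp add: hterm_def distrib_left)
  qed
  then have "hn m g \<le> infsum (\<lambda>k. ?low k + ?up k) UNIV"
    unfolding hn_def by (intro nonneg_summable_bound(2) summable_on_add low up hterm_nonneg)
  also have "\<dots> = infsum ?low UNIV + infsum ?up UNIV" by (rule infsum_add[OF low(1) up(1)])
  also have "\<dots> \<le> (3 ^ m + 1) * hn (Suc m) f" using low(2) up(2) by (simp add: distrib_right)
  finally show ?thesis .
qed

lemma ip_lin: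
  assumes "f \<in> schwartz"
  shows "ip f (\<lambda>x. a * hermite k x + c * hermite l x) = a * ip f (hermite k) + c * ip f (hermite l)"
proof -
  have "integrable lborel (\<lambda>x. f x * hermite k x)" for k
    by (intro schwartz_integrable schwartz_mult_schwartz assms hermite_schwartz)
  moreover have "f x * (a * hermite k x + c * hermite l x) = a * (f x * hermite k x) + c * (f x * hermite l x)" for x
    by (simp add: algebra_simps)
  ultimately show ?thesis by simp
qed

lemma abs_comb_le:
  fixes a c u v :: real
  assumes "0 \<le> a" "0 \<le> c"
  shows "\<bar>a * u + c * v\<bar> \<le> a * \<bar>u\<bar> + c * \<bar>v\<bar>" "\<bar>a * u - c * v\<bar> \<le> a * \<bar>u\<bar> + c * \<bar>v\<bar>"
  using abs_triangle_ineq[of "a * u" "c * v"] abs_triangle_ineq4[of "a * u" "c * v"] assms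
  by (simp_all add: abs_mult)

lemma hn_coord:
  assumes "f \<in> schwartz" shows "hn m (\<lambda>x. x $ i * f x) \<le> (3 ^ m + 1) * hn (Suc m) f"
proof (rule ladder_bound[OF assms])
  show "(\<lambda>x. x $ i * f x) \<in> schwartz" by (rule schwartz_mult[OF symb_coord assms])
  fix k
  have eq: "ip (\<lambda>x. x $ i * f x) (hermite k) = ip f (\<lambda>x. x $ i * hermite k x)" by (simp add: mult_ac)
  show "\<bar>ip (\<lambda>x. x $ i * f x) (hermite k)\<bar> \<le> sqrt (real (k i) / 2) * \<bar>ip f (hermite (lower i k))\<bar> + sqrt (real (Suc (k i)) / 2) * \<bar>ip f (hermite (raise i k))\<bar>"
    unfolding eq hermite_coord ip_lin[OF assms]
    by (rule abs_comb_le(1)) auto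
qed

lemma hn_partial:
  assumes "f \<in> schwartz" shows "hn m (partial i f) \<le> (3 ^ m + 1) * hn (Suc m) f"
proof (rule ladder_bound[OF assms schwartz_partial[OF assms]])
  fix k
  have "ip (partial i f) (hermite k) = - ip f (partial i (hermite k))"
    by (rule integration_by_parts[OF schwartz_symb[OF assms] hermite_schwartz])
  also have "ip f (partial i (hermite k)) = sqrt (real (k i) / 2) * ip f (hermite (lower i k)) + (- sqrt (real (Suc (k i)) / 2)) * ip f (hermite (raise i k))"
    unfolding partial_hermite ip_lin[OF assms, symmetric] by simp
  finally have "\<bar>ip (partial i f) (hermite k)\<bar> = \<bar>sqrt (real (k i) / 2) * ip f (hermite (lower i k)) - sqrt (real (Suc (k i)) / 2) * ip f (hermite (raise i k))\<bar>"
    by (simp add: abs_minus_commute)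
  also have "\<dots> \<le> sqrt (real (k i) / 2) * \<bar>ip f (hermite (lower i k))\<bar> + sqrt (real (Suc (k i)) / 2) * \<bar>ip f (hermite (raise i k))\<bar>"
    by (rule abs_comb_le(2)) auto
  finally show "\<bar>ip (partial i f) (hermite k)\<bar> \<le> sqrt (real (k i) / 2) * \<bar>ip f (hermite (lower i k))\<bar> + sqrt (real (Suc (k i)) / 2) * \<bar>ip f (hermite (raise i k))\<bar>" .
qed

section \<open>Operators of finite order on the Hermite-Sobolev scale\<close>

text \<open>The order counts powers of the weight in the squared norm, so it is twice the loss in
  the Sobolev index. Asking for a bound at every level \<open>m\<close> makes orders add under
  composition.\<close>

definition op_order :: "nat \<Rightarrow> ((real^'d::finite \<Rightarrow> real) \<Rightarrow> real^'d \<Rightarrow> real) \<Rightarrow> bool" where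
  "op_order n T \<longleftrightarrow> (\<forall>f\<in>schwartz. T f \<in> schwartz) \<and>
     (\<forall>m. \<exists>C\<ge>0. \<forall>f\<in>schwartz. hn m (T f) \<le> C * hn (m + n) f)"

lemma op_order_boundE:
  assumes "op_order a T"
  obtains C where "C \<ge> 0" "\<And>f. f \<in> schwartz \<Longrightarrow> hn m (T f) \<le> C * hn (m + a) f"
  using assms unfolding op_order_def by blast

lemma op_order_comp:
  assumes S: "op_order a S" and T: "op_order c T" shows "op_order (a + c) (\<lambda>f. S (T f))"
  unfolding op_order_def
proof safe
  show "S (T f) \<in> schwartz" if "f \<in> schwartz" for f using S T that by (simp add: op_order_def)
  fix m
  obtain C where C: "C \<ge> 0" "\<And>f. f \<in> schwartz \<Longrightarrow> hn m (S f) \<le> C * hn (m + a) f" using op_order_boundE[OF S, where m = m] by blast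
  obtain D where D: "D \<ge> 0" "\<And>f. f \<in> schwartz \<Longrightarrow> hn (m + a) (T f) \<le> D * hn (m + a + c) f" using op_order_boundE[OF T, where m = "m + a"] by blast
  have "hn m (S (T f)) \<le> (C * D) * hn (m + (a + c)) f" if f: "f \<in> schwartz" for f
  proof -
    have "hn m (S (T f)) \<le> C * hn (m + a) (T f)" using T f by (intro C) (simp add: op_order_def)
    also have "\<dots> \<le> C * (D * hn (m + a + c) f)" by (intro mult_left_mono C D f)
    finally show ?thesis by (simp add: mult.assoc add.assoc)
  qed
  then show "\<exists>C\<ge>0. \<forall>f\<in>schwartz. hn m (S (T f)) \<le> C * hn (m + (a + c)) f"
    using C D by (intro exI[of _ "C * D"]) auto
qed

lemma op_order_mono: assumes "op_order a T" "a \<le> c" shows "op_order c T"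
  unfolding op_order_def
proof safe
  show "T f \<in> schwartz" if "f \<in> schwartz" for f using assms that by (simp add: op_order_def)
  fix m
  obtain C where C: "C \<ge> 0" "\<And>f. f \<in> schwartz \<Longrightarrow> hn m (T f) \<le> C * hn (m + a) f" using op_order_boundE[OF assms(1), where m = m] by blast
  have "hn m (T f) \<le> C * hn (m + c) f" if "f \<in> schwartz" for f
    using C(2)[OF that] mult_left_mono[OF hn_mono[OF that, of "m + a" "m + c"] C(1)] assms(2) by simp
  then show "\<exists>C\<ge>0. \<forall>f\<in>schwartz. hn m (T f) \<le> C * hn (m + c) f" using C(1) by blast
qed

lemma op_order_add:
  assumes S: "op_order a S" and T: "op_order a T" shows "op_order a (\<lambda>f x. S f x + T f x)"
  unfolding op_order_def
proof safe
  show "(\<lambda>x. S f x + T f x) \<in> schwartz" if "f \<in> schwartz" for f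
    using S T that by (simp add: op_order_def schwartz_add)
  fix m
  obtain C where C: "C \<ge> 0" "\<And>f. f \<in> schwartz \<Longrightarrow> hn m (S f) \<le> C * hn (m + a) f" using op_order_boundE[OF S, where m = m] by blast
  obtain D where D: "D \<ge> 0" "\<And>f. f \<in> schwartz \<Longrightarrow> hn m (T f) \<le> D * hn (m + a) f" using op_order_boundE[OF T, where m = m] by blast
  have "hn m (\<lambda>x. S f x + T f x) \<le> (2 * C + 2 * D) * hn (m + a) f" if f: "f \<in> schwartz" for f
  proof -
    have "hn m (\<lambda>x. S f x + T f x) \<le> 2 * hn m (S f) + 2 * hn m (T f)"
      using S T f by (intro hn_add) (auto simp: op_order_def)
    then show ?thesis using C(2)[OF f] D(2)[OF f] by (simp add: distrib_right)
  qed
  then show "\<exists>C\<ge>0. \<forall>f\<in>schwartz. hn m (\<lambda>x. S f x + T f x) \<le> C * hn (m + a) f"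
    using C D by (intro exI[of _ "2 * C + 2 * D"]) auto
qed

lemma op_order_0: "op_order 0 (\<lambda>f x. 0)"
  unfolding op_order_def hn_def hterm_def[abs_def]
  by (auto simp: schwartz_iff symb_0 intro!: exI[of _ 0])

lemma op_order_sum:
  "finite A \<Longrightarrow> (\<And>a. a \<in> A \<Longrightarrow> op_order n (T a)) \<Longrightarrow> op_order n (\<lambda>f x. \<Sum>a\<in>A. T a f x)"
  by (induction A rule: finite_induct) (auto simp: op_order_add op_order_mono[OF op_order_0])

lemma op_order_id: "op_order 0 (\<lambda>f. f)"
  unfolding op_order_def by (auto intro!: exI[of _ 1])

lemma op_order_coord: "op_order 1 (\<lambda>f x. x $ i * f x)"
  unfolding op_order_def using hn_coord by (auto intro!: schwartz_mult[OF symb_coord] exI[of _ "3 ^ _ + 1"])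

lemma op_order_partial: "op_order 1 (partial i)"
  unfolding op_order_def using hn_partial by (auto intro!: schwartz_partial exI[of _ "3 ^ _ + 1"])

lemma op_order_partials: "op_order (length is) (partials is)"
proof (induction "is")
  case (Cons i "is")
  show ?case using op_order_comp[OF op_order_partial[of i] Cons] by simp
qed (use op_order_id in simp)

text \<open>At most two derivatives followed by two multiplications with a coordinate, each of order
  1.\<close>

lemma op_order_weighted_partials:
  assumes "length is \<le> 2"
  shows "op_order 4 (\<lambda>f x. (1 + (norm x)\<^sup>2) * partials is f x)"
proof -
  have 2: "op_order 2 (partials is)" by (rule op_order_mono[OF op_order_partials assms])
  have xx: "op_order 4 (\<lambda>f x. x $ i * (x $ i * partials is f x))" for i
    by (rule op_order_mono[OF op_order_comp[OF op_order_coord op_order_comp[OF op_order_coord 2]]]) simp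
  have "op_order 4 (\<lambda>f x. partials is f x + (\<Sum>i\<in>UNIV. x $ i * (x $ i * partials is f x)))"
    by (intro op_order_add op_order_sum op_order_mono[OF 2]) (use xx in auto)
  moreover have "partials is f x + (\<Sum>i\<in>UNIV. x $ i * (x $ i * partials is f x)) = (1 + (norm x)\<^sup>2) * partials is f x" for f x
    unfolding norm_sq_sum by (simp only: distrib_right mult_1_left sum_distrib_right mult.assoc)
  ultimately show ?thesis by (simp only:)
qed

text \<open>The passage from pointwise domination to Hermite coefficients happens in
  \<open>L2\<close>, where \<open>hn_0\<close> identifies the integral with \<open>hn 0\<close>; the
  Cauchy-Schwarz inequality for the finite sum over \<open>I\<close> gives the factor
  \<open>card I\<close>.\<close>

lemma second_order_bound:
  fixes T :: "(real^'d::finite \<Rightarrow> real) \<Rightarrow> real^'d \<Rightarrow> real"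
  assumes T: "\<And>f. f \<in> schwartz \<Longrightarrow> T f \<in> schwartz"
    and I: "finite I" "\<And>is. is \<in> I \<Longrightarrow> length is \<le> 2"
    and b: "\<And>f x. f \<in> schwartz \<Longrightarrow> \<bar>T f x\<bar> \<le> B * (1 + (norm x)\<^sup>2) * (\<Sum>is\<in>I. \<bar>partials is f x\<bar>)"
  shows "\<exists>C\<ge>0. \<forall>f\<in>schwartz. (LINT x|lborel. (T f x)\<^sup>2) \<le> C * hn 4 f"
proof -
  let ?S = "\<lambda>is f x. (1 + (norm x)\<^sup>2) * partials is f x"
  have "\<forall>is\<in>I. \<exists>C\<ge>0. \<forall>f\<in>schwartz. hn 0 (?S is f) \<le> C * hn 4 f"
  proof
    fix "is" assume "is \<in> I"
    then have "op_order 4 (?S is)" by (intro op_order_weighted_partials I)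
    then show "\<exists>C\<ge>0. \<forall>f\<in>schwartz. hn 0 (?S is f) \<le> C * hn 4 f"
      unfolding op_order_def by (elim conjE allE[of _ 0]) (simp only: add_0)
  qed
  then obtain C where C: "\<And>is. is \<in> I \<Longrightarrow> C is \<ge> 0" "\<And>is f. is \<in> I \<Longrightarrow> f \<in> schwartz \<Longrightarrow> hn 0 (?S is f) \<le> C is * hn 4 f"
    by metis
  let ?D = "B\<^sup>2 * (real (card I) * (\<Sum>is\<in>I. C is))"
  have "(LINT x|lborel. (T f x)\<^sup>2) \<le> ?D * hn 4 f" if f: "f \<in> schwartz" for f
  proof -
    have S: "?S is f \<in> schwartz" if "is \<in> I" for "is"
      using op_order_weighted_partials[OF I(2)[OF that]] f by (simp add: op_order_def)
    have "(LINT x|lborel. (T f x)\<^sup>2) \<le> (LINT x|lborel. B\<^sup>2 * (real (card I) * (\<Sum>is\<in>I. (?S is f x)\<^sup>2)))"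
    proof (rule integral_mono)
      show "integrable lborel (\<lambda>x. (T f x)\<^sup>2)" by (intro L2_integrable schwartz_L2 T f)
      show "integrable lborel (\<lambda>x. B\<^sup>2 * (real (card I) * (\<Sum>is\<in>I. (?S is f x)\<^sup>2)))"
        by (intro integrable_mult_right Bochner_Integration.integrable_sum L2_integrable schwartz_L2 S)
      fix x
      have eq: "B * (1 + (norm x)\<^sup>2) * (\<Sum>is\<in>I. \<bar>partials is f x\<bar>) = B * (\<Sum>is\<in>I. \<bar>?S is f x\<bar>)"
        by (simp add: abs_mult sum_distrib_left mult.assoc)
      have "(T f x)\<^sup>2 \<le> (B * (\<Sum>is\<in>I. \<bar>?S is f x\<bar>))\<^sup>2"
        using power_mono[OF b[OF f, of x], of 2] unfolding eq by simp
      also have "\<dots> = B\<^sup>2 * (\<Sum>is\<in>I. \<bar>?S is f x\<bar>)\<^sup>2" by (simp add: power_mult_distrib)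
      also have "\<dots> \<le> B\<^sup>2 * (real (card I) * (\<Sum>is\<in>I. \<bar>?S is f x\<bar>\<^sup>2))"
        by (intro mult_left_mono) (use sum_squared_le_sum_of_squares[of "\<lambda>is. \<bar>?S is f x\<bar>" I] I(1) in \<open>auto simp: mult.commute\<close>)
      finally show "(T f x)\<^sup>2 \<le> B\<^sup>2 * (real (card I) * (\<Sum>is\<in>I. (?S is f x)\<^sup>2))" by simp
    qed
    also have "\<dots> = B\<^sup>2 * (real (card I) * (\<Sum>is\<in>I. hn 0 (?S is f)))"
      using S by (simp add: hn_0 L2_integrable[OF schwartz_L2])
    also have "\<dots> \<le> B\<^sup>2 * (real (card I) * (\<Sum>is\<in>I. C is * hn 4 f))"
      by (intro mult_left_mono sum_mono C f) auto
    finally show ?thesis by (simp add: sum_distrib_right mult.assoc)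
  qed
  moreover have "?D \<ge> 0" by (intro mult_nonneg_nonneg sum_nonneg C) auto
  ultimately show ?thesis by blast
qed

section \<open>The monotonicity inequality for Schwartz functions\<close>

lemma integral_schwartz_sum:
  "(\<And>a. a \<in> A \<Longrightarrow> F a \<in> schwartz) \<Longrightarrow> (LINT x|lborel. (\<Sum>a\<in>A. F a x)) = (\<Sum>a\<in>A. LINT x|lborel. F a x)"
  by (rule Bochner_Integration.integral_sum) (auto intro: schwartz_integrable)

lemma integral_schwartz_add:
  "f \<in> schwartz \<Longrightarrow> g \<in> schwartz \<Longrightarrow> (LINT x|lborel. f x + g x) = (LINT x|lborel. f x) + (LINT x|lborel. g x)"
  by (rule Bochner_Integration.integral_add) (auto intro: schwartz_integrable)

text \<open>Integration by parts applied to \<open>F * partial k F\<close>, which is half of the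
  derivative of \<open>F^2\<close>.\<close>

lemma integral_square_partial:
  assumes m: "m \<in> symb q" and F: "F \<in> schwartz"
  shows "(LINT x|lborel. m x * (F x * partial k F x)) = - (LINT x|lborel. partial k m x * (F x)\<^sup>2) / 2"
proof -
  have eq: "partial k (\<lambda>x. F x * F x) = (\<lambda>x. 2 * (F x * partial k F x))"
    using F by (auto simp: partial_mult schwartz_differentiable)
  have "(LINT x|lborel. partial k m x * (F x * F x)) = - (LINT x|lborel. m x * (2 * (F x * partial k F x)))"
    using integration_by_parts[OF m schwartz_mult_schwartz[OF F F], of k] unfolding eq .
  also have "(LINT x|lborel. m x * (2 * (F x * partial k F x))) = 2 * (LINT x|lborel. m x * (F x * partial k F x))"
    by (subst integral_mult_right_zero[symmetric]) (simp add: mult_ac)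
  finally show ?thesis by (simp add: power2_eq_square)
qed

lemma integral_divergence:
  assumes m: "m \<in> symb q" and F: "F \<in> schwartz"
  shows "(LINT x|lborel. F x * partial k (\<lambda>x. m x * F x) x) = (LINT x|lborel. partial k m x * (F x)\<^sup>2) / 2"
proof -
  have "(LINT x|lborel. F x * partial k (\<lambda>x. m x * F x) x) = - (LINT x|lborel. (m x * F x) * partial k F x)"
    using integration_by_parts[OF schwartz_symb[OF schwartz_mult[OF m F]] F, of k] by (simp add: mult.commute)
  also have "\<dots> = (LINT x|lborel. partial k m x * (F x)\<^sup>2) / 2"
    using integral_square_partial[OF m F, of k] by (simp add: mult.assoc)
  finally show ?thesis .
qed

section \<open>Energy identity for a single vector field\<close>

definition field_star :: "('d \<Rightarrow> real^'d::finite \<Rightarrow> real) \<Rightarrow> (real^'d \<Rightarrow> real) \<Rightarrow> real^'d \<Rightarrow> real" where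
  "field_star s F x = - (\<Sum>k\<in>UNIV. partial k (\<lambda>x. s k x * F x) x)"

text \<open>One column's share of twice the second-order part of \<open>L_star\<close>, because
  \<open>\<sigma> \<sigma>^t\<close> is the sum over the columns \<open>s\<close> of
  \<open>s s^t\<close>.\<close>

definition field_second :: "('d \<Rightarrow> real^'d::finite \<Rightarrow> real) \<Rightarrow> (real^'d \<Rightarrow> real) \<Rightarrow> real^'d \<Rightarrow> real" where
  "field_second s F x = (\<Sum>k\<in>UNIV. \<Sum>l\<in>UNIV. partial k (partial l (\<lambda>x. (s k x * s l x) * F x)) x)"

definition field_div :: "('d \<Rightarrow> real^'d::finite \<Rightarrow> real) \<Rightarrow> real^'d \<Rightarrow> real" where
  "field_div s x = (\<Sum>k\<in>UNIV. partial k (s k) x)"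

text \<open>The trace of the square of the Jacobian matrix of \<open>s\<close>.\<close>

definition field_trace :: "('d \<Rightarrow> real^'d::finite \<Rightarrow> real) \<Rightarrow> real^'d \<Rightarrow> real" where
  "field_trace s x = (\<Sum>k\<in>UNIV. \<Sum>l\<in>UNIV. partial k (s l) x * partial l (s k) x)"

context
  fixes s :: "'d::finite \<Rightarrow> real^'d \<Rightarrow> real"
  assumes s: "\<And>k. s k \<in> symb 1" and ds: "\<And>k l. partial l (s k) \<in> symb 0"
begin

lemma field_div_symb: "field_div s \<in> symb 0"
  unfolding field_div_def[abs_def] by (intro symb_sum ds)

lemma field_potential_symb: "(\<lambda>x. ((field_div s x)\<^sup>2 + field_trace s x) / 2) \<in> symb 0"
proof -
  have "(\<lambda>x. (1/2) * (field_div s x * field_div s x + (\<Sum>k\<in>UNIV. \<Sum>l\<in>UNIV. partial k (s l) x * partial l (s k) x))) \<in> symb 0"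
    using symb_mult[OF field_div_symb field_div_symb] symb_mult[OF ds ds]
    by (intro symb_sum symb_cmult symb_add) simp_all
  then show ?thesis unfolding field_trace_def power2_eq_square by simp
qed

lemma field_star_schwartz: "F \<in> schwartz \<Longrightarrow> field_star s F \<in> schwartz"
  unfolding field_star_def[abs_def] by (intro schwartz_uminus schwartz_sum schwartz_partial schwartz_mult[OF s])

lemma field_second_schwartz: "F \<in> schwartz \<Longrightarrow> field_second s F \<in> schwartz"
  unfolding field_second_def[abs_def]
  by (intro schwartz_sum schwartz_partial schwartz_mult[OF symb_mult[OF s s]])

lemma field_star_eq:
  assumes F: "F \<in> schwartz"
  shows "field_star s F x = - (\<Sum>k\<in>UNIV. s k x * partial k F x) - field_div s x * F x"
proof -
  have "partial k (\<lambda>x. s k x * F x) x = partial k (s k) x * F x + s k x * partial k F x" for k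
    by (rule partial_mult) (auto intro: symb_differentiable[OF s] schwartz_differentiable F)
  then show ?thesis
    by (simp add: field_star_def field_div_def sum.distrib sum_distrib_right)
qed

text \<open>The derivative of the field along itself, twice the Ito-Stratonovich correction.\<close>

definition drift :: "'d \<Rightarrow> real^'d \<Rightarrow> real" where
  "drift k x = (\<Sum>l\<in>UNIV. s l x * partial l (s k) x)"

lemma drift_symb: "drift k \<in> symb 1"
  unfolding drift_def[abs_def] using symb_mult[OF s ds] by (intro symb_sum) simp

text \<open>The Leibniz rule for \<open>s k * (s l * F)\<close> separates the square of
  \<open>field_star\<close> from a first-order remainder. The square can be paired with
  \<open>F\<close> through the adjoint of \<open>field_star\<close>, and the remainder is a pure
  divergence.\<close>

lemma field_second_eq:
  assumes F: "F \<in> schwartz"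
  shows "field_second s F x = field_star s (field_star s F) x + (\<Sum>k\<in>UNIV. partial k (\<lambda>x. drift k x * F x) x)"
proof -
  let ?G = "field_star s F"
  have inner: "(\<Sum>l\<in>UNIV. partial l (\<lambda>x. (s k x * s l x) * F x) x) = - (s k x * ?G x) + drift k x * F x" for k x
  proof -
    have "partial l (\<lambda>x. (s k x * s l x) * F x) x = s k x * partial l (\<lambda>x. s l x * F x) x + (s l x * partial l (s k) x) * F x" for l
    proof -
      have "partial l (\<lambda>x. s k x * (s l x * F x)) x = partial l (s k) x * (s l x * F x) + s k x * partial l (\<lambda>x. s l x * F x) x"
        by (rule partial_mult) (auto intro: symb_differentiable[OF s] schwartz_differentiable[OF schwartz_mult[OF s F]])
      then show ?thesis by (simp add: mult_ac)
    qed
    then show ?thesis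
      by (simp add: sum.distrib sum_distrib_left[symmetric] sum_distrib_right[symmetric] field_star_def drift_def)
  qed
  have GS: "?G \<in> schwartz" by (rule field_star_schwartz[OF F])
  have "field_second s F x = (\<Sum>k\<in>UNIV. partial k (\<lambda>x. \<Sum>l\<in>UNIV. partial l (\<lambda>x. (s k x * s l x) * F x) x) x)"
    unfolding field_second_def
    by (intro sum.cong refl partial_sum[symmetric] schwartz_differentiable schwartz_partial schwartz_mult[OF symb_mult[OF s s]] F)
  also have "\<dots> = (\<Sum>k\<in>UNIV. partial k (\<lambda>x. - (s k x * ?G x) + drift k x * F x) x)"
    unfolding inner ..
  also have "\<dots> = (\<Sum>k\<in>UNIV. - partial k (\<lambda>x. s k x * ?G x) x + partial k (\<lambda>x. drift k x * F x) x)"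
  proof (rule sum.cong[OF refl])
    fix k
    have S: "(\<lambda>x. s k x * ?G x) \<in> schwartz" "(\<lambda>x. drift k x * F x) \<in> schwartz"
      by (intro schwartz_mult[OF s] GS schwartz_mult[OF drift_symb] F)+
    show "partial k (\<lambda>x. - (s k x * ?G x) + drift k x * F x) x = - partial k (\<lambda>x. s k x * ?G x) x + partial k (\<lambda>x. drift k x * F x) x"
      by (simp only: partial_add[OF schwartz_differentiable[OF schwartz_uminus[OF S(1)]] schwartz_differentiable[OF S(2)]]
        partial_uminus[OF schwartz_differentiable[OF S(1)]])
  qed
  finally show ?thesis by (simp add: sum.distrib sum_subtractf sum_negf field_star_def)
qed

text \<open>Symmetry of second derivatives turns the terms
  \<open>s_l * partial_k partial_l s_k\<close> into the derivative of the divergence along the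
  field.\<close>

lemma sum_partial_drift:
  "(\<Sum>k\<in>UNIV. partial k (drift k) x) = field_trace s x + (\<Sum>l\<in>UNIV. s l x * partial l (field_div s) x)"
proof -
  have 1: "partial k (drift k) x = (\<Sum>l\<in>UNIV. partial k (s l) x * partial l (s k) x + s l x * partial l (partial k (s k)) x)" for k
  proof -
    have "partial k (drift k) x = (\<Sum>l\<in>UNIV. partial k (\<lambda>x. s l x * partial l (s k) x) x)"
      unfolding drift_def[abs_def] by (rule partial_sum) (auto intro!: symb_differentiable[OF symb_mult[OF s ds]])
    also have "\<dots> = (\<Sum>l\<in>UNIV. partial k (s l) x * partial l (s k) x + s l x * partial k (partial l (s k)) x)"
      by (intro sum.cong refl partial_mult symb_differentiable[OF s] symb_differentiable[OF ds])
    finally show ?thesis unfolding partial_commute[OF s, of k] .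
  qed
  have 2: "partial l (field_div s) x = (\<Sum>k\<in>UNIV. partial l (partial k (s k)) x)" for l
    unfolding field_div_def[abs_def] by (rule partial_sum) (rule symb_differentiable[OF ds])
  have "(\<Sum>k\<in>UNIV. \<Sum>l\<in>UNIV. s l x * partial l (partial k (s k)) x) = (\<Sum>l\<in>UNIV. s l x * partial l (field_div s) x)"
    unfolding 2 by (subst sum.swap) (simp add: sum_distrib_left)
  then show ?thesis unfolding 1 field_trace_def by (simp add: sum.distrib)
qed

lemma sum_partial_div_field:
  "(\<Sum>k\<in>UNIV. partial k (\<lambda>x. field_div s x * s k x) x) = (\<Sum>l\<in>UNIV. s l x * partial l (field_div s) x) + (field_div s x)\<^sup>2"
proof -
  have "partial k (\<lambda>x. field_div s x * s k x) x = partial k (field_div s) x * s k x + field_div s x * partial k (s k) x" for k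
    by (rule partial_mult) (rule symb_differentiable[OF field_div_symb] symb_differentiable[OF s])+
  then show ?thesis
    by (simp add: sum.distrib sum_distrib_left[symmetric] sum_distrib_right[symmetric] mult.commute power2_eq_square field_div_def[of s x])
qed

text \<open>The second derivatives of the field, which may be unbounded against its linear growth, cancel
  between \<open>sum_partial_drift\<close> and \<open>sum_partial_div_field\<close>.\<close>

lemma field_energy:
  assumes F: "F \<in> schwartz"
  shows "ip F (field_second s F) + (LINT x|lborel. (field_star s F x)\<^sup>2) =
    (LINT x|lborel. ((field_div s x)\<^sup>2 + field_trace s x) / 2 * (F x)\<^sup>2)"
proof -
  let ?G = "field_star s F" and ?c = "field_div s"
  have G: "?G \<in> schwartz" by (rule field_star_schwartz[OF F])
  have FF: "(\<lambda>x. (F x)\<^sup>2) \<in> schwartz" unfolding power2_eq_square by (rule schwartz_mult_schwartz[OF F F])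
  have cc: "(\<lambda>x. (?c x)\<^sup>2) \<in> symb 0" unfolding power2_eq_square using symb_mult[OF field_div_symb field_div_symb] by simp
  have cs: "(\<lambda>x. ?c x * s k x) \<in> symb 1" for k using symb_mult[OF field_div_symb s] by simp
  have FsG: "(\<lambda>x. F x * partial k (\<lambda>x. s k x * ?G x) x) \<in> schwartz" for k
    by (intro schwartz_mult_schwartz schwartz_partial schwartz_mult[OF s] F G)
  have sFG: "(\<lambda>x. (s k x * partial k F x) * ?G x) \<in> schwartz" for k
    by (intro schwartz_mult_schwartz schwartz_partial schwartz_mult[OF s] F G)
  have FdF: "(\<lambda>x. F x * partial k (\<lambda>x. drift k x * F x) x) \<in> schwartz" for k
    by (intro schwartz_mult_schwartz schwartz_partial schwartz_mult[OF drift_symb] F)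
  have csF: "(\<lambda>x. (?c x * s k x) * (F x * partial k F x)) \<in> schwartz" for k
    by (intro schwartz_mult_schwartz schwartz_partial schwartz_mult[OF cs] F)
  have FA: "(\<lambda>x. F x * field_star s ?G x) \<in> schwartz"
    by (intro schwartz_mult_schwartz field_star_schwartz F G)
  have GG: "(\<lambda>x. (?G x)\<^sup>2) \<in> schwartz" unfolding power2_eq_square by (rule schwartz_mult_schwartz[OF G G])
  \<comment> \<open>Integration by parts moves the outer \<open>field_star\<close> onto
    \<open>F\<close> as the derivative along \<open>s\<close>, which equals
    \<open>- ?G - ?c * F\<close> by \<open>field_star_eq\<close>. The resulting
    \<open>- (?G x)\<^sup>2\<close> cancels the norm term in \<open>I2\<close>.\<close>
  have I1: "ip F (field_star s ?G) = (LINT x|lborel. - (?G x)\<^sup>2 - ?c x * F x * ?G x)"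
  proof -
    have "ip F (field_star s ?G) = - (\<Sum>k\<in>UNIV. LINT x|lborel. F x * partial k (\<lambda>x. s k x * ?G x) x)"
      unfolding field_star_def[of s ?G] by (simp add: sum_distrib_left integral_schwartz_sum FsG)
    also have "\<dots> = (\<Sum>k\<in>UNIV. LINT x|lborel. (s k x * partial k F x) * ?G x)"
    proof -
      have "(LINT x|lborel. F x * partial k (\<lambda>x. s k x * ?G x) x) = - (LINT x|lborel. (s k x * partial k F x) * ?G x)" for k
        using integration_by_parts[OF schwartz_symb[OF F] schwartz_mult[OF s G], of k k] by (simp add: mult_ac)
      then show ?thesis by (simp add: sum_negf)
    qed
    also have "\<dots> = (LINT x|lborel. (\<Sum>k\<in>UNIV. s k x * partial k F x) * ?G x)"
      by (simp add: sum_distrib_right integral_schwartz_sum sFG)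
    also have "\<dots> = (LINT x|lborel. - (?G x)\<^sup>2 - ?c x * F x * ?G x)"
    proof -
      have D: "(\<Sum>k\<in>UNIV. s k x * partial k F x) = - ?G x - ?c x * F x" for x
        unfolding field_star_eq[OF F] by simp
      show ?thesis unfolding D
        by (rule Bochner_Integration.integral_cong) (simp_all add: power2_eq_square algebra_simps)
    qed
    finally show ?thesis .
  qed
  have cFG: "(\<lambda>x. ?c x * F x * ?G x) \<in> schwartz"
    by (intro schwartz_mult_schwartz schwartz_mult[OF field_div_symb] F G)
  have I2: "ip F (field_star s ?G) + (LINT x|lborel. (?G x)\<^sup>2) = - (LINT x|lborel. ?c x * F x * ?G x)"
    unfolding I1 using GG cFG by (simp add: schwartz_integrable)
  have ccFF: "(\<lambda>x. (?c x)\<^sup>2 * (F x)\<^sup>2) \<in> schwartz" by (rule schwartz_mult[OF cc FF])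
  \<comment> \<open>Expanding \<open>?G\<close> once more leaves \<open>?c\<close> times
    \<open>F\<close> times the derivative of \<open>F\<close> along \<open>s\<close>, to which
    \<open>integral_square_partial\<close> applies with the field \<open>?c * s\<close>.\<close>
  have I3: "- (LINT x|lborel. ?c x * F x * ?G x) = (LINT x|lborel. (?c x)\<^sup>2 * (F x)\<^sup>2)
      - (LINT x|lborel. (\<Sum>k\<in>UNIV. partial k (\<lambda>x. ?c x * s k x) x) * (F x)\<^sup>2) / 2"
  proof -
    have pcs: "(\<lambda>x. partial k (\<lambda>x. ?c x * s k x) x * (F x)\<^sup>2) \<in> schwartz" for k
      by (rule schwartz_mult[OF symb_partial[OF cs] FF])
    have "- (LINT x|lborel. ?c x * F x * ?G x) = (LINT x|lborel. (\<Sum>k\<in>UNIV. (?c x * s k x) * (F x * partial k F x)) + (?c x)\<^sup>2 * (F x)\<^sup>2)"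
    proof -
      have "- (?c x * F x * ?G x) = (\<Sum>k\<in>UNIV. (?c x * s k x) * (F x * partial k F x)) + (?c x)\<^sup>2 * (F x)\<^sup>2" for x
        unfolding field_star_eq[OF F] by (simp add: sum_distrib_left power2_eq_square algebra_simps)
      then show ?thesis by (subst Bochner_Integration.integral_minus[symmetric]) simp
    qed
    also have "\<dots> = (\<Sum>k\<in>UNIV. LINT x|lborel. (?c x * s k x) * (F x * partial k F x)) + (LINT x|lborel. (?c x)\<^sup>2 * (F x)\<^sup>2)"
      by (subst integral_schwartz_add) (auto intro!: schwartz_sum csF ccFF integral_schwartz_sum)
    also have "(\<Sum>k\<in>UNIV. LINT x|lborel. (?c x * s k x) * (F x * partial k F x)) = - (\<Sum>k\<in>UNIV. LINT x|lborel. partial k (\<lambda>x. ?c x * s k x) x * (F x)\<^sup>2) / 2"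
      by (simp add: integral_square_partial[OF cs F] sum_negf sum_divide_distrib[symmetric])
    also have "(\<Sum>k\<in>UNIV. LINT x|lborel. partial k (\<lambda>x. ?c x * s k x) x * (F x)\<^sup>2) = (LINT x|lborel. (\<Sum>k\<in>UNIV. partial k (\<lambda>x. ?c x * s k x) x) * (F x)\<^sup>2)"
      by (simp add: sum_distrib_right integral_schwartz_sum pcs)
    finally show ?thesis by simp
  qed
  have I4: "(LINT x|lborel. F x * (\<Sum>k\<in>UNIV. partial k (\<lambda>x. drift k x * F x) x)) = (LINT x|lborel. (\<Sum>k\<in>UNIV. partial k (drift k) x) * (F x)\<^sup>2) / 2"
  proof -
    have pd: "(\<lambda>x. partial k (drift k) x * (F x)\<^sup>2) \<in> schwartz" for k
      by (rule schwartz_mult[OF symb_partial[OF drift_symb] FF])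
    show ?thesis
      by (simp add: sum_distrib_left sum_distrib_right integral_schwartz_sum FdF pd integral_divergence[OF drift_symb F] sum_divide_distrib)
  qed
  have "ip F (field_second s F) = (LINT x|lborel. F x * field_star s ?G x + F x * (\<Sum>k\<in>UNIV. partial k (\<lambda>x. drift k x * F x) x))"
    by (simp add: field_second_eq[OF F] distrib_left)
  also have "\<dots> = ip F (field_star s ?G) + (LINT x|lborel. F x * (\<Sum>k\<in>UNIV. partial k (\<lambda>x. drift k x * F x) x))"
    by (rule integral_schwartz_add[OF FA]) (intro schwartz_mult_schwartz F schwartz_sum schwartz_partial schwartz_mult[OF drift_symb])
  finally have "ip F (field_second s F) + (LINT x|lborel. (?G x)\<^sup>2) =
     (LINT x|lborel. (?c x)\<^sup>2 * (F x)\<^sup>2)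
      - (LINT x|lborel. (\<Sum>k\<in>UNIV. partial k (\<lambda>x. ?c x * s k x) x) * (F x)\<^sup>2) / 2
      + (LINT x|lborel. (\<Sum>k\<in>UNIV. partial k (drift k) x) * (F x)\<^sup>2) / 2"
    using I2 I3 I4 by simp
  also have "\<dots> = (LINT x|lborel. (?c x)\<^sup>2 * (F x)\<^sup>2 - (\<Sum>k\<in>UNIV. partial k (\<lambda>x. ?c x * s k x) x) * (F x)\<^sup>2 / 2
       + (\<Sum>k\<in>UNIV. partial k (drift k) x) * (F x)\<^sup>2 / 2)"
  proof -
    have "integrable lborel (\<lambda>x. (\<Sum>k\<in>UNIV. partial k (\<lambda>x. ?c x * s k x) x) * (F x)\<^sup>2)"
      "integrable lborel (\<lambda>x. (\<Sum>k\<in>UNIV. partial k (drift k) x) * (F x)\<^sup>2)"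
      by (rule schwartz_integrable[OF schwartz_mult[OF symb_sum[OF symb_partial[OF cs]] FF]],
        rule schwartz_integrable[OF schwartz_mult[OF symb_sum[OF symb_partial[OF drift_symb]] FF]])
    then show ?thesis using schwartz_integrable[OF ccFF] by simp
  qed
  also have "\<dots> = (LINT x|lborel. ((?c x)\<^sup>2 + field_trace s x) / 2 * (F x)\<^sup>2)"
    unfolding sum_partial_drift sum_partial_div_field
    by (rule Bochner_Integration.integral_cong) (simp_all add: field_simps)
  finally show ?thesis .
qed

end

section \<open>Second-order operators with coefficients of quadratic growth\<close>

definition second_order :: "((real^'d::finite \<Rightarrow> real) \<Rightarrow> real^'d \<Rightarrow> real) \<Rightarrow> bool" where
  "second_order T \<longleftrightarrow> (\<exists>B\<ge>0. \<forall>F\<in>schwartz. \<forall>x.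
     \<bar>T F x\<bar> \<le> B * (1 + (norm x)\<^sup>2) * (\<Sum>is | length is \<le> 2. \<bar>partials is F x\<bar>))"

lemma finite_short_lists: "finite {is :: 'd::finite list. length is \<le> n}"
  using finite_lists_length_le[of "UNIV :: 'd set" n] by simp

lemma second_order_add:
  assumes "second_order S" "second_order T" shows "second_order (\<lambda>F x. S F x + T F x)"
proof -
  let ?R = "\<lambda>F x. (1 + (norm x)\<^sup>2) * (\<Sum>is | length is \<le> 2. \<bar>partials is F x\<bar>)"
  obtain B C where B: "B \<ge> 0" "\<And>F x. F \<in> schwartz \<Longrightarrow> \<bar>S F x\<bar> \<le> B * ?R F x"
    and C: "C \<ge> 0" "\<And>F x. F \<in> schwartz \<Longrightarrow> \<bar>T F x\<bar> \<le> C * ?R F x"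
    using assms unfolding second_order_def mult.assoc by blast
  have "\<bar>S F x + T F x\<bar> \<le> (B + C) * ?R F x" if "F \<in> schwartz" for F x
    using B(2)[OF that, of x] C(2)[OF that, of x] abs_triangle_ineq[of "S F x" "T F x"] unfolding distrib_right by linarith
  then show ?thesis unfolding second_order_def mult.assoc using B C by (intro exI[of _ "B + C"]) auto
qed

lemma second_order_cmult:
  assumes "second_order T" shows "second_order (\<lambda>F x. c * T F x)"
proof -
  let ?R = "\<lambda>F x. (1 + (norm x)\<^sup>2) * (\<Sum>is | length is \<le> 2. \<bar>partials is F x\<bar>)"
  obtain C where C: "C \<ge> 0" "\<And>F x. F \<in> schwartz \<Longrightarrow> \<bar>T F x\<bar> \<le> C * ?R F x"
    using assms unfolding second_order_def mult.assoc by blast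
  have "\<bar>c * T F x\<bar> \<le> (\<bar>c\<bar> * C) * ?R F x" if "F \<in> schwartz" for F x
    using mult_left_mono[OF C(2)[OF that, of x], of "\<bar>c\<bar>"] by (simp add: abs_mult mult.assoc)
  then show ?thesis unfolding second_order_def mult.assoc using C by (intro exI[of _ "\<bar>c\<bar> * C"]) (auto simp: mult.assoc)
qed

lemma second_order_sum:
  "finite A \<Longrightarrow> (\<And>a. a \<in> A \<Longrightarrow> second_order (T a)) \<Longrightarrow> second_order (\<lambda>F x. \<Sum>a\<in>A. T a F x)"
proof (induction A rule: finite_induct)
  case empty
  show ?case by (auto simp: second_order_def intro!: exI[of _ 0])
qed (simp add: second_order_add)

lemma second_order_coeff:
  assumes a: "a \<in> symb 2" and l: "length is \<le> 2"
  shows "second_order (\<lambda>F x. a x * partials is F x)"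
proof -
  obtain C where C: "C \<ge> 0" "\<And>x. \<bar>a x\<bar> \<le> C * (1 + norm x) powr 2" using symb_boundE[OF a] by blast
  have "\<bar>a x * partials is F x\<bar> \<le> (2 * C) * ((1 + (norm x)\<^sup>2) * (\<Sum>is | length is \<le> 2. \<bar>partials is F x\<bar>))" for F x
  proof -
    have "(1 + norm x) powr 2 = (1 + norm x)\<^sup>2" by (rule powr_numeral) simp
    also have "\<dots> \<le> 2 * (1 + (norm x)\<^sup>2)" using sum_squares_bound[of 1 "norm x"] by (simp add: power2_sum)
    finally have "C * (1 + norm x) powr 2 \<le> C * (2 * (1 + (norm x)\<^sup>2))" using C(1) by (rule mult_left_mono)
    then have "\<bar>a x\<bar> \<le> 2 * C * (1 + (norm x)\<^sup>2)" using C(2)[of x] by (simp add: algebra_simps)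
    moreover have "\<bar>partials is F x\<bar> \<le> (\<Sum>is | length is \<le> 2. \<bar>partials is F x\<bar>)"
      by (rule member_le_sum[of "is" _ "\<lambda>is. \<bar>partials is F x\<bar>"]) (use l finite_short_lists in auto)
    ultimately have "\<bar>a x\<bar> * \<bar>partials is F x\<bar> \<le> (2 * C * (1 + (norm x)\<^sup>2)) * (\<Sum>is | length is \<le> 2. \<bar>partials is F x\<bar>)"
      using C(1) by (intro mult_mono) auto
    then show ?thesis by (simp add: abs_mult mult.assoc)
  qed
  then show ?thesis unfolding second_order_def mult.assoc using C(1) by (intro exI[of _ "2 * C"]) (auto simp: mult.assoc)
qed

lemma second_order_cong:
  assumes "second_order S" "\<And>F x. F \<in> schwartz \<Longrightarrow> T F x = S F x" shows "second_order T"
  using assms unfolding second_order_def by simp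

lemma second_order_partial1:
  assumes a: "a \<in> symb 2"
  shows "second_order (\<lambda>F. partial i (\<lambda>x. a x * F x))"
proof (rule second_order_cong)
  show "second_order (\<lambda>F x. partial i a x * partials [] F x + a x * partials [i] F x)"
    by (intro second_order_add second_order_coeff symb_partial a) auto
qed (simp add: partial_mult symb_differentiable[OF a] schwartz_differentiable)

text \<open>The four terms of the Leibniz rule all have coefficients in \<open>symb 2\<close>, since
  differentiation does not raise the symbol order.\<close>

lemma second_order_partial2:
  assumes a: "a \<in> symb 2"
  shows "second_order (\<lambda>F. partial i (partial j (\<lambda>x. a x * F x)))"
proof (rule second_order_cong)
  show "second_order (\<lambda>F x. (partial i (partial j a) x * partials [] F x + partial j a x * partials [i] F x)
     + (partial i a x * partials [j] F x + a x * partials [i, j] F x))"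
    by (intro second_order_add second_order_coeff symb_partial a) auto
  fix F :: "real^'a \<Rightarrow> real" and x assume F: "F \<in> schwartz"
  have "partial j (\<lambda>x. a x * F x) = (\<lambda>x. partial j a x * F x + a x * partial j F x)"
    by (auto simp: partial_mult symb_differentiable[OF a] schwartz_differentiable F)
  moreover have "partial i (\<lambda>x. partial j a x * F x + a x * partial j F x) x =
     partial i (\<lambda>x. partial j a x * F x) x + partial i (\<lambda>x. a x * partial j F x) x"
    by (intro partial_add schwartz_differentiable schwartz_mult[OF symb_partial[OF a]] schwartz_mult[OF a] schwartz_partial F)
  ultimately show "partial i (partial j (\<lambda>x. a x * F x)) x = (partial i (partial j a) x * partials [] F x + partial j a x * partials [i] F x)
     + (partial i a x * partials [j] F x + a x * partials [i, j] F x)"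
    by (simp add: partial_mult symb_differentiable[OF a] symb_differentiable[OF symb_partial[OF a]]
      schwartz_differentiable[OF F] schwartz_differentiable[OF schwartz_partial[OF F]])
qed

lemma second_order_hn:
  assumes "second_order T" "\<And>F. F \<in> schwartz \<Longrightarrow> T F \<in> schwartz"
  shows "\<exists>C\<ge>0. \<forall>F\<in>schwartz. (LINT x|lborel. (T F x)\<^sup>2) \<le> C * hn 4 F"
proof -
  obtain B where "\<And>F x. F \<in> schwartz \<Longrightarrow> \<bar>T F x\<bar> \<le> B * (1 + (norm x)\<^sup>2) * (\<Sum>is | length is \<le> 2. \<bar>partials is F x\<bar>)"
    using assms(1) unfolding second_order_def by blast
  then show ?thesis
    by (intro second_order_bound[OF assms(2) finite_short_lists]) auto
qed

section \<open>Passage to the limit\<close>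

text \<open>Completeness of \<open>l^2\<close> when the limit is known only coordinatewise: the
  Cauchy bound passes to the limit on finite index sets, then to the full sum by taking
  suprema.\<close>

lemma limit_square_sums:
  fixes y :: "nat \<Rightarrow> 'k \<Rightarrow> real"
  assumes sum: "\<And>n. (\<lambda>k. (y n k)\<^sup>2) summable_on UNIV"
    and lim: "\<And>k. (\<lambda>n. y n k) \<longlonglongrightarrow> z k"
    and cauchy: "\<And>e. e > 0 \<Longrightarrow> \<exists>N. \<forall>m\<ge>N. \<forall>n\<ge>N. (\<lambda>k. (y m k - y n k)\<^sup>2) summable_on UNIV \<and> (\<Sum>\<^sub>\<infinity>k. (y m k - y n k)\<^sup>2) \<le> e"
  shows "(\<lambda>k. (z k)\<^sup>2) summable_on UNIV" "(\<lambda>n. \<Sum>\<^sub>\<infinity>k. (y n k)\<^sup>2) \<longlonglongrightarrow> (\<Sum>\<^sub>\<infinity>k. (z k)\<^sup>2)"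
proof -
  let ?d = "\<lambda>n k. (y n k - z k)\<^sup>2"
  have D: "\<exists>N. \<forall>n\<ge>N. ?d n summable_on UNIV \<and> infsum (?d n) UNIV \<le> e" if e: "e > 0" for e
  proof -
    obtain N where N: "\<And>m n. m \<ge> N \<Longrightarrow> n \<ge> N \<Longrightarrow> (\<lambda>k. (y m k - y n k)\<^sup>2) summable_on UNIV"
      "\<And>m n. m \<ge> N \<Longrightarrow> n \<ge> N \<Longrightarrow> (\<Sum>\<^sub>\<infinity>k. (y m k - y n k)\<^sup>2) \<le> e"
      using cauchy[OF e] by blast
    have fin: "(\<Sum>k\<in>A. ?d n k) \<le> e" if n: "n \<ge> N" and A: "finite A" for n A
    proof (rule tendsto_upperbound)
      show "(\<lambda>m. \<Sum>k\<in>A. (y n k - y m k)\<^sup>2) \<longlonglongrightarrow> (\<Sum>k\<in>A. ?d n k)"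
        by (intro tendsto_intros lim)
      have "(\<Sum>k\<in>A. (y n k - y m k)\<^sup>2) \<le> e" if "m \<ge> N" for m
        using finite_sum_le_infsum[OF N(1)[OF n that] A] N(2)[OF n that] by fastforce
      then show "\<forall>\<^sub>F m in sequentially. (\<Sum>k\<in>A. (y n k - y m k)\<^sup>2) \<le> e"
        unfolding eventually_sequentially by blast
    qed simp
    have "?d n summable_on UNIV \<and> infsum (?d n) UNIV \<le> e" if n: "n \<ge> N" for n
    proof
      show s: "?d n summable_on UNIV"
        by (rule nonneg_bdd_above_summable_on) (use fin[OF n] in \<open>auto intro!: bdd_aboveI2[where M = e]\<close>)
      show "infsum (?d n) UNIV \<le> e"
        by (rule infsum_le_finite_sums[OF s]) (use fin[OF n] in auto)
    qed
    then show ?thesis by blast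
  qed
  obtain N0 where N0: "\<And>n. n \<ge> N0 \<Longrightarrow> ?d n summable_on UNIV" using D[of 1] by auto
  have yz: "(z k)\<^sup>2 \<le> 2 * (y n k)\<^sup>2 + 2 * ?d n k" for n k
  proof -
    have "(z k)\<^sup>2 + (2 * y n k - z k)\<^sup>2 = 2 * (y n k)\<^sup>2 + 2 * ?d n k" by (simp add: power2_eq_square algebra_simps)
    then show ?thesis using zero_le_power2[of "2 * y n k - z k"] by linarith
  qed
  show z: "(\<lambda>k. (z k)\<^sup>2) summable_on UNIV"
    by (rule nonneg_summable_bound(1)[OF summable_on_add[OF summable_on_cmult_right[OF sum[of N0]] summable_on_cmult_right[OF N0[OF order_refl]]] _ yz]) simp
  let ?S = "\<Sum>\<^sub>\<infinity>k. (z k)\<^sup>2"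
  have S: "?S \<ge> 0" by (rule infsum_nonneg) simp
  \<comment> \<open>Young's inequality with a free parameter \<open>\<eta>\<close>, applied to the
    cross term of \<open>(z + (y - z))^2\<close>: the part containing \<open>z\<close> can be made
    small first, after which the distance part tends to zero.\<close>
  have close: "\<bar>(\<Sum>\<^sub>\<infinity>k. (y n k)\<^sup>2) - ?S\<bar> \<le> \<eta> * ?S + (1 / \<eta> + 1) * infsum (?d n) UNIV" if \<eta>: "\<eta> > 0" and n: "n \<ge> N0" for \<eta> n
  proof -
    note dn = N0[OF n]
    have pt: "\<bar>(y n k)\<^sup>2 - (z k)\<^sup>2\<bar> \<le> \<eta> * (z k)\<^sup>2 + (1 / \<eta> + 1) * ?d n k" for k
    proof -
      let ?e = "y n k - z k"
      have "2 * (\<bar>z k\<bar> * \<bar>?e\<bar>) \<le> \<eta> * (z k)\<^sup>2 + (1 / \<eta>) * ?e\<^sup>2"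
        using sum_squares_bound[of "sqrt \<eta> * \<bar>z k\<bar>" "\<bar>?e\<bar> / sqrt \<eta>"] \<eta>
        by (simp add: power_mult_distrib power_divide mult_ac)
      moreover have "\<bar>(y n k)\<^sup>2 - (z k)\<^sup>2\<bar> \<le> 2 * (\<bar>z k\<bar> * \<bar>?e\<bar>) + ?e\<^sup>2"
      proof -
        have "(y n k)\<^sup>2 - (z k)\<^sup>2 = 2 * (z k * ?e) + ?e\<^sup>2" by (simp add: power2_eq_square algebra_simps)
        then show ?thesis using abs_triangle_ineq[of "2 * (z k * ?e)" "?e\<^sup>2"] by (simp add: abs_mult)
      qed
      ultimately show ?thesis unfolding distrib_right by linarith
    qed
    have s: "(\<lambda>k. \<eta> * (z k)\<^sup>2 + (1 / \<eta> + 1) * ?d n k) summable_on UNIV"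
      by (intro summable_on_add summable_on_cmult_right z dn)
    have neg: "(\<lambda>k. - (z k)\<^sup>2) summable_on UNIV" using summable_on_cmult_right[OF z, of "- 1"] by simp
    have sd: "(\<lambda>k. (y n k)\<^sup>2 + - (z k)\<^sup>2) summable_on UNIV" by (rule summable_on_add[OF sum neg])
    have sd': "(\<lambda>k. - ((y n k)\<^sup>2 + - (z k)\<^sup>2)) summable_on UNIV"
      using summable_on_cmult_right[OF sd, of "- 1"] by (simp only: mult_minus1)
    have eq: "(\<Sum>\<^sub>\<infinity>k. (y n k)\<^sup>2) - ?S = (\<Sum>\<^sub>\<infinity>k. (y n k)\<^sup>2 + - (z k)\<^sup>2)"
      by (subst infsum_add[OF sum neg]) (simp add: infsum_uminus)
    have "(\<Sum>\<^sub>\<infinity>k. (y n k)\<^sup>2 + - (z k)\<^sup>2) \<le> (\<Sum>\<^sub>\<infinity>k. \<eta> * (z k)\<^sup>2 + (1 / \<eta> + 1) * ?d n k)"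
      using pt by (intro infsum_mono[OF sd s]) (simp add: abs_le_iff)
    moreover have "- (\<Sum>\<^sub>\<infinity>k. (y n k)\<^sup>2 + - (z k)\<^sup>2) \<le> (\<Sum>\<^sub>\<infinity>k. \<eta> * (z k)\<^sup>2 + (1 / \<eta> + 1) * ?d n k)"
      unfolding infsum_uminus[symmetric] using pt by (intro infsum_mono[OF sd' s]) (simp add: abs_le_iff)
    moreover have "(\<Sum>\<^sub>\<infinity>k. \<eta> * (z k)\<^sup>2 + (1 / \<eta> + 1) * ?d n k) = \<eta> * ?S + (1 / \<eta> + 1) * infsum (?d n) UNIV"
      by (simp add: infsum_add summable_on_cmult_right z dn infsum_cmult_right)
    ultimately show ?thesis unfolding eq by (simp add: abs_le_iff)
  qed
  show "(\<lambda>n. \<Sum>\<^sub>\<infinity>k. (y n k)\<^sup>2) \<longlonglongrightarrow> ?S"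
  proof (rule LIMSEQ_I)
    fix e :: real assume e: "e > 0"
    \<comment> \<open>The choices give \<open>\<eta> * ?S \<le> e / 2\<close> and
      \<open>(1 / \<eta> + 1) * \<delta> = e / 4\<close>, together less than
      \<open>e\<close>.\<close>
    define \<eta> where "\<eta> = e / (2 * (?S + 1))"
    have \<eta>: "\<eta> > 0" unfolding \<eta>_def using e S by simp
    define \<delta> where "\<delta> = e / (4 * (1 / \<eta> + 1))"
    have p: "1 / \<eta> + 1 > 0" using \<eta> by (simp add: add_pos_pos)
    have \<delta>: "\<delta> > 0" unfolding \<delta>_def using e p by (intro divide_pos_pos mult_pos_pos) auto
    obtain N where N: "\<And>n. n \<ge> N \<Longrightarrow> infsum (?d n) UNIV \<le> \<delta>" using D[OF \<delta>] by blast
    have "norm ((\<Sum>\<^sub>\<infinity>k. (y n k)\<^sup>2) - ?S) < e" if "n \<ge> max N N0" for n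
    proof -
      have "(1 / \<eta> + 1) * infsum (?d n) UNIV \<le> (1 / \<eta> + 1) * \<delta>" using N[of n] that p by (intro mult_left_mono) auto
      also have "\<dots> = e / 4" unfolding \<delta>_def using p by (simp add: field_simps)
      finally have 1: "(1 / \<eta> + 1) * infsum (?d n) UNIV \<le> e / 4" .
      have "\<eta> * ?S = (e / 2) * (?S / (?S + 1))" unfolding \<eta>_def by simp
      also have "\<dots> \<le> (e / 2) * 1" using e S by (intro mult_left_mono) (auto simp: divide_le_eq)
      finally have "\<eta> * ?S \<le> e / 2" by simp
      moreover have "n \<ge> N0" using that by simp
      ultimately show ?thesis using close[OF \<eta>, of n] 1 e unfolding real_norm_def by linarith
    qed
    then show "\<exists>N. \<forall>n\<ge>N. norm ((\<Sum>\<^sub>\<infinity>k. (y n k)\<^sup>2) - ?S) < e" by blast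
  qed
qed

text \<open>Here \<open>4 \<le> 2 * p\<close>, and weights are at least 1. Summability of the series
  with real exponent has to be established first, since \<open>infsum\<close> of a divergent family
  is 0; it follows from comparison with an integer exponent above \<open>2 * p\<close>.\<close>

lemma hn_le_hs_norm:
  assumes G: "G \<in> schwartz" and p: "p \<ge> 2"
  shows "hn 4 G \<le> (hs_norm p (of_fun G))\<^sup>2"
proof -
  let ?t = "\<lambda>k. weight k powr (2 * p) * ip G (hermite k) * ip G (hermite k)"
  obtain n :: nat where n: "2 * p \<le> real n" using real_arch_simple by blast
  have w: "weight k powr real m = weight k ^ m" for k :: "'a \<Rightarrow> nat" and m
    using weight_ge_1[of k] by (simp add: powr_realpow)
  have le1: "?t k \<le> hterm n G k" for k
  proof -
    have "weight k powr (2 * p) \<le> weight k ^ n"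
      using powr_mono[OF n weight_ge_1[of k]] unfolding w .
    then show ?thesis by (simp add: hterm_def power2_eq_square mult.assoc mult_right_mono)
  qed
  have le2: "hterm 4 G k \<le> ?t k" for k
  proof -
    have "weight k powr real 4 \<le> weight k powr (2 * p)" using p by (intro powr_mono weight_ge_1) auto
    then have "weight k ^ 4 \<le> weight k powr (2 * p)" unfolding w .
    then show ?thesis by (simp add: hterm_def power2_eq_square mult.assoc mult_right_mono)
  qed
  have t: "?t summable_on UNIV" by (rule nonneg_summable_bound(1)[OF hterm_summable[OF G] _ le1]) (simp add: mult.assoc)
  have "hs_inner p (of_fun G) (of_fun G) = infsum ?t UNIV"
    unfolding hs_inner_def of_fun_def weight_def ..
  moreover have "0 \<le> infsum ?t UNIV" by (rule infsum_nonneg) (simp add: mult.assoc)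
  moreover have "hn 4 G \<le> infsum ?t UNIV" unfolding hn_def
    by (rule nonneg_summable_bound(2)[OF t hterm_nonneg le2])
  ultimately show ?thesis by (simp add: hs_norm_def)
qed

text \<open>Applying the bound to \<open>T (F m - F n)\<close> makes the images Cauchy in
  \<open>L2\<close>, and Parseval translates this to coefficients. The limit appears only as the
  numbers \<open>z k\<close>, so \<open>T\<close> never has to act on a distribution.\<close>

lemma operator_limit:
  fixes F :: "nat \<Rightarrow> real^'d::finite \<Rightarrow> real"
  assumes F: "\<And>n. F n \<in> schwartz"
    and cauchy: "\<forall>e>0. \<exists>N. \<forall>m\<ge>N. \<forall>n\<ge>N. hs_norm p (of_fun (\<lambda>x. F m x - F n x)) < e"
    and p: "p \<ge> 2"
    and T: "\<And>G. G \<in> schwartz \<Longrightarrow> T G \<in> schwartz"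
    and diff: "\<And>G H x. G \<in> schwartz \<Longrightarrow> H \<in> schwartz \<Longrightarrow> T (\<lambda>x. G x - H x) x = T G x - T H x"
    and bound: "\<exists>C\<ge>0. \<forall>G\<in>schwartz. (LINT x|lborel. (T G x)\<^sup>2) \<le> C * hn 4 G"
    and lim: "\<And>k. (\<lambda>n. ip (T (F n)) (hermite k)) \<longlonglongrightarrow> z k"
  shows "(\<lambda>k. (z k)\<^sup>2) summable_on UNIV"
    "(\<lambda>n. LINT x|lborel. (T (F n) x)\<^sup>2) \<longlonglongrightarrow> (\<Sum>\<^sub>\<infinity>k. (z k)\<^sup>2)"
proof -
  let ?y = "\<lambda>n k. ip (T (F n)) (hermite k)"
  obtain C where C: "C \<ge> 0" "\<And>G. G \<in> schwartz \<Longrightarrow> (LINT x|lborel. (T G x)\<^sup>2) \<le> C * hn 4 G" using bound by blast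
  note P = parseval[OF schwartz_hclosure[OF T[OF F]]]
  have sum: "(\<lambda>k. (?y n k)\<^sup>2) summable_on UNIV" for n using P[of n] by (auto simp: summable_on_def)
  have cau: "\<exists>N. \<forall>m\<ge>N. \<forall>n\<ge>N. (\<lambda>k. (?y m k - ?y n k)\<^sup>2) summable_on UNIV \<and> (\<Sum>\<^sub>\<infinity>k. (?y m k - ?y n k)\<^sup>2) \<le> e"
    if e: "e > 0" for e
  proof -
    have "sqrt (e / (C + 1)) > 0" using e C(1) by simp
    then obtain N where N: "\<And>m n. m \<ge> N \<Longrightarrow> n \<ge> N \<Longrightarrow> hs_norm p (of_fun (\<lambda>x. F m x - F n x)) < sqrt (e / (C + 1))"
      using cauchy by blast
    have "(\<lambda>k. (?y m k - ?y n k)\<^sup>2) summable_on UNIV \<and> (\<Sum>\<^sub>\<infinity>k. (?y m k - ?y n k)\<^sup>2) \<le> e" if mn: "m \<ge> N" "n \<ge> N" for m n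
    proof -
      let ?G = "\<lambda>x. F m x - F n x"
      have G: "?G \<in> schwartz" by (rule schwartz_diff[OF F F])
      have "integrable lborel (\<lambda>x. T (F n) x * hermite k x)" for n k
        by (intro schwartz_integrable schwartz_mult_schwartz T F hermite_schwartz)
      then have "ip (T ?G) (hermite k) = ?y m k - ?y n k" for k
        by (simp add: diff[OF F F] left_diff_distrib)
      then have hs: "((\<lambda>k. (?y m k - ?y n k)\<^sup>2) has_sum (LINT x|lborel. (T ?G x)\<^sup>2)) UNIV"
        using parseval[OF schwartz_hclosure[OF T[OF G]]] by simp
      have nn: "0 \<le> hs_norm p (of_fun ?G)"
        unfolding hs_norm_def hs_inner_def by (intro real_sqrt_ge_zero infsum_nonneg) (simp add: mult.assoc)
      have "hn 4 ?G \<le> (hs_norm p (of_fun ?G))\<^sup>2" by (rule hn_le_hs_norm[OF G p])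
      also have "\<dots> \<le> (sqrt (e / (C + 1)))\<^sup>2" using N[OF mn] nn by (intro power_mono) auto
      also have "\<dots> = e / (C + 1)" using e C(1) by simp
      finally have "C * hn 4 ?G \<le> C * (e / (C + 1))" by (rule mult_left_mono[OF _ C(1)])
      also have "\<dots> \<le> e" using e C(1) by (simp add: field_simps)
      finally have "(LINT x|lborel. (T ?G x)\<^sup>2) \<le> e" using C(2)[OF G] by linarith
      then show ?thesis using hs infsumI[OF hs] by (auto simp: summable_on_def)
    qed
    then show ?thesis by blast
  qed
  note L = limit_square_sums[OF sum lim cau]
  show "(\<lambda>k. (z k)\<^sup>2) summable_on UNIV" by (rule L(1))
  have "(\<Sum>\<^sub>\<infinity>k. (?y n k)\<^sup>2) = (LINT x|lborel. (T (F n) x)\<^sup>2)" for n by (rule infsumI[OF P])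
  then show "(\<lambda>n. LINT x|lborel. (T (F n) x)\<^sup>2) \<longlonglongrightarrow> (\<Sum>\<^sub>\<infinity>k. (z k)\<^sup>2)" using L(2) by simp
qed

lemma integral_half_diff:
  "u \<in> schwartz \<Longrightarrow> v \<in> schwartz \<Longrightarrow>
    (LINT x|lborel. 1/2 * u x + (- 1) * v x) = 1/2 * (LINT x|lborel. u x) - (LINT x|lborel. v x)"
  by (simp add: schwartz_integrable)

lemma partial_mult_diff:
  assumes "a \<in> symb m" "F \<in> schwartz" "G \<in> schwartz"
  shows "partial i (\<lambda>x. a x * (F x - G x)) = (\<lambda>x. partial i (\<lambda>x. a x * F x) x - partial i (\<lambda>x. a x * G x) x)"
  by (rule ext) (simp add: right_diff_distrib partial_diff schwartz_differentiable schwartz_mult[OF assms(1)] assms)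

section \<open>The operators \<open>L_star\<close> and \<open>A_star\<close>, on Schwartz functions
  and in the limit\<close>

context
  fixes \<sigma> :: "real^'d::finite \<Rightarrow> real^'r::finite^'d" and b :: "real^'d \<Rightarrow> real^'d"
  assumes s: "\<And>i j. (\<lambda>x. \<sigma> x $ i $ j) \<in> symb 1" and ds: "\<And>i j k. partial k (\<lambda>x. \<sigma> x $ i $ j) \<in> symb 0"
    and b: "\<And>i. (\<lambda>x. b x $ i) \<in> symb 1" and db: "\<And>i k. partial k (\<lambda>x. b x $ i) \<in> symb 0"
begin

abbreviation (input) fld :: "'r \<Rightarrow> 'd \<Rightarrow> real^'d \<Rightarrow> real" where "fld r \<equiv> \<lambda>k x. \<sigma> x $ k $ r"

lemma fields: "fld r k \<in> symb 1" "partial l (fld r k) \<in> symb 0"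
  by (rule s) (rule ds)

lemma ss: "(\<lambda>x. \<sigma> x $ i $ r * \<sigma> x $ j $ r) \<in> symb 2"
  using symb_mult[OF s s] by simp

text \<open>\<open>L_star\<close> on functions, with \<open>\<sigma> \<sigma>^t\<close> split into
  columns so that \<open>field_energy\<close> applies to each; the link is
  \<open>L_star_of_fun\<close>.\<close>

definition gen_star :: "(real^'d \<Rightarrow> real) \<Rightarrow> real^'d \<Rightarrow> real" where
  "gen_star F x = 1/2 * (\<Sum>r\<in>UNIV. field_second (fld r) F x) - (\<Sum>i\<in>UNIV. partial i (\<lambda>x. b x $ i * F x) x)"

lemma gen_star_schwartz: "F \<in> schwartz \<Longrightarrow> gen_star F \<in> schwartz"
  unfolding gen_star_def[abs_def]
  by (intro schwartz_diff schwartz_cmult schwartz_sum field_second_schwartz fields schwartz_partial schwartz_mult[OF b])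

lemma field_star_diff:
  assumes "F \<in> schwartz" "G \<in> schwartz"
  shows "field_star (fld r) (\<lambda>x. F x - G x) x = field_star (fld r) F x - field_star (fld r) G x"
  by (simp add: field_star_def partial_mult_diff[OF s assms] sum_subtractf)

lemma gen_star_diff:
  assumes "F \<in> schwartz" "G \<in> schwartz"
  shows "gen_star (\<lambda>x. F x - G x) x = gen_star F x - gen_star G x"
proof -
  have eq: "partial k (partial l (\<lambda>x. (\<sigma> x $ k $ r * \<sigma> x $ l $ r) * (F x - G x))) x =
     partial k (partial l (\<lambda>x. (\<sigma> x $ k $ r * \<sigma> x $ l $ r) * F x)) x - partial k (partial l (\<lambda>x. (\<sigma> x $ k $ r * \<sigma> x $ l $ r) * G x)) x" for k l r
    unfolding partial_mult_diff[OF ss assms]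
    by (intro partial_diff schwartz_differentiable schwartz_partial schwartz_mult[OF ss] assms)
  show ?thesis
    unfolding gen_star_def field_second_def eq partial_mult_diff[OF b assms] sum_subtractf
    by (simp add: right_diff_distrib)
qed

lemma field_star_bound: "\<exists>C\<ge>0. \<forall>F\<in>schwartz. (LINT x|lborel. (field_star (fld r) F x)\<^sup>2) \<le> C * hn 4 F"
proof (rule second_order_hn)
  have "second_order (\<lambda>F x. (- 1) * (\<Sum>k\<in>UNIV. partial k (\<lambda>x. fld r k x * F x) x))"
    by (intro second_order_cmult second_order_sum second_order_partial1 symb_mono[OF s]) auto
  then show "second_order (field_star (fld r))"
    by (rule second_order_cong) (simp add: field_star_def)
qed (rule field_star_schwartz[OF fields])

lemma gen_star_second_order: "second_order gen_star"
proof (rule second_order_cong)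
  show "second_order (\<lambda>F x. 1/2 * (\<Sum>r\<in>UNIV. \<Sum>k\<in>UNIV. \<Sum>l\<in>UNIV. partial k (partial l (\<lambda>x. (\<sigma> x $ k $ r * \<sigma> x $ l $ r) * F x)) x)
      + (- 1) * (\<Sum>i\<in>UNIV. partial i (\<lambda>x. b x $ i * F x) x))"
    by (intro second_order_add second_order_cmult second_order_sum second_order_partial1 second_order_partial2 ss symb_mono[OF b]) auto
qed (simp add: gen_star_def field_second_def)

lemma A_star_of_fun:
  assumes F: "F \<in> schwartz" and h: "h \<in> schwartz"
  shows "A_star \<sigma> r (of_fun F) h = ip (field_star (fld r) F) h"
proof -
  have "(LINT x|lborel. F x * (\<sigma> x $ k $ r * partial k h x)) = - (LINT x|lborel. partial k (\<lambda>x. \<sigma> x $ k $ r * F x) x * h x)" for k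
    using integration_by_parts[OF schwartz_symb[OF schwartz_mult[OF s F]] h, of k k r] by (simp add: mult_ac)
  moreover have "(\<lambda>x. partial k (\<lambda>x. \<sigma> x $ k $ r * F x) x * h x) \<in> schwartz" for k
    by (intro schwartz_mult_schwartz schwartz_partial schwartz_mult[OF s] F h)
  ultimately show ?thesis
    by (simp add: A_star_def dist_partial_def dist_mult_def of_fun_def field_star_def sum_negf sum_distrib_right integral_schwartz_sum)
qed

lemma L_star_of_fun:
  assumes F: "F \<in> schwartz" and h: "h \<in> schwartz"
  shows "L_star \<sigma> b (of_fun F) h = ip (gen_star F) h"
proof -
  let ?a = "\<lambda>i j x. (\<sigma> x ** transpose (\<sigma> x)) $ i $ j"
  let ?P = "\<lambda>i j r. partial i (partial j (\<lambda>x. (\<sigma> x $ i $ r * \<sigma> x $ j $ r) * F x))"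
  have a: "?a i j x = (\<Sum>r\<in>UNIV. \<sigma> x $ i $ r * \<sigma> x $ j $ r)" for i j x
    by (simp add: matrix_matrix_mult_def transpose_def)
  have PS: "?P i j r \<in> schwartz" for i j r by (intro schwartz_partial schwartz_mult[OF ss] F)
  have PhS: "(\<lambda>x. ?P i j r x * h x) \<in> schwartz" for i j r by (intro schwartz_mult_schwartz PS h)
  \<comment> \<open>The test function carries \<open>partial j (partial i h)\<close>. Integrating by
    parts first in \<open>j\<close> and then in \<open>i\<close> gives exactly the order
    \<open>partial i (partial j ...)\<close> of \<open>?P\<close>, and the two signs cancel.\<close>
  have second: "(LINT x|lborel. F x * (?a i j x * partial j (partial i h) x)) = (\<Sum>r\<in>UNIV. LINT x|lborel. ?P i j r x * h x)" for i j
  proof -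
    have S: "(\<lambda>x. ((\<sigma> x $ i $ r * \<sigma> x $ j $ r) * F x) * partial j (partial i h) x) \<in> schwartz" for r
      by (intro schwartz_mult_schwartz schwartz_partial schwartz_mult[OF ss] F h)
    have "(LINT x|lborel. F x * (?a i j x * partial j (partial i h) x)) = (\<Sum>r\<in>UNIV. LINT x|lborel. ((\<sigma> x $ i $ r * \<sigma> x $ j $ r) * F x) * partial j (partial i h) x)"
      unfolding a integral_schwartz_sum[OF S, symmetric] by (simp add: sum_distrib_left sum_distrib_right mult_ac)
    moreover have "(LINT x|lborel. ((\<sigma> x $ i $ r * \<sigma> x $ j $ r) * F x) * partial j (partial i h) x) = (LINT x|lborel. ?P i j r x * h x)" for r
      using integration_by_parts[OF schwartz_symb[OF schwartz_mult[OF ss F]] schwartz_partial[OF h], of j i r j i]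
        integration_by_parts[OF schwartz_symb[OF schwartz_partial[OF schwartz_mult[OF ss F]]] h, of i j i r j]
      by simp
    ultimately show ?thesis by simp
  qed
  have bS: "(\<lambda>x. partial i (\<lambda>x. b x $ i * F x) x * h x) \<in> schwartz" for i
    by (intro schwartz_mult_schwartz schwartz_partial schwartz_mult[OF b] F h)
  have first: "(LINT x|lborel. F x * (b x $ i * partial i h x)) = - (LINT x|lborel. partial i (\<lambda>x. b x $ i * F x) x * h x)" for i
    using integration_by_parts[OF schwartz_symb[OF schwartz_mult[OF b F]] h, of i i] by (simp add: mult_ac)
  have "ip (gen_star F) h = (LINT x|lborel. 1/2 * (\<Sum>r\<in>UNIV. \<Sum>i\<in>UNIV. \<Sum>j\<in>UNIV. ?P i j r x * h x) + (- 1) * (\<Sum>i\<in>UNIV. partial i (\<lambda>x. b x $ i * F x) x * h x))"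
    by (simp add: gen_star_def field_second_def left_diff_distrib sum_distrib_right sum_negf mult.assoc)
  also have "\<dots> = 1/2 * (LINT x|lborel. (\<Sum>r\<in>UNIV. \<Sum>i\<in>UNIV. \<Sum>j\<in>UNIV. ?P i j r x * h x)) - (LINT x|lborel. (\<Sum>i\<in>UNIV. partial i (\<lambda>x. b x $ i * F x) x * h x))"
    by (rule integral_half_diff; intro schwartz_sum PhS bS)
  also have "\<dots> = 1/2 * (\<Sum>r\<in>UNIV. \<Sum>i\<in>UNIV. \<Sum>j\<in>UNIV. LINT x|lborel. ?P i j r x * h x) - (\<Sum>i\<in>UNIV. LINT x|lborel. partial i (\<lambda>x. b x $ i * F x) x * h x)"
    by (simp add: integral_schwartz_sum schwartz_sum PhS bS)
  also have "(\<Sum>r\<in>UNIV. \<Sum>i\<in>UNIV. \<Sum>j\<in>UNIV. LINT x|lborel. ?P i j r x * h x) = (\<Sum>i\<in>UNIV. \<Sum>j\<in>UNIV. \<Sum>r\<in>UNIV. LINT x|lborel. ?P i j r x * h x)"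
    by (subst sum.swap, subst (2) sum.swap) (rule refl)
  finally show ?thesis
    by (simp add: L_star_def dist_partial_def dist_mult_def of_fun_def second first sum_negf)
qed

definition potential :: "real^'d \<Rightarrow> real" where
  "potential x = (\<Sum>r\<in>UNIV. ((field_div (fld r) x)\<^sup>2 + field_trace (fld r) x) / 2) - (\<Sum>i\<in>UNIV. partial i (\<lambda>x. b x $ i) x)"

lemma potential_symb: "potential \<in> symb 0"
  unfolding potential_def[abs_def] by (intro symb_diff symb_sum field_potential_symb fields db)

text \<open>Sums \<open>field_energy\<close> over the columns: the factor 2 cancels the
  \<open>1/2\<close> in \<open>gen_star\<close>, and it also cancels the \<open>1/2\<close> that
  \<open>integral_divergence\<close> produces for the terms with \<open>b\<close>.\<close>

lemma schwartz_energy: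
  assumes F: "F \<in> schwartz"
  shows "2 * ip F (gen_star F) + (\<Sum>r\<in>UNIV. LINT x|lborel. (field_star (fld r) F x)\<^sup>2) = (LINT x|lborel. potential x * (F x)\<^sup>2)"
proof -
  have FF: "(\<lambda>x. (F x)\<^sup>2) \<in> schwartz" unfolding power2_eq_square by (rule schwartz_mult_schwartz[OF F F])
  let ?V = "\<lambda>r x. ((field_div (fld r) x)\<^sup>2 + field_trace (fld r) x) / 2"
  have V: "?V r \<in> symb 0" for r by (intro field_potential_symb fields)
  have VS: "(\<lambda>x. ?V r x * (F x)\<^sup>2) \<in> schwartz" for r by (rule schwartz_mult[OF V FF])
  have F2: "(\<lambda>x. F x * field_second (fld r) F x) \<in> schwartz" for r
    by (intro schwartz_mult_schwartz F field_second_schwartz fields)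
  have Fb: "(\<lambda>x. F x * partial i (\<lambda>x. b x $ i * F x) x) \<in> schwartz" for i
    by (intro schwartz_mult_schwartz F schwartz_partial schwartz_mult[OF b])
  have bS: "(\<lambda>x. partial i (\<lambda>x. b x $ i) x * (F x)\<^sup>2) \<in> schwartz" for i by (rule schwartz_mult[OF db FF])
  have "ip F (gen_star F) = (LINT x|lborel. 1/2 * (\<Sum>r\<in>UNIV. F x * field_second (fld r) F x) + (- 1) * (\<Sum>i\<in>UNIV. F x * partial i (\<lambda>x. b x $ i * F x) x))"
    by (simp add: gen_star_def right_diff_distrib sum_distrib_left sum_negf mult_ac)
  also have "\<dots> = 1/2 * (LINT x|lborel. (\<Sum>r\<in>UNIV. F x * field_second (fld r) F x)) - (LINT x|lborel. (\<Sum>i\<in>UNIV. F x * partial i (\<lambda>x. b x $ i * F x) x))"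
    by (rule integral_half_diff; intro schwartz_sum F2 Fb)
  also have "\<dots> = 1/2 * (\<Sum>r\<in>UNIV. ip F (field_second (fld r) F)) - (\<Sum>i\<in>UNIV. LINT x|lborel. F x * partial i (\<lambda>x. b x $ i * F x) x)"
    by (simp add: integral_schwartz_sum F2 Fb)
  finally have "2 * ip F (gen_star F) = (\<Sum>r\<in>UNIV. ip F (field_second (fld r) F)) - (\<Sum>i\<in>UNIV. LINT x|lborel. partial i (\<lambda>x. b x $ i) x * (F x)\<^sup>2)"
    by (simp add: integral_divergence[OF b F] sum_divide_distrib[symmetric])
  moreover have E: "ip F (field_second (fld r) F) + (LINT x|lborel. (field_star (fld r) F x)\<^sup>2) = (LINT x|lborel. ?V r x * (F x)\<^sup>2)" for r
    by (rule field_energy[OF fields F])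
  ultimately have "2 * ip F (gen_star F) + (\<Sum>r\<in>UNIV. LINT x|lborel. (field_star (fld r) F x)\<^sup>2) =
     (\<Sum>r\<in>UNIV. LINT x|lborel. ?V r x * (F x)\<^sup>2) - (\<Sum>i\<in>UNIV. LINT x|lborel. partial i (\<lambda>x. b x $ i) x * (F x)\<^sup>2)"
    unfolding E[symmetric] sum.distrib by linarith
  also have "\<dots> = (LINT x|lborel. (\<Sum>r\<in>UNIV. ?V r x * (F x)\<^sup>2) - (\<Sum>i\<in>UNIV. partial i (\<lambda>x. b x $ i) x * (F x)\<^sup>2))"
    unfolding integral_schwartz_sum[OF VS, symmetric] integral_schwartz_sum[OF bS, symmetric]
    by (rule Bochner_Integration.integral_diff[symmetric]; intro schwartz_integrable schwartz_sum VS bS)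
  finally show ?thesis by (simp add: potential_def left_diff_distrib sum_distrib_right)
qed

lemma schwartz_monotonicity:
  "\<exists>C>0. \<forall>F\<in>schwartz. 2 * ip F (gen_star F) + (\<Sum>r\<in>UNIV. LINT x|lborel. (field_star (fld r) F x)\<^sup>2) \<le> C * (LINT x|lborel. (F x)\<^sup>2)"
proof -
  obtain C where C: "C \<ge> 0" "\<And>x. \<bar>potential x\<bar> \<le> C * (1 + norm x) powr 0" using symb_boundE[OF potential_symb] by blast
  \<comment> \<open>The \<open>+ 1\<close> makes the constant strictly positive.\<close>
  have le: "potential x \<le> C + 1" for x using C(2)[of x] by (simp add: one_norm_nz)
  have "(LINT x|lborel. potential x * (F x)\<^sup>2) \<le> (C + 1) * (LINT x|lborel. (F x)\<^sup>2)" if F: "F \<in> schwartz" for F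
  proof -
    have FF: "(\<lambda>x. (F x)\<^sup>2) \<in> schwartz" unfolding power2_eq_square by (rule schwartz_mult_schwartz[OF F F])
    have "(LINT x|lborel. potential x * (F x)\<^sup>2) \<le> (LINT x|lborel. (C + 1) * (F x)\<^sup>2)"
      by (intro integral_mono schwartz_integrable schwartz_mult[OF potential_symb FF] schwartz_cmult FF mult_right_mono le) simp
    then show ?thesis by simp
  qed
  then show ?thesis using C(1) by (intro exI[of _ "C + 1"]) (auto simp: schwartz_energy)
qed

text \<open>Polarization writes \<open>2 * ip F (gen_star F)\<close> as half the difference of the
  squared norms of \<open>F + gen_star F\<close> and \<open>F - gen_star F\<close>. Every term of
  the inequality is then a squared \<open>L2\<close> norm, and \<open>operator_limit\<close> covers
  them all.\<close>

lemma hs_monotonicity: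
  assumes p: "p \<ge> 2"
  shows "\<exists>C>0. \<forall>\<phi>\<in>hermite_sobolev p. 2 * hs_inner 0 \<phi> (L_star \<sigma> b \<phi>) + (\<Sum>r\<in>UNIV. (hs_norm 0 (A_star \<sigma> r \<phi>))\<^sup>2) \<le> C * (hs_norm 0 \<phi>)\<^sup>2"
proof -
  obtain C where C: "C > 0" "\<And>F. F \<in> schwartz \<Longrightarrow> 2 * ip F (gen_star F) + (\<Sum>r\<in>UNIV. LINT x|lborel. (field_star (fld r) F x)\<^sup>2) \<le> C * (LINT x|lborel. (F x)\<^sup>2)"
    using schwartz_monotonicity by blast
  have "2 * hs_inner 0 \<phi> (L_star \<sigma> b \<phi>) + (\<Sum>r\<in>UNIV. (hs_norm 0 (A_star \<sigma> r \<phi>))\<^sup>2) \<le> C * (hs_norm 0 \<phi>)\<^sup>2"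
    if \<phi>: "\<phi> \<in> hermite_sobolev p" for \<phi>
  proof -
    obtain F where F: "\<And>n. F n \<in> schwartz"
      and cauchy: "\<forall>e>0. \<exists>N. \<forall>m\<ge>N. \<forall>n\<ge>N. hs_norm p (of_fun (\<lambda>x. F m x - F n x)) < e"
      and lim: "\<And>g. g \<in> schwartz \<Longrightarrow> (\<lambda>n. of_fun (F n) g) \<longlonglongrightarrow> \<phi> g"
      using \<phi> unfolding hermite_sobolev_def by blast
    have aS: "(\<lambda>x. (\<sigma> x ** transpose (\<sigma> x)) $ i $ j) \<in> symb 2" for i j
      using symb_sum[of UNIV "\<lambda>r x. \<sigma> x $ i $ r * \<sigma> x $ j $ r" 2] ss by (simp add: matrix_matrix_mult_def transpose_def)
    \<comment> \<open>On the distribution side the operator acts on the test function: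
      \<open>hermite k\<close> is differentiated and multiplied by a symbol, and stays Schwartz.
      Convergence of \<open>of_fun (F n)\<close> on Schwartz functions is therefore enough.\<close>
    have limA: "(\<lambda>n. ip (field_star (fld r) (F n)) (hermite k)) \<longlonglongrightarrow> A_star \<sigma> r \<phi> (hermite k)" for r k
      unfolding A_star_of_fun[OF F hermite_schwartz, symmetric] A_star_def dist_partial_def dist_mult_def
      by (intro tendsto_intros lim schwartz_mult[OF s] schwartz_partial hermite_schwartz)
    have limL: "(\<lambda>n. ip (gen_star (F n)) (hermite k)) \<longlonglongrightarrow> L_star \<sigma> b \<phi> (hermite k)" for k
      unfolding L_star_of_fun[OF F hermite_schwartz, symmetric] L_star_def dist_partial_def dist_mult_def
      by (intro tendsto_intros lim schwartz_mult[OF aS] schwartz_mult[OF b] schwartz_partial hermite_schwartz)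
    have lim0: "(\<lambda>n. ip (F n) (hermite k)) \<longlonglongrightarrow> \<phi> (hermite k)" for k
      using lim[OF hermite_schwartz] by (simp add: of_fun_def)
    have int: "integrable lborel (\<lambda>x. F n x * hermite k x)" "integrable lborel (\<lambda>x. gen_star (F n) x * hermite k x)" for n k
      by (intro schwartz_integrable schwartz_mult_schwartz F gen_star_schwartz hermite_schwartz)+
    have add: "(\<lambda>n. ip (\<lambda>x. F n x + gen_star (F n) x) (hermite k)) \<longlonglongrightarrow> \<phi> (hermite k) + L_star \<sigma> b \<phi> (hermite k)" for k
      using tendsto_add[OF lim0 limL] int by (simp add: distrib_right)
    have sub: "(\<lambda>n. ip (\<lambda>x. F n x - gen_star (F n) x) (hermite k)) \<longlonglongrightarrow> \<phi> (hermite k) - L_star \<sigma> b \<phi> (hermite k)" for k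
      using tendsto_diff[OF lim0 limL] int by (simp add: left_diff_distrib)
    have so0: "second_order (\<lambda>F x. F x)"
      by (rule second_order_cong[OF second_order_coeff[OF symb_const[of 2 1], of "[]"]]) auto
    \<comment> \<open>Instances for the identity, for the identity plus and minus
      \<open>gen_star\<close>, and for each \<open>field_star\<close>.\<close>
    note OL = operator_limit[OF F cauchy p]
    note L0 = OL[where T = "\<lambda>G. G", OF _ _ second_order_hn[OF so0] lim0]
    note Ladd = OL[where T = "\<lambda>G x. G x + gen_star G x", OF _ _ second_order_hn[OF second_order_add[OF so0 gen_star_second_order]] add]
    have so_sub: "second_order (\<lambda>F x. F x - gen_star F x)"
      by (rule second_order_cong[OF second_order_add[OF so0 second_order_cmult[OF gen_star_second_order, of "-1"]]]) simp
    note Lsub = OL[where T = "\<lambda>G x. G x - gen_star G x", OF _ _ second_order_hn[OF so_sub] sub]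
    note LA = OL[where T = "field_star (fld r)" for r, OF field_star_schwartz[OF fields] field_star_diff field_star_bound limA]
    let ?a = "\<lambda>k. \<phi> (hermite k)" and ?l = "\<lambda>k. L_star \<sigma> b \<phi> (hermite k)"
    have T: "G \<in> schwartz \<Longrightarrow> (\<lambda>x. G x + gen_star G x) \<in> schwartz" "G \<in> schwartz \<Longrightarrow> (\<lambda>x. G x - gen_star G x) \<in> schwartz" for G
      by (auto intro: schwartz_add schwartz_diff gen_star_schwartz)
    have l0: "(\<lambda>n. LINT x|lborel. (F n x)\<^sup>2) \<longlonglongrightarrow> (\<Sum>\<^sub>\<infinity>k. (?a k)\<^sup>2)" by (rule L0(2)) auto
    have la: "(\<lambda>k. (?a k + ?l k)\<^sup>2) summable_on UNIV" "(\<lambda>n. LINT x|lborel. (F n x + gen_star (F n) x)\<^sup>2) \<longlonglongrightarrow> (\<Sum>\<^sub>\<infinity>k. (?a k + ?l k)\<^sup>2)"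
      by (rule Ladd; simp add: T gen_star_diff)+
    have ls: "(\<lambda>k. (?a k - ?l k)\<^sup>2) summable_on UNIV" "(\<lambda>n. LINT x|lborel. (F n x - gen_star (F n) x)\<^sup>2) \<longlonglongrightarrow> (\<Sum>\<^sub>\<infinity>k. (?a k - ?l k)\<^sup>2)"
      by (rule Lsub; simp add: T gen_star_diff)+
    have lA: "(\<lambda>n. LINT x|lborel. (field_star (fld r) (F n) x)\<^sup>2) \<longlonglongrightarrow> (\<Sum>\<^sub>\<infinity>k. (A_star \<sigma> r \<phi> (hermite k))\<^sup>2)" for r
      by (rule LA(2))
    have le: "1/2 * ((LINT x|lborel. (F n x + gen_star (F n) x)\<^sup>2) - (LINT x|lborel. (F n x - gen_star (F n) x)\<^sup>2))
       + (\<Sum>r\<in>UNIV. LINT x|lborel. (field_star (fld r) (F n) x)\<^sup>2) \<le> C * (LINT x|lborel. (F n x)\<^sup>2)" for n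
    proof -
      have I: "integrable lborel (\<lambda>x. (F n x + gen_star (F n) x)\<^sup>2)" "integrable lborel (\<lambda>x. (F n x - gen_star (F n) x)\<^sup>2)"
        by (intro L2_integrable schwartz_L2 T F)+
      have "(LINT x|lborel. (F n x + gen_star (F n) x)\<^sup>2) - (LINT x|lborel. (F n x - gen_star (F n) x)\<^sup>2)
         = (LINT x|lborel. 4 * (F n x * gen_star (F n) x))"
        unfolding Bochner_Integration.integral_diff[OF I, symmetric]
        by (rule Bochner_Integration.integral_cong) (simp_all add: power2_sum power2_diff)
      then show ?thesis using C(2)[OF F[of n]] by simp
    qed
    have main: "1/2 * ((\<Sum>\<^sub>\<infinity>k. (?a k + ?l k)\<^sup>2) - (\<Sum>\<^sub>\<infinity>k. (?a k - ?l k)\<^sup>2))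
       + (\<Sum>r\<in>UNIV. \<Sum>\<^sub>\<infinity>k. (A_star \<sigma> r \<phi> (hermite k))\<^sup>2) \<le> C * (\<Sum>\<^sub>\<infinity>k. (?a k)\<^sup>2)"
    proof (rule LIMSEQ_le)
      show "(\<lambda>n. 1/2 * ((LINT x|lborel. (F n x + gen_star (F n) x)\<^sup>2) - (LINT x|lborel. (F n x - gen_star (F n) x)\<^sup>2))
         + (\<Sum>r\<in>UNIV. LINT x|lborel. (field_star (fld r) (F n) x)\<^sup>2)) \<longlonglongrightarrow>
        1/2 * ((\<Sum>\<^sub>\<infinity>k. (?a k + ?l k)\<^sup>2) - (\<Sum>\<^sub>\<infinity>k. (?a k - ?l k)\<^sup>2)) + (\<Sum>r\<in>UNIV. \<Sum>\<^sub>\<infinity>k. (A_star \<sigma> r \<phi> (hermite k))\<^sup>2)"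
        by (intro tendsto_add tendsto_mult tendsto_const tendsto_diff tendsto_sum la ls lA)
      show "(\<lambda>n. C * (LINT x|lborel. (F n x)\<^sup>2)) \<longlonglongrightarrow> C * (\<Sum>\<^sub>\<infinity>k. (?a k)\<^sup>2)"
        by (intro tendsto_mult tendsto_const l0)
    qed (use le in blast)
    \<comment> \<open>Order 0 makes every weight 1, because the weight is positive.\<close>
    have w: "real (2 * (\<Sum>i\<in>UNIV. k i) + CARD('d)) powr (2 * 0) = 1" for k :: "'d \<Rightarrow> nat"
      using weight_ge_1[of k] by (simp add: weight_def)
    have inner: "hs_inner 0 u v = (\<Sum>\<^sub>\<infinity>k. u (hermite k) * v (hermite k))" for u v :: "'d functional"
      unfolding hs_inner_def w by simp
    have norm: "(hs_norm 0 u)\<^sup>2 = (\<Sum>\<^sub>\<infinity>k. (u (hermite k))\<^sup>2)" for u :: "'d functional"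
      unfolding hs_norm_def inner by (simp add: infsum_nonneg power2_eq_square)
    \<comment> \<open>The same polarization for the limit. Writing the products as a combination of
      two summable families of squares is also what justifies splitting the
      \<open>infsum\<close>.\<close>
    have "hs_inner 0 \<phi> (L_star \<sigma> b \<phi>) = (\<Sum>\<^sub>\<infinity>k. 1/4 * (?a k + ?l k)\<^sup>2 + (- 1/4) * (?a k - ?l k)\<^sup>2)"
      unfolding inner by (rule infsum_cong) (simp add: power2_sum power2_diff field_simps)
    also have "\<dots> = 1/4 * (\<Sum>\<^sub>\<infinity>k. (?a k + ?l k)\<^sup>2) + (- 1/4) * (\<Sum>\<^sub>\<infinity>k. (?a k - ?l k)\<^sup>2)"
      by (simp only: infsum_add[OF summable_on_cmult_right[OF la(1)] summable_on_cmult_right[OF ls(1)]] infsum_cmult_right la(1) ls(1))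
    finally show ?thesis using main unfolding norm by (simp add: field_simps)
  qed
  then show ?thesis using C(1) by blast
qed

end

theorem theorem4p4:
  fixes \<sigma> :: "real^'d::finite \<Rightarrow> real^'r::finite^'d"
    and b :: "real^'d \<Rightarrow> real^'d"
    and p :: real
  assumes "\<And>i j. C_infinity (\<lambda>x. \<sigma> x $ i $ j)"
    and "\<And>i j. bounded_derivatives (\<lambda>x. \<sigma> x $ i $ j)"
    and "\<And>i. C_infinity (\<lambda>x. b x $ i)"
    and "\<And>i. bounded_derivatives (\<lambda>x. b x $ i)"
    and "p \<ge> 5"
  shows "\<forall>K :: (real^'d) set. compact K \<longrightarrow>
    (\<exists>C>0. \<forall>\<phi> \<in> hermite_sobolev p \<inter> dist_supported_in K.
       2 * hs_inner 0 \<phi> (L_star \<sigma> b \<phi>) + (\<Sum>i\<in>UNIV. (hs_norm 0 (A_star \<sigma> i \<phi>))\<^sup>2)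
         \<le> C * (hs_norm 0 \<phi>)\<^sup>2)"
proof -
  have "\<exists>C>0. \<forall>\<phi>\<in>hermite_sobolev p. 2 * hs_inner 0 \<phi> (L_star \<sigma> b \<phi>) + (\<Sum>r\<in>UNIV. (hs_norm 0 (A_star \<sigma> r \<phi>))\<^sup>2) \<le> C * (hs_norm 0 \<phi>)\<^sup>2"
    by (rule hs_monotonicity)
      (use assms in \<open>auto intro: bounded_derivatives_symb bounded_derivatives_partial\<close>)
  then show ?thesis by blast
qed

end
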